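(* Let $T>0$ be any finite time horizon. Assume: (i) $\Delta_2$ is invertible; (ii) the algebraic Riccati equation $A_{22}^*P+PA_{22}+P\Delta_2P+Q_2=0$ admits a solution $\overline P_{22}\in\mathbb S^{n_2}$ such that all eigenvalues of $S:=A_{22}+\Delta_2\overline P_{22}$ have strictly negative real parts; (iii) the differential Riccati equation $\frac{d\overline P_{11}}{dt}+\widetilde A^*\overline P_{11}+\overline P_{11}\widetilde A+\overline P_{11}M\overline P_{11}+N=0$ on $[0,T]$, $\overline P_{11}(T)=0$, admits a unique solution $\overline P_{11}\in C([0,T];\mathbb S^{n_1})$; (iv) there is $\gamma>0$ with $\frac12(S^*+S)\le-\gamma I$; (v) for some $\delta\in(0,\gamma)$, $-\overline P_{22}$ lies in the interior of the closed ball $B_{\delta,q_2}$. Then there exists a Tikhonov threshold $\epsilon^*$ (defined in the context) such that for all $0<\epsilon<\epsilon^*$ the generalised Riccati equation $$\dot P^\epsilon+(A^\epsilon)^*P^\epsilon+P^\epsilon A^\epsilon-P^\epsilon B^\epsilon R^{-1}(B^\epsilon)^*P^\epsilon+Q=0,\qquad P^\epsilon(T)=0,$$ admits a unique solution $$P^\epsilon(t)=\begin{pmatrix}P_{11}^\epsilon(t)&\epsilon P_{12}^\epsilon(t)\\ \epsilon(P_{12}^\epsilon(t))^*&\epsilon P_{22}^\epsilon(t)\end{pmatrix},\quad t\in[0,T],$$ in the space $C([0,T];\mathbb S^{n})$, where $(P_{11}^\epsilon,P_{12}^\epsilon,P_{22}^\epsilon)$ is the unique solution of the full system. Moreover, $$P^\epsilon(t)-\begin{pmatrix}\overline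 P_{11}(t)&0\\0&0\end{pmatrix}=O(\epsilon),\qquad\forall t\in[0,T].$$
   Context: Notation: $M^*$ is the transpose of $M$; $\mathbb S^m$ is the space of symmetric $m\times m$ real matrices; matrices carry the inner product $\langle M,N\rangle=\mathrm{tr}(M^*N)$ and norm $|M|=\langle M,M\rangle^{1/2}$. $O(\epsilon)$ denotes a quantity bounded in norm by $C\epsilon$ for all $0<\epsilon<\epsilon^*$, with $C$ independent of $\epsilon$ and $t$. Data: $n_1,n_2,k_1,k_2\ge1$ are integers, $n=n_1+n_2$; for $i,j\in\{1,2\}$, $A_{ij}\in\mathbb R^{n_i\times n_j}$, $B_{ij}\in\mathbb R^{n_i\times k_j}$, $Q_i\in\mathbb S^{n_i}$ are constant matrices. The perturbation parameter satisfies $0<\epsilon\le1$. Put $\Delta_1=B_{11}B_{11}^*-B_{12}B_{12}^*$, $\Delta=B_{11}B_{21}^*-B_{12}B_{22}^*$, $\Delta_2=B_{21}B_{21}^*-B_{22}B_{22}^*$, and $A^\epsilon=\begin{pmatrix}A_{11}&A_{12}\\ \frac1\epsilon A_{21}&\frac1\epsilon A_{22}\end{pmatrix}$, $B^\epsilon=\begin{pmatrix}B_{11}&B_{12}\\ \frac1\epsilon B_{21}&\frac1\epsilon B_{22}\end{pmatrix}$, $Q=\begin{pmatrix}Q_1&0\\0&Q_2\end{pmatrix}$, $R=\begin{pmatrix}-I&0\\0&I\end{pmatrix}$ (blocks of sizes $k_1,k_2$). Full system: $\frac{dP_{11}^\epsilon}{dt}+f(P_{11}^\epsilon,P_{12}^\epsilon,P_{22}^\epsilon,\epsilon)=0$,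 $\epsilon\frac{dP_{12}^\epsilon}{dt}+g_1(P_{11}^\epsilon,P_{12}^\epsilon,P_{22}^\epsilon,\epsilon)=0$, $\epsilon\frac{dP_{22}^\epsilon}{dt}+g_2(P_{11}^\epsilon,P_{12}^\epsilon,P_{22}^\epsilon,\epsilon)=0$ on $[0,T]$, with $P_{11}^\epsilon(T)=0$, $P_{12}^\epsilon(T)=0$, $P_{22}^\epsilon(T)=0$, where $f(P_{11},P_{12},P_{22},\epsilon)=A_{11}^*P_{11}+A_{21}^*P_{12}^*+P_{11}A_{11}+P_{12}A_{21}+P_{11}\Delta_1P_{11}+P_{12}\Delta^*P_{11}+P_{11}\Delta P_{12}^*+P_{12}\Delta_2P_{12}^*+Q_1$; $g_1(P_{11},P_{12},P_{22},\epsilon)=\epsilon A_{11}^*P_{12}+A_{21}^*P_{22}+P_{11}A_{12}+P_{12}A_{22}+\epsilon P_{11}\Delta_1P_{12}+\epsilon P_{12}\Delta^*P_{12}+P_{11}\Delta P_{22}+P_{12}\Delta_2P_{22}$; $g_2(P_{11},P_{12},P_{22},\epsilon)=\epsilon A_{12}^*P_{12}+A_{22}^*P_{22}+\epsilon P_{12}^*A_{12}+P_{22}A_{22}+\epsilon^2P_{12}^*\Delta_1P_{12}+\epsilon P_{12}^*\Delta P_{22}+\epsilon P_{22}\Delta^*P_{12}+P_{22}\Delta_2P_{22}+Q_2$. Coefficients of the reduced differential Riccati equation: with $\Lambda=A_{22}^*\Delta_2^{-1}A_{22}-Q_2$ (which is invertible under (i) and (ii)), $\widetilde A=A_{11}-\Delta\Delta_2^{-1}[\Delta_2-A_{22}\Lambda^{-1}A_{22}^*]\Delta_2^{-1}A_{21}-A_{12}\Lambda^{-1}A_{22}^*\Delta_2^{-1}A_{21}$;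 $M=\Delta_1+A_{12}\Lambda^{-1}A_{12}^*-\Delta\Delta_2^{-1}A_{22}\Lambda^{-1}A_{12}^*-A_{12}\Lambda^{-1}A_{22}^*\Delta_2^{-1}\Delta^*-\Delta\Delta_2^{-1}[\Delta_2-A_{22}\Lambda^{-1}A_{22}^*]\Delta_2^{-1}\Delta^*$; $N=Q_1-A_{21}^*\Delta_2^{-1}[\Delta_2-A_{22}\Lambda^{-1}A_{22}^*]\Delta_2^{-1}A_{21}$. For $0<\delta<\gamma$ let $\mathcal R_\delta=\{P\in\mathbb S^{n_2}:\frac12[(S+\Delta_2P)^*+(S+\Delta_2P)]\le\delta I\}$; $B_{\delta,q_2}$ is the largest closed ball centred at $0$ in $\mathbb S^{n_2}$ contained in $\mathcal R_\delta$, and $q_2$ is its radius. Let $h(P_{11})=-(A_{21}^*\overline P_{22}+P_{11}A_{12}+P_{11}\Delta\overline P_{22})(A_{22}+\Delta_2\overline P_{22})^{-1}$ and $\overline P_{12}(t)=h(\overline P_{11}(t))$. The boundary-layer system on $\tau\ge0$ is $\frac{d\widehat P_{12}}{d\tau}=g_1(0,\widehat P_{12}+h(0),\widehat P_{22}+\overline P_{22},0)$, $\widehat P_{12}(0)=-h(0)$; $\frac{d\widehat P_{22}}{d\tau}=g_2(0,\widehat P_{12}+h(0),\widehat P_{22}+\overline P_{22},0)$, $\widehat P_{22}(0)=-\overline P_{22}$. Tikhonov threshold: a number $\epsilon^*\in(0,1]$ such that for all $0<\epsilon<\epsilon^*$ the full system has a unique solution $(P_{11}^\epsilon,P_{12}^\epsilon,P_{22}^\epsilon)\in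 C([0,T];\mathbb S^{n_1})\times C([0,T];\mathbb R^{n_1\times n_2})\times C([0,T];\mathbb S^{n_2})$, and, uniformly in $t\in[0,T]$, $P_{11}^\epsilon(t)-\overline P_{11}(t)=O(\epsilon)$, $P_{12}^\epsilon(t)-\overline P_{12}(t)-\widehat P_{12}((T-t)/\epsilon)=O(\epsilon)$, $P_{22}^\epsilon(t)-\overline P_{22}-\widehat P_{22}((T-t)/\epsilon)=O(\epsilon)$. *)

theory Defs
  imports "HOL-Analysis.Analysis"
begin

text \<open>
  Matrices in \<open>\<real>\<^sup>m\<^sup>\<times>\<^sup>n\<close> have type \<^typ>\<open>real^'n^'m\<close>. The library's inner product and norm on this type
  are \<open>tr (M\<^sup>* N)\<close> and the Frobenius norm. Its order \<open>\<le>\<close> is entrywise, so the order of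
  symmetric matrices is defined separately.
\<close>

definition sym_mats :: "(real^'n^'n) set" where
  "sym_mats = {M. transpose M = M}"

definition psd_le :: "real^'n^'n \<Rightarrow> real^'n^'n \<Rightarrow> bool" where
  "psd_le M N \<longleftrightarrow> (\<forall>x. x \<bullet> (M *v x) \<le> x \<bullet> (N *v x))"

definition complex_eigenvalue :: "real^'n^'n \<Rightarrow> complex \<Rightarrow> bool" where
  "complex_eigenvalue M z \<longleftrightarrow>
     (\<exists>v::complex^'n. v \<noteq> 0 \<and> map_matrix complex_of_real M *v v = z *s v)"

definition block_mat ::
  "real^'n1^'m1 \<Rightarrow> real^'n2^'m1 \<Rightarrow> real^'n1^'m2 \<Rightarrow> real^'n2^'m2 \<Rightarrow> real^('n1 + 'n2)^('m1 + 'm2)" where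
  "block_mat M11 M12 M21 M22 = (\<chi> i j. case i of
       Inl a \<Rightarrow> (case j of Inl b \<Rightarrow> M11 $ a $ b | Inr b \<Rightarrow> M12 $ a $ b)
     | Inr a \<Rightarrow> (case j of Inl b \<Rightarrow> M21 $ a $ b | Inr b \<Rightarrow> M22 $ a $ b))"

text \<open>
  A curve in a solution space is only constrained on its interval of definition, so uniqueness
  means agreement there. Derivatives at the end points are one-sided.
\<close>

definition unique_solution_on :: "real set \<Rightarrow> ((real \<Rightarrow> 'a) \<Rightarrow> bool) \<Rightarrow> (real \<Rightarrow> 'a) \<Rightarrow> bool" where
  "unique_solution_on I sol X \<longleftrightarrow> sol X \<and> (\<forall>Y. sol Y \<longrightarrow> (\<forall>t\<in>I. Y t = X t))"

record ('n1, 'n2, 'k1, 'k2) riccati_data =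
  A11 :: "real^'n1^'n1"
  A12 :: "real^'n2^'n1"
  A21 :: "real^'n1^'n2"
  A22 :: "real^'n2^'n2"
  B11 :: "real^'k1^'n1"
  B12 :: "real^'k2^'n1"
  B21 :: "real^'k1^'n2"
  B22 :: "real^'k2^'n2"
  Q1 :: "real^'n1^'n1"
  Q2 :: "real^'n2^'n2"

definition Delta1 ::
  "('n1::finite, 'n2::finite, 'k1::finite, 'k2::finite) riccati_data \<Rightarrow> real^'n1^'n1" where
  "Delta1 d = B11 d ** transpose (B11 d) - B12 d ** transpose (B12 d)"

definition Delta ::
  "('n1::finite, 'n2::finite, 'k1::finite, 'k2::finite) riccati_data \<Rightarrow> real^'n2^'n1" where
  "Delta d = B11 d ** transpose (B21 d) - B12 d ** transpose (B22 d)"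

definition Delta2 ::
  "('n1::finite, 'n2::finite, 'k1::finite, 'k2::finite) riccati_data \<Rightarrow> real^'n2^'n2" where
  "Delta2 d = B21 d ** transpose (B21 d) - B22 d ** transpose (B22 d)"


subsection \<open>The generalised Riccati equation\<close>

definition Aeps ::
  "('n1::finite, 'n2::finite, 'k1::finite, 'k2::finite) riccati_data \<Rightarrow> real \<Rightarrow>
   real^('n1 + 'n2)^('n1 + 'n2)" where
  "Aeps d \<epsilon> = block_mat (A11 d) (A12 d) ((1 / \<epsilon>) *\<^sub>R A21 d) ((1 / \<epsilon>) *\<^sub>R A22 d)"

definition Beps ::
  "('n1::finite, 'n2::finite, 'k1::finite, 'k2::finite) riccati_data \<Rightarrow> real \<Rightarrow>
   real^('k1 + 'k2)^('n1 + 'n2)" where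
  "Beps d \<epsilon> = block_mat (B11 d) (B12 d) ((1 / \<epsilon>) *\<^sub>R B21 d) ((1 / \<epsilon>) *\<^sub>R B22 d)"

definition Qmat ::
  "('n1::finite, 'n2::finite, 'k1::finite, 'k2::finite) riccati_data \<Rightarrow>
   real^('n1 + 'n2)^('n1 + 'n2)" where
  "Qmat d = block_mat (Q1 d) 0 0 (Q2 d)"

definition Rmat :: "real^('k1 + 'k2)^('k1::finite + 'k2::finite)" where
  "Rmat = block_mat (- mat 1) 0 0 (mat 1)"

definition riccati_solution ::
  "('n1::finite, 'n2::finite, 'k1::finite, 'k2::finite) riccati_data \<Rightarrow> real \<Rightarrow> real \<Rightarrow>
   (real \<Rightarrow> real^('n1 + 'n2)^('n1 + 'n2)) \<Rightarrow> bool" where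
  "riccati_solution d T \<epsilon> P \<longleftrightarrow>
     continuous_on {0..T} P \<and> (\<forall>t\<in>{0..T}. P t \<in> sym_mats) \<and>
     (\<forall>t\<in>{0..T}. \<exists>P'. (P has_vector_derivative P') (at t within {0..T}) \<and>
        P' + transpose (Aeps d \<epsilon>) ** P t + P t ** Aeps d \<epsilon>
          - P t ** Beps d \<epsilon> ** matrix_inv Rmat ** transpose (Beps d \<epsilon>) ** P t + Qmat d = 0) \<and>
     P T = 0"


subsection \<open>The full singularly perturbed system\<close>

definition full_f ::
  "('n1::finite, 'n2::finite, 'k1::finite, 'k2::finite) riccati_data \<Rightarrow>
   real^'n1^'n1 \<Rightarrow> real^'n2^'n1 \<Rightarrow> real^'n2^'n2 \<Rightarrow> real \<Rightarrow> real^'n1^'n1" where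
  "full_f d P11 P12 P22 \<epsilon> =
     transpose (A11 d) ** P11 + transpose (A21 d) ** transpose P12 + P11 ** A11 d + P12 ** A21 d
     + P11 ** Delta1 d ** P11 + P12 ** transpose (Delta d) ** P11
     + P11 ** Delta d ** transpose P12 + P12 ** Delta2 d ** transpose P12 + Q1 d"

definition full_g1 ::
  "('n1::finite, 'n2::finite, 'k1::finite, 'k2::finite) riccati_data \<Rightarrow>
   real^'n1^'n1 \<Rightarrow> real^'n2^'n1 \<Rightarrow> real^'n2^'n2 \<Rightarrow> real \<Rightarrow> real^'n2^'n1" where
  "full_g1 d P11 P12 P22 \<epsilon> =
     \<epsilon> *\<^sub>R (transpose (A11 d) ** P12) + transpose (A21 d) ** P22 + P11 ** A12 d + P12 ** A22 d
     + \<epsilon> *\<^sub>R (P11 ** Delta1 d ** P12) + \<epsilon> *\<^sub>R (P12 ** transpose (Delta d) ** P12)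
     + P11 ** Delta d ** P22 + P12 ** Delta2 d ** P22"

definition full_g2 ::
  "('n1::finite, 'n2::finite, 'k1::finite, 'k2::finite) riccati_data \<Rightarrow>
   real^'n1^'n1 \<Rightarrow> real^'n2^'n1 \<Rightarrow> real^'n2^'n2 \<Rightarrow> real \<Rightarrow> real^'n2^'n2" where
  "full_g2 d P11 P12 P22 \<epsilon> =
     \<epsilon> *\<^sub>R (transpose (A12 d) ** P12) + transpose (A22 d) ** P22
     + \<epsilon> *\<^sub>R (transpose P12 ** A12 d) + P22 ** A22 d
     + \<epsilon>\<^sup>2 *\<^sub>R (transpose P12 ** Delta1 d ** P12) + \<epsilon> *\<^sub>R (transpose P12 ** Delta d ** P22)
     + \<epsilon> *\<^sub>R (P22 ** transpose (Delta d) ** P12) + P22 ** Delta2 d ** P22 + Q2 d"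

definition full_solution ::
  "('n1::finite, 'n2::finite, 'k1::finite, 'k2::finite) riccati_data \<Rightarrow> real \<Rightarrow> real \<Rightarrow>
   (real \<Rightarrow> (real^'n1^'n1) \<times> (real^'n2^'n1) \<times> (real^'n2^'n2)) \<Rightarrow> bool" where
  "full_solution d T \<epsilon> P \<longleftrightarrow>
     continuous_on {0..T} P \<and> (\<forall>t\<in>{0..T}. P t \<in> sym_mats \<times> UNIV \<times> sym_mats) \<and>
     (\<forall>t\<in>{0..T}. \<exists>P11' P12' P22'.
        (P has_vector_derivative (P11', P12', P22')) (at t within {0..T}) \<and>
        (case P t of (P11, P12, P22) \<Rightarrow>
           P11' + full_f d P11 P12 P22 \<epsilon> = 0 \<and>
           \<epsilon> *\<^sub>R P12' + full_g1 d P11 P12 P22 \<epsilon> = 0 \<and>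
           \<epsilon> *\<^sub>R P22' + full_g2 d P11 P12 P22 \<epsilon> = 0)) \<and>
     P T = (0, 0, 0)"


subsection \<open>The reduced Riccati equation\<close>

definition Lam ::
  "('n1::finite, 'n2::finite, 'k1::finite, 'k2::finite) riccati_data \<Rightarrow> real^'n2^'n2" where
  "Lam d = transpose (A22 d) ** matrix_inv (Delta2 d) ** A22 d - Q2 d"

definition Atilde ::
  "('n1::finite, 'n2::finite, 'k1::finite, 'k2::finite) riccati_data \<Rightarrow> real^'n1^'n1" where
  "Atilde d = (let D = Delta d; D2 = Delta2 d; D2i = matrix_inv D2; Li = matrix_inv (Lam d) in
     A11 d - D ** D2i ** (D2 - A22 d ** Li ** transpose (A22 d)) ** D2i ** A21 d
     - A12 d ** Li ** transpose (A22 d) ** D2i ** A21 d)"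

definition Mred ::
  "('n1::finite, 'n2::finite, 'k1::finite, 'k2::finite) riccati_data \<Rightarrow> real^'n1^'n1" where
  "Mred d = (let D = Delta d; D2 = Delta2 d; D2i = matrix_inv D2; Li = matrix_inv (Lam d) in
     Delta1 d + A12 d ** Li ** transpose (A12 d)
     - D ** D2i ** A22 d ** Li ** transpose (A12 d)
     - A12 d ** Li ** transpose (A22 d) ** D2i ** transpose D
     - D ** D2i ** (D2 - A22 d ** Li ** transpose (A22 d)) ** D2i ** transpose D)"

definition Nred ::
  "('n1::finite, 'n2::finite, 'k1::finite, 'k2::finite) riccati_data \<Rightarrow> real^'n1^'n1" where
  "Nred d = (let D2 = Delta2 d; D2i = matrix_inv D2; Li = matrix_inv (Lam d) in
     Q1 d - transpose (A21 d) ** D2i ** (D2 - A22 d ** Li ** transpose (A22 d)) ** D2i ** A21 d)"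

definition reduced_solution ::
  "('n1::finite, 'n2::finite, 'k1::finite, 'k2::finite) riccati_data \<Rightarrow> real \<Rightarrow>
   (real \<Rightarrow> real^'n1^'n1) \<Rightarrow> bool" where
  "reduced_solution d T P \<longleftrightarrow>
     continuous_on {0..T} P \<and> (\<forall>t\<in>{0..T}. P t \<in> sym_mats) \<and>
     (\<forall>t\<in>{0..T}. \<exists>P'. (P has_vector_derivative P') (at t within {0..T}) \<and>
        P' + transpose (Atilde d) ** P t + P t ** Atilde d + P t ** Mred d ** P t + Nred d = 0) \<and>
     P T = 0"


subsection \<open>The algebraic Riccati equation and the boundary layer\<close>

definition algebraic_riccati ::
  "('n1::finite, 'n2::finite, 'k1::finite, 'k2::finite) riccati_data \<Rightarrow> real^'n2^'n2 \<Rightarrow> bool" where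
  "algebraic_riccati d P \<longleftrightarrow>
     transpose (A22 d) ** P + P ** A22 d + P ** Delta2 d ** P + Q2 d = 0"

definition Smat ::
  "('n1::finite, 'n2::finite, 'k1::finite, 'k2::finite) riccati_data \<Rightarrow> real^'n2^'n2 \<Rightarrow>
   real^'n2^'n2" where
  "Smat d Pbar22 = A22 d + Delta2 d ** Pbar22"

definition hmap ::
  "('n1::finite, 'n2::finite, 'k1::finite, 'k2::finite) riccati_data \<Rightarrow> real^'n2^'n2 \<Rightarrow>
   real^'n1^'n1 \<Rightarrow> real^'n2^'n1" where
  "hmap d Pbar22 P11 =
     - ((transpose (A21 d) ** Pbar22 + P11 ** A12 d + P11 ** Delta d ** Pbar22)
        ** matrix_inv (A22 d + Delta2 d ** Pbar22))"

definition boundary_layer_solution ::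
  "('n1::finite, 'n2::finite, 'k1::finite, 'k2::finite) riccati_data \<Rightarrow> real^'n2^'n2 \<Rightarrow>
   (real \<Rightarrow> (real^'n2^'n1) \<times> (real^'n2^'n2)) \<Rightarrow> bool" where
  "boundary_layer_solution d Pbar22 Y \<longleftrightarrow>
     continuous_on {0..} Y \<and> (\<forall>\<tau>\<in>{0..}. Y \<tau> \<in> UNIV \<times> sym_mats) \<and>
     (\<forall>\<tau>\<in>{0..}. (Y has_vector_derivative
        (case Y \<tau> of (Y12, Y22) \<Rightarrow>
           (full_g1 d 0 (Y12 + hmap d Pbar22 0) (Y22 + Pbar22) 0,
            full_g2 d 0 (Y12 + hmap d Pbar22 0) (Y22 + Pbar22) 0))) (at \<tau> within {0..})) \<and>
     Y 0 = (- hmap d Pbar22 0, - Pbar22)"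

definition Rset ::
  "('n1::finite, 'n2::finite, 'k1::finite, 'k2::finite) riccati_data \<Rightarrow> real^'n2^'n2 \<Rightarrow> real \<Rightarrow>
   (real^'n2^'n2) set" where
  "Rset d Pbar22 \<delta> = {P \<in> sym_mats.
     psd_le ((1/2) *\<^sub>R (transpose (Smat d Pbar22 + Delta2 d ** P) + (Smat d Pbar22 + Delta2 d ** P)))
            (\<delta> *\<^sub>R mat 1)}"

text \<open>
  The maximum below exists whenever \<open>\<Delta>\<^sub>2 \<noteq> 0\<close> and \<open>0\<close> belongs to \<^const>\<open>Rset\<close>: the set is closed,
  and it does not contain \<open>c \<Delta>\<^sub>2\<close> for large \<open>c\<close>.
\<close>

definition q2_radius ::
  "('n1::finite, 'n2::finite, 'k1::finite, 'k2::finite) riccati_data \<Rightarrow> real^'n2^'n2 \<Rightarrow> real \<Rightarrow>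
   real" where
  "q2_radius d Pbar22 \<delta> = (GREATEST r. 0 \<le> r \<and> cball 0 r \<inter> sym_mats \<subseteq> Rset d Pbar22 \<delta>)"

definition Bball ::
  "('n1::finite, 'n2::finite, 'k1::finite, 'k2::finite) riccati_data \<Rightarrow> real^'n2^'n2 \<Rightarrow> real \<Rightarrow>
   (real^'n2^'n2) set" where
  "Bball d Pbar22 \<delta> = cball 0 (q2_radius d Pbar22 \<delta>) \<inter> sym_mats"


subsection \<open>Tikhonov thresholds\<close>

text \<open>
  The outer approximation of \<open>P\<^sub>1\<^sub>2\<close> is \<open>h (Pbar11 t)\<close>; \<open>Phat\<close> is the boundary-layer pair, in the
  stretched time \<open>(T - t) / \<epsilon>\<close>. Each \<open>O(\<epsilon>)\<close> is one constant for all \<open>0 < \<epsilon> < \<epsilon>s\<close> and all \<open>t\<close>.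
\<close>

definition tikhonov_threshold ::
  "('n1::finite, 'n2::finite, 'k1::finite, 'k2::finite) riccati_data \<Rightarrow> real \<Rightarrow>
   (real \<Rightarrow> real^'n1^'n1) \<Rightarrow> real^'n2^'n2 \<Rightarrow> (real \<Rightarrow> (real^'n2^'n1) \<times> (real^'n2^'n2)) \<Rightarrow>
   real \<Rightarrow> bool" where
  "tikhonov_threshold d T Pbar11 Pbar22 Phat \<epsilon>s \<longleftrightarrow>
     0 < \<epsilon>s \<and> \<epsilon>s \<le> 1 \<and>
     (\<forall>\<epsilon>. 0 < \<epsilon> \<and> \<epsilon> < \<epsilon>s \<longrightarrow> (\<exists>P. unique_solution_on {0..T} (full_solution d T \<epsilon>) P)) \<and>
     (\<exists>C. \<forall>\<epsilon> P11 P12 P22. 0 < \<epsilon> \<and> \<epsilon> < \<epsilon>s \<and> full_solution d T \<epsilon> (\<lambda>t. (P11 t, P12 t, P22 t)) \<longrightarrow>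
        (\<forall>t\<in>{0..T}.
           norm (P11 t - Pbar11 t) \<le> C * \<epsilon> \<and>
           norm (P12 t - hmap d Pbar22 (Pbar11 t) - fst (Phat ((T - t) / \<epsilon>))) \<le> C * \<epsilon> \<and>
           norm (P22 t - Pbar22 - snd (Phat ((T - t) / \<epsilon>))) \<le> C * \<epsilon>))"

end

theory Submission
  imports Defs
begin

text \<open>
  The full system is a singularly perturbed terminal value problem. Running time backwards,
  \<open>s = T - t\<close>, makes it an initial value problem whose fast variables \<open>P\<^sub>1\<^sub>2\<close> and \<open>P\<^sub>2\<^sub>2\<close> are
  attracted to the equilibrium \<open>(h P\<^sub>1\<^sub>1, Pb)\<close>: its linearisation is governed by \<open>S\<close>, whose
  symmetric part is at most \<open>-\<gamma>\<close>. Three facts carry the proof.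

  On the equilibrium the slow equation is the reduced Riccati equation (\<open>reduced_equation\<close>). This
  is a completion of the square, resting on \<open>\<Lambda> = S\<^sup>* \<Delta>\<^sub>2\<^sup>-\<^sup>1 S\<close>.

  The boundary layer, which starts at distance of order one from the equilibrium, decays
  exponentially (\<open>boundary_layer\<close>). The ball \<open>B\<^sub>\<delta>\<close> is made for this: as long as the deviation
  \<open>X\<close> of \<open>P\<^sub>2\<^sub>2\<close> from \<open>Pb\<close> lies in it, the symmetric part of \<open>2 S + \<Delta>\<^sub>2 X\<close> is at most
  \<open>-(\<gamma> - \<delta>)\<close>, so that the norm of \<open>X\<close> decreases and \<open>X\<close> remains in the ball. The layer of
  \<open>P\<^sub>1\<^sub>2\<close> then solves a linear equation with exponentially decaying forcing.

  The sum of the outer solution and the layer solves the full system up to a residual that is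
  \<open>O(\<epsilon>)\<close> in the fast equations and \<open>O(exp (- \<kappa> s / \<epsilon>))\<close> in the slow one, whose
  time integral is \<open>O(\<epsilon>)\<close> (\<open>remainder_bounds\<close>). An energy estimate turns this into an error of
  size \<open>O(\<epsilon>)\<close> (\<open>slow_fast_estimate\<close>). The same estimate gives existence on all of \<open>[0,T]\<close>: in
  the equation for the error everything but the stable linear part is evaluated at the error
  clamped to a small ball, which makes the equation globally solvable; the
  estimate holds for the clamped equation and shows that its solution does not leave the
  ball, where clamping changes nothing (\<open>tikhonov_approximation\<close>).

  Finally the generalised Riccati equation, written in blocks, is the full system, because the
  powers of \<open>1/\<epsilon>\<close> in its coefficients cancel against the scaling of the blocks of
  \<open>P\<^sup>\<epsilon>\<close> (\<open>riccati_blocks\<close>). Uniqueness holds since all right-hand sides are polynomials.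
\<close>

section \<open>Functions that are Lipschitz on bounded sets\<close>

text \<open>
  Products do not preserve global Lipschitz continuity, but they preserve Lipschitz continuity on
  each ball. Hence all right-hand sides below qualify; with \<open>\<epsilon>\<close> as one more argument the constants
  are also uniform in \<open>\<epsilon>\<close>.
\<close>

definition lip_bounded :: "('a::real_normed_vector \<Rightarrow> 'b::real_normed_vector) \<Rightarrow> bool" where
  "lip_bounded F \<longleftrightarrow> (\<forall>R. \<exists>L\<ge>0. \<forall>z\<in>cball 0 R. \<forall>w\<in>cball 0 R. norm (F z - F w) \<le> L * norm (z - w))"

lemma lip_boundedE:
  assumes "lip_bounded F"
  obtains L where "0 \<le> L"
    "\<And>z w. norm z \<le> R \<Longrightarrow> norm w \<le> R \<Longrightarrow> norm (F z - F w) \<le> L * norm (z - w)"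
  using assms unfolding lip_bounded_def by (force simp: dist_norm)

lemma lip_bounded_ident: "lip_bounded (\<lambda>z. z)"
  unfolding lip_bounded_def by (auto intro: exI[of _ 1])

lemma lip_bounded_const: "lip_bounded (\<lambda>z. c)"
  unfolding lip_bounded_def by (auto intro: exI[of _ 0])

lemma lip_bounded_add:
  assumes "lip_bounded F" "lip_bounded G" shows "lip_bounded (\<lambda>z. F z + G z)"
  unfolding lip_bounded_def
proof
  fix R
  obtain L where L: "0 \<le> L" "\<And>z w. norm z \<le> R \<Longrightarrow> norm w \<le> R \<Longrightarrow> norm (F z - F w) \<le> L * norm (z - w)"
    using lip_boundedE[OF assms(1)] by blast
  obtain M where M: "0 \<le> M" "\<And>z w. norm z \<le> R \<Longrightarrow> norm w \<le> R \<Longrightarrow> norm (G z - G w) \<le> M * norm (z - w)"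
    using lip_boundedE[OF assms(2)] by blast
  have "norm (F z + G z - (F w + G w)) \<le> (L + M) * norm (z - w)" if "norm z \<le> R" "norm w \<le> R" for z w
    using L(2)[OF that] M(2)[OF that] norm_triangle_ineq[of "F z - F w" "G z - G w"]
    by (simp add: algebra_simps)
  then show "\<exists>L\<ge>0. \<forall>z\<in>cball 0 R. \<forall>w\<in>cball 0 R. norm (F z + G z - (F w + G w)) \<le> L * norm (z - w)"
    using L(1) M(1) by (intro exI[of _ "L + M"]) auto
qed

lemma lip_bounded_bound:
  assumes "lip_bounded F" obtains B where "0 < B" "\<And>z. norm z \<le> R \<Longrightarrow> norm (F z) \<le> B"
proof -
  obtain L where L: "0 \<le> L" "\<And>z w. norm z \<le> R \<Longrightarrow> norm w \<le> R \<Longrightarrow> norm (F z - F w) \<le> L * norm (z - w)"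
    using lip_boundedE[OF assms] by blast
  have "norm (F z) \<le> norm (F 0) + L * \<bar>R\<bar> + 1" if "norm z \<le> R" for z
  proof -
    have R: "0 \<le> R" using that norm_ge_zero[of z] by linarith
    have "norm (F z - F 0) \<le> L * norm z" using L(2)[OF that, of 0] R by simp
    also have "\<dots> \<le> L * \<bar>R\<bar>" using that L(1) by (intro mult_left_mono) auto
    finally show ?thesis using norm_triangle_sub[of "F z" "F 0"] by linarith
  qed
  moreover have "0 < norm (F 0) + L * \<bar>R\<bar> + 1" using L(1) by (simp add: add_nonneg_pos)
  ultimately show ?thesis using that by blast
qed

lemma lip_bounded_bilinear:
  assumes "bounded_bilinear bm" "lip_bounded F" "lip_bounded G"
  shows "lip_bounded (\<lambda>z. bm (F z) (G z))"
  unfolding lip_bounded_def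
proof
  interpret bounded_bilinear bm by fact
  fix R
  obtain L where L: "0 \<le> L" "\<And>z w. norm z \<le> R \<Longrightarrow> norm w \<le> R \<Longrightarrow> norm (F z - F w) \<le> L * norm (z - w)"
    using lip_boundedE[OF assms(2)] by blast
  obtain M where M: "0 \<le> M" "\<And>z w. norm z \<le> R \<Longrightarrow> norm w \<le> R \<Longrightarrow> norm (G z - G w) \<le> M * norm (z - w)"
    using lip_boundedE[OF assms(3)] by blast
  obtain B where B: "0 < B" "\<And>z. norm z \<le> R \<Longrightarrow> norm (F z) \<le> B"
    using lip_bounded_bound[OF assms(2)] by blast
  obtain D where D: "0 < D" "\<And>z. norm z \<le> R \<Longrightarrow> norm (G z) \<le> D"
    using lip_bounded_bound[OF assms(3)] by blast
  obtain N where N: "0 < N" "\<And>a b. norm (bm a b) \<le> norm a * norm b * N"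
    using pos_bounded by blast
  have "norm (bm (F z) (G z) - bm (F w) (G w)) \<le> ((L * D + B * M) * N) * norm (z - w)"
    if "norm z \<le> R" "norm w \<le> R" for z w
  proof -
    have "bm (F z) (G z) - bm (F w) (G w) = bm (F z - F w) (G z) + bm (F w) (G z - G w)"
      by (simp add: diff_left diff_right)
    also have "norm \<dots> \<le> norm (F z - F w) * norm (G z) * N + norm (F w) * norm (G z - G w) * N"
      by (intro norm_triangle_le add_mono N)
    also have "\<dots> \<le> (L * norm (z - w)) * D * N + B * (M * norm (z - w)) * N"
      using L M B D N that by (intro add_mono mult_mono) auto
    finally show ?thesis by (simp add: algebra_simps)
  qed
  then show "\<exists>L\<ge>0. \<forall>z\<in>cball 0 R. \<forall>w\<in>cball 0 R. norm (bm (F z) (G z) - bm (F w) (G w)) \<le> L * norm (z - w)"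
    using L(1) M(1) B(1) D(1) N(1) by (intro exI[of _ "(L * D + B * M) * N"]) auto
qed

lemma lip_bounded_compose_linear:
  assumes "bounded_linear J" "lip_bounded F" shows "lip_bounded (\<lambda>z. J (F z))"
proof -
  interpret bounded_linear J by fact
  obtain K where K: "0 \<le> K" "\<And>x. norm (J x) \<le> norm x * K" using nonneg_bounded by blast
  show ?thesis unfolding lip_bounded_def
  proof
    fix R
    obtain L where L: "0 \<le> L" "\<And>z w. norm z \<le> R \<Longrightarrow> norm w \<le> R \<Longrightarrow> norm (F z - F w) \<le> L * norm (z - w)"
      using lip_boundedE[OF assms(2)] by blast
    have "norm (J (F z) - J (F w)) \<le> (L * K) * norm (z - w)" if "norm z \<le> R" "norm w \<le> R" for z w
      using order_trans[OF K(2)[of "F z - F w"] mult_right_mono[OF L(2)[OF that] K(1)]]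
      by (simp add: diff mult_ac)
    then show "\<exists>L\<ge>0. \<forall>z\<in>cball 0 R. \<forall>w\<in>cball 0 R. norm (J (F z) - J (F w)) \<le> L * norm (z - w)"
      using L(1) K(1) by (intro exI[of _ "L * K"]) auto
  qed
qed

lemma lip_bounded_Pair:
  assumes "lip_bounded F" "lip_bounded G" shows "lip_bounded (\<lambda>z. (F z, G z))"
proof -
  have "lip_bounded (\<lambda>z. (F z, 0) + (0, G z))"
    by (intro lip_bounded_add
        lip_bounded_compose_linear[OF bounded_linear_Pair[OF bounded_linear_ident bounded_linear_zero] assms(1)]
        lip_bounded_compose_linear[OF bounded_linear_Pair[OF bounded_linear_zero bounded_linear_ident] assms(2)])
  then show ?thesis by simp
qed

lemma lip_bounded_continuous_on:
  fixes F :: "'a::real_normed_vector \<Rightarrow> 'b::real_normed_vector"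
  assumes "lip_bounded F" shows "continuous_on X F"
proof (intro continuous_at_imp_continuous_on ballI)
  fix x :: 'a
  obtain L where L: "0 \<le> L" "\<And>z w. norm z \<le> norm x + 1 \<Longrightarrow> norm w \<le> norm x + 1 \<Longrightarrow> norm (F z - F w) \<le> L * norm (z - w)"
    using lip_boundedE[OF assms] by blast
  have "((\<lambda>z. L * norm (z - x)) \<longlongrightarrow> L * norm (x - x)) (at x)" by (intro tendsto_intros)
  then have lim: "((\<lambda>z. L * norm (z - x)) \<longlongrightarrow> 0) (at x)" by simp
  have "\<forall>\<^sub>F z in at x. norm (F z - F x) \<le> L * norm (z - x)"
  proof (rule eventually_at_ball'[of 1 x UNIV, THEN eventually_mono])
    fix z assume "z \<in> ball x 1 \<and> z \<noteq> x \<and> z \<in> UNIV"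
    then have "norm (z - x) < 1" by (simp add: dist_norm norm_minus_commute)
    then have "norm z \<le> norm x + 1" using norm_triangle_sub[of z x] by linarith
    then show "norm (F z - F x) \<le> L * norm (z - x)" by (intro L) auto
  qed simp
  then have "((\<lambda>z. F z - F x) \<longlongrightarrow> 0) (at x)"
    by (rule Lim_null_comparison[OF _ lim])
  then show "isCont F x" by (simp add: isCont_def LIM_zero_iff)
qed

text \<open>
  The radial retraction onto the ball of radius \<open>r\<close>. It makes polynomial right-hand sides globally
  Lipschitz and does not change them inside the ball. It multiplies each \<open>z\<close> by a factor in
  \<open>(0,1]\<close>, so that dissipation inequalities survive it.
\<close>

definition clamp_ball :: "real \<Rightarrow> 'a::real_normed_vector \<Rightarrow> 'a" where
  "clamp_ball r z = (r / max r (norm z)) *\<^sub>R z"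

lemma clamp_ball_id: "norm z \<le> r \<Longrightarrow> clamp_ball r z = z"
  by (cases "r = 0") (auto simp: clamp_ball_def max_absorb1)

lemma norm_clamp_ball:
  assumes "0 < r" shows "norm (clamp_ball r z) \<le> r" "norm (clamp_ball r z) \<le> norm z"
proof -
  have m: "0 < max r (norm z)" using assms by simp
  have "r * norm z \<le> r * max r (norm z)" using assms by (intro mult_left_mono) auto
  then show "norm (clamp_ball r z) \<le> r" using m assms
    by (simp add: clamp_ball_def field_simps del: less_max_iff_disj)
  have "r / max r (norm z) \<le> 1" using m assms by (simp add: field_simps)
  then show "norm (clamp_ball r z) \<le> norm z"
    using assms mult_right_mono[of "r / max r (norm z)" 1 "norm z"] by (simp add: clamp_ball_def)
qed

lemma clamp_ball_lipschitz:
  assumes r: "0 < r" shows "norm (clamp_ball r x - clamp_ball r y) \<le> 2 * norm (x - y)"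
proof -
  define a b where "a = max r (norm x)" and "b = max r (norm y)"
  have ab: "0 < a" "0 < b" "r \<le> a" "norm y \<le> b" using r by (auto simp: a_def b_def)
  have "clamp_ball r x - clamp_ball r y = (r / a) *\<^sub>R (x - y) + (r / a - r / b) *\<^sub>R y"
    by (simp add: clamp_ball_def a_def b_def algebra_simps)
  also have "norm \<dots> \<le> (r / a) * norm (x - y) + \<bar>r / a - r / b\<bar> * norm y"
    using r ab by (intro norm_triangle_le) auto
  also have "(r / a) * norm (x - y) \<le> 1 * norm (x - y)"
    using ab by (intro mult_right_mono) auto
  also have "\<bar>r / a - r / b\<bar> * norm y \<le> \<bar>a - b\<bar>"
  proof -
    have "r / a - r / b = (r / a) * ((b - a) / b)" using ab by (simp add: field_simps)
    then have "\<bar>r / a - r / b\<bar> * norm y = (r / a) * (norm y / b) * \<bar>a - b\<bar>"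
      using ab r by (simp add: abs_mult abs_minus_commute)
    also have "\<dots> \<le> (1 * 1) * \<bar>a - b\<bar>" using ab r by (intro mult_right_mono mult_mono) auto
    finally show ?thesis by simp
  qed
  also have "\<bar>a - b\<bar> \<le> norm (x - y)"
    using norm_triangle_ineq3[of x y] unfolding a_def b_def by linarith
  finally show ?thesis by simp
qed

lemma clamp_ball_shrinks:
  assumes "0 < r" obtains \<theta> where "0 < \<theta>" "\<theta> \<le> 1" "clamp_ball r z = \<theta> *\<^sub>R z"
  using assms that[of "r / max r (norm z)"] by (auto simp: clamp_ball_def divide_simps)

lemma continuous_on_clamp_ball [continuous_intros]:
  assumes "0 < r" "continuous_on S u" shows "continuous_on S (\<lambda>s. clamp_ball r (u s))"
  unfolding clamp_ball_def using assms by (intro continuous_intros) auto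

lemma norm_clamped_le:
  assumes "0 < r" and L: "0 \<le> L" "\<And>z w. norm z \<le> r \<Longrightarrow> norm w \<le> r \<Longrightarrow> norm (F z - F w) \<le> L * norm (z - w)"
  shows "norm (F (clamp_ball r z) - F (clamp_ball r w)) \<le> (2 * L) * norm (z - w)"
proof -
  have "norm (F (clamp_ball r z) - F (clamp_ball r w)) \<le> L * norm (clamp_ball r z - clamp_ball r w)"
    using norm_clamp_ball[OF \<open>0 < r\<close>] by (intro L)
  also have "\<dots> \<le> L * (2 * norm (z - w))"
    using L(1) clamp_ball_lipschitz[OF \<open>0 < r\<close>] by (intro mult_left_mono) auto
  finally show ?thesis by simp
qed

section \<open>Ordinary differential equations\<close>

text \<open>
  The weight \<open>exp (- 2 l t)\<close> turns the integral operator into a contraction with factor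
  \<open>1/2\<close> on bounded continuous functions, on the whole half-line at once. The fixed point \<open>v\<close>
  is the weighted solution; negative times are sent to \<open>0\<close>, so that the operator acts on functions
  on all of \<open>\<real>\<close>.
\<close>

lemma picard_lipschitz:
  fixes f :: "real \<Rightarrow> 'a::banach \<Rightarrow> 'a"
  assumes cont: "\<And>u. continuous_on {0..} u \<Longrightarrow> continuous_on {0..} (\<lambda>s. f s (u s))"
    and lip: "\<And>s x y. 0 \<le> s \<Longrightarrow> norm (f s x - f s y) \<le> L * norm (x - y)"
    and bnd: "\<And>s. 0 \<le> s \<Longrightarrow> norm (f s 0) \<le> C"
  obtains u where "u 0 = x0"
    "\<And>t. 0 \<le> t \<Longrightarrow> (u has_vector_derivative f t (u t)) (at t within {0..})"
proof -
  define l where "l = max L 1"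
  have l: "1 \<le> l" "L \<le> l" by (auto simp: l_def)
  have lip': "norm (f s x - f s y) \<le> l * norm (x - y)" if "0 \<le> s" for s x y
    using lip[OF that, of x y] l mult_right_mono[of L l "norm (x - y)"] by force
  have C0: "0 \<le> C" using bnd[of 0] norm_ge_zero[of "f 0 0"] by linarith
  define J where "J v t = integral {0..t} (\<lambda>s. f s (exp (2 * l * s) *\<^sub>R apply_bcontfun v s))"
    for v :: "real \<Rightarrow>\<^sub>C 'a" and t
  define \<Phi> where "\<Phi> v t = exp (- (2 * l * max 0 t)) *\<^sub>R (x0 + J v (max 0 t))" for v t
  let ?k = "\<lambda>v s. f s (exp (2 * l * s) *\<^sub>R apply_bcontfun v s)"
  have cf: "continuous_on {0..} (\<lambda>s. ?k v s)" for v
    by (intro cont continuous_intros) auto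
  have cf': "continuous_on {0..t} (\<lambda>s. ?k v s)" for v t
    by (rule continuous_on_subset[OF cf]) auto
  have exp_int: "((\<lambda>s. exp (2 * l * s)) has_integral (exp (2 * l * t) - 1) / (2 * l)) {0..t}"
    if "0 \<le> t" for t
  proof -
    have "((\<lambda>s. exp (2 * l * s)) has_integral exp (2 * l * t) / (2 * l) - exp (2 * l * 0) / (2 * l)) {0..t}"
      by (rule fundamental_theorem_of_calculus[OF that])
        (use l in \<open>auto intro!: derivative_eq_intros simp: has_real_derivative_iff_has_vector_derivative[symmetric]\<close>)
    then show ?thesis by (simp add: diff_divide_distrib)
  qed
  have exp_bound: "exp (- (2 * l * t)) * (b * ((exp (2 * l * t) - 1) / (2 * l))) \<le> b / (2 * l)"
    if "0 \<le> b" for b t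
  proof -
    have "exp (- (2 * l * t)) * (b * ((exp (2 * l * t) - 1) / (2 * l)))
        = b / (2 * l) * (1 - exp (- (2 * l * t)))"
      using l by (simp add: field_simps exp_minus)
    also have "\<dots> \<le> b / (2 * l) * 1" using that l by (intro mult_left_mono) auto
    finally show ?thesis by simp
  qed
  have J_diff: "norm (J v t - J w t) \<le> (l * dist v w) * ((exp (2 * l * t) - 1) / (2 * l))"
    if t: "0 \<le> t" for v w t
  proof -
    have "norm (J v t - J w t) = norm (integral {0..t} (\<lambda>s. ?k v s
        - ?k w s))"
      unfolding J_def
      by (subst integral_diff) (auto intro!: integrable_continuous_real cf')
    also have "\<dots> \<le> integral {0..t} (\<lambda>s. (l * dist v w) * exp (2 * l * s))"
    proof (rule integral_norm_bound_integral)
      fix s assume s: "s \<in> {0..t}"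
      have "norm (?k v s - ?k w s)
          \<le> l * norm (exp (2 * l * s) *\<^sub>R apply_bcontfun v s - exp (2 * l * s) *\<^sub>R apply_bcontfun w s)"
        using s by (intro lip') auto
      also have "\<dots> = l * (exp (2 * l * s) * dist (apply_bcontfun v s) (apply_bcontfun w s))"
        by (simp add: scaleR_diff_right[symmetric] dist_norm)
      also have "\<dots> \<le> l * (exp (2 * l * s) * dist v w)"
        using l by (intro mult_left_mono dist_bounded) auto
      finally show "norm (?k v s
        - ?k w s) \<le> (l * dist v w) * exp (2 * l * s)"
        by (simp add: mult_ac)
    qed (auto intro!: integrable_continuous_real continuous_intros cf')
    also have "\<dots> = (l * dist v w) * ((exp (2 * l * t) - 1) / (2 * l))"
      using exp_int[OF t] by (simp add: integral_unique)
    finally show ?thesis .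
  qed
  have J_bound: "norm (J 0 t) \<le> C * ((exp (2 * l * t) - 1) / (2 * l))" if t: "0 \<le> t" for t
  proof -
    have "norm (J 0 t) \<le> integral {0..t} (\<lambda>s. C * exp (2 * l * s))"
      unfolding J_def
    proof (rule integral_norm_bound_integral)
      fix s assume s: "s \<in> {0..t}"
      have "norm (f s 0) \<le> C * 1" using bnd s by simp
      also have "\<dots> \<le> C * exp (2 * l * s)"
        using s l C0 by (intro mult_left_mono) auto
      finally show "norm (?k 0 s) \<le> C * exp (2 * l * s)"
        by simp
    qed (use cf'[of t 0] in \<open>auto intro!: integrable_continuous_real continuous_intros\<close>)
    also have "\<dots> = C * ((exp (2 * l * t) - 1) / (2 * l))"
      using exp_int[OF t] by (simp add: integral_unique)
    finally show ?thesis .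
  qed
  have J_deriv: "(J v has_vector_derivative f t (exp (2 * l * t) *\<^sub>R apply_bcontfun v t)) (at t within {0..})"
    if t: "0 \<le> t" for v t
  proof -
    have "(J v has_vector_derivative f t (exp (2 * l * t) *\<^sub>R apply_bcontfun v t)) (at t within {0..t+1})"
      unfolding J_def by (rule integral_has_vector_derivative[OF cf']) (use t in auto)
    moreover have "at t within {0..t+1} = at t within {0..}"
      by (rule at_within_nhd[of _ "{..<t+1}"]) auto
    ultimately show ?thesis by simp
  qed
  have cJ: "continuous_on {0..} (J v)" for v
    using J_deriv by (auto intro!: continuous_on_vector_derivative)
  have \<Phi>_diff: "norm (\<Phi> v t - \<Phi> w t) \<le> (1/2) * dist v w" for v w t
  proof -
    define m where "m = max 0 t"
    have "norm (\<Phi> v t - \<Phi> w t) = exp (- (2 * l * m)) * norm (J v m - J w m)"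
      by (simp add: \<Phi>_def m_def scaleR_diff_right[symmetric])
    also have "\<dots> \<le> exp (- (2 * l * m)) * ((l * dist v w) * ((exp (2 * l * m) - 1) / (2 * l)))"
      by (intro mult_left_mono J_diff) (auto simp: m_def)
    also have "\<dots> \<le> (l * dist v w) / (2 * l)"
      using l by (intro exp_bound) auto
    also have "\<dots> = (1/2) * dist v w" using l by simp
    finally show ?thesis .
  qed
  have \<Phi>0: "norm (\<Phi> 0 t) \<le> norm x0 + C / (2 * l)" for t
  proof -
    define m where "m = max 0 t"
    have "norm (\<Phi> 0 t) \<le> exp (- (2 * l * m)) * (norm x0 + C * ((exp (2 * l * m) - 1) / (2 * l)))"
      unfolding \<Phi>_def m_def[symmetric] norm_scaleR using J_bound[of m]
      by (intro mult_mono norm_triangle_le add_mono) (auto simp: m_def)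
    also have "\<dots> \<le> 1 * norm x0 + C / (2 * l)"
      unfolding distrib_left using l C0
      by (intro add_mono mult_right_mono exp_bound) (auto simp: m_def)
    finally show ?thesis by simp
  qed
  have \<Phi>_bc: "\<Phi> v \<in> bcontfun" for v
  proof (rule bcontfun_normI)
    have "continuous_on UNIV (\<lambda>t. J v (max 0 t))"
      by (rule continuous_on_compose2[OF cJ]) (auto intro!: continuous_intros)
    then show "continuous_on UNIV (\<Phi> v)"
      unfolding \<Phi>_def[abs_def] by (intro continuous_intros) auto
    show "norm (\<Phi> v t) \<le> (1/2) * dist v 0 + (norm x0 + C / (2 * l))" for t
      using \<Phi>_diff[of v t 0] \<Phi>0[of t] norm_triangle_sub[of "\<Phi> v t" "\<Phi> 0 t"] by linarith
  qed
  define G where "G v = Bcontfun (\<Phi> v)" for v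
  have G: "apply_bcontfun (G v) t = \<Phi> v t" for v t
    using \<Phi>_bc by (simp add: G_def Bcontfun_inverse)
  have "\<forall>v w. dist (G v) (G w) \<le> (1/2) * dist v w"
  proof (intro allI dist_bound)
    show "dist (apply_bcontfun (G v) t) (apply_bcontfun (G w) t) \<le> (1/2) * dist v w" for v w t
      using \<Phi>_diff[of v t w] by (simp only: G dist_norm[of "\<Phi> v t"])
  qed
  then have "\<exists>!v. G v = v"
    by (intro banach_fix_type[of "1/2"]) auto
  then obtain v where v: "G v = v" by auto
  define u where "u t = exp (2 * l * t) *\<^sub>R apply_bcontfun v t" for t
  have u: "u t = x0 + J v t" if "0 \<le> t" for t
  proof -
    have "apply_bcontfun v t = exp (- (2 * l * t)) *\<^sub>R (x0 + J v t)"
      using G[of v t] that by (simp add: v \<Phi>_def)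
    then show ?thesis by (simp add: u_def exp_minus)
  qed
  show ?thesis
  proof
    show "u 0 = x0" using u[of 0] by (simp add: J_def)
    show "(u has_vector_derivative f t (u t)) (at t within {0..})" if t: "0 \<le> t" for t
    proof (rule has_vector_derivative_transform)
      show "((\<lambda>t. x0 + J v t) has_vector_derivative f t (u t)) (at t within {0..})"
        using J_deriv[OF t, of v] unfolding u_def[of t, symmetric]
        by (auto intro!: derivative_eq_intros)
      show "t \<in> {0..}" using t by simp
      show "u s = x0 + J v s" if "s \<in> {0..}" for s using u that by simp
    qed
  qed
qed

text \<open>
  If the field maps the range of a projection into itself, solutions stay there, because
  \<open>u - pr u\<close> has derivative zero along solutions of the projected equation. Symmetry of
  the matrix solutions comes from this lemma.
\<close>

lemma picard_subspace:
  fixes f :: "real \<Rightarrow> 'a::banach \<Rightarrow> 'a"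
  assumes pr: "bounded_linear pr" "\<And>z. pr (pr z) = pr z" "\<And>z. norm (pr z) \<le> norm z"
    and inv: "\<And>s z. 0 \<le> s \<Longrightarrow> pr z = z \<Longrightarrow> pr (f s z) = f s z" and x0: "pr x0 = x0"
    and cont: "\<And>u. continuous_on {0..} u \<Longrightarrow> continuous_on {0..} (\<lambda>s. f s (u s))"
    and lip: "\<And>s x y. 0 \<le> s \<Longrightarrow> norm (f s x - f s y) \<le> L * norm (x - y)"
    and bnd: "\<And>s. 0 \<le> s \<Longrightarrow> norm (f s 0) \<le> C"
  obtains u where "u 0 = x0" "\<And>t. 0 \<le> t \<Longrightarrow> pr (u t) = u t"
    "\<And>t. 0 \<le> t \<Longrightarrow> (u has_vector_derivative f t (u t)) (at t within {0..})"
proof -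
  interpret pr: bounded_linear pr by (rule pr(1))
  have "norm (f s (pr x) - f s (pr y)) \<le> max L 0 * norm (x - y)" if "0 \<le> s" for s x y
  proof -
    have "norm (f s (pr x) - f s (pr y)) \<le> L * norm (pr (x - y))"
      using lip[OF that, of "pr x" "pr y"] by (simp add: pr.diff)
    also have "\<dots> \<le> max L 0 * norm (x - y)" by (intro mult_mono pr(3)) auto
    finally show ?thesis .
  qed
  moreover have "norm (f s (pr 0)) \<le> C" if "0 \<le> s" for s using bnd[OF that] by (simp add: pr.zero)
  moreover have "continuous_on {0..} (\<lambda>s. f s (pr (u s)))" if "continuous_on {0..} u" for u
    using that by (intro cont pr.continuous_on)
  ultimately obtain u where u: "u 0 = x0"
    "\<And>t. 0 \<le> t \<Longrightarrow> (u has_vector_derivative f t (pr (u t))) (at t within {0..})"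
    using picard_lipschitz[of "\<lambda>s z. f s (pr z)" "max L 0" C x0 thesis] by blast
  have "((\<lambda>t. u t - pr (u t)) has_vector_derivative 0) (at t within {0..})" if "t \<in> {0..}" for t
  proof -
    have "((\<lambda>t. u t - pr (u t)) has_vector_derivative (f t (pr (u t)) - pr (f t (pr (u t))))) (at t within {0..})"
      using that by (intro derivative_intros u pr.has_vector_derivative) auto
    then show ?thesis using inv[of t "pr (u t)"] that pr(2) by simp
  qed
  then obtain c where c: "\<And>t. t \<in> {0..} \<Longrightarrow> u t - pr (u t) = c"
    using has_vector_derivative_zero_constant[of "{0::real..}" "\<lambda>t. u t - pr (u t)"] by auto
  have "c = 0" using c[of 0] x0 u(1) by simp
  then have pu: "pr (u t) = u t" if "0 \<le> t" for t using c[of t] that by simp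
  show ?thesis using that u pu by metis
qed

text \<open>
  The function \<open>(v - m) exp (- A)\<close> has a nonpositive derivative.
\<close>

lemma comparison:
  fixes v m :: "real \<Rightarrow> real"
  assumes v: "\<And>s. s \<in> {0..b} \<Longrightarrow> (v has_real_derivative v' s) (at s within {0..b})"
    and m: "\<And>s. s \<in> {0..b} \<Longrightarrow> (m has_real_derivative m' s) (at s within {0..b})"
    and A: "\<And>s. s \<in> {0..b} \<Longrightarrow> (A has_real_derivative a s) (at s within {0..b})"
    and sub: "\<And>s. s \<in> {0..b} \<Longrightarrow> v' s \<le> a s * v s + r s"
    and super: "\<And>s. s \<in> {0..b} \<Longrightarrow> a s * m s + r s \<le> m' s"
    and init: "v 0 \<le> m 0" and s: "s \<in> {0..b}"
  shows "v s \<le> m s"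
proof -
  define D where "D s = (v s - m s) * exp (- A s)" for s
  have D: "(D has_real_derivative (v' s - m' s - a s * (v s - m s)) * exp (- A s)) (at s within {0..b})"
    if "s \<in> {0..b}" for s
    unfolding D_def using v[OF that] m[OF that] A[OF that]
    by (auto intro!: derivative_eq_intros simp: algebra_simps)
  have "\<exists>x\<in>{0..s}. D s - D 0 = (v' x - m' x - a x * (v x - m x)) * exp (- A x) * (s - 0)"
  proof (rule mvt_very_simple)
    show "(D has_derivative (*) ((v' x - m' x - a x * (v x - m x)) * exp (- A x))) (at x within {0..s})"
      if "0 \<le> x" "x \<le> s" for x
      using D[of x] that s unfolding has_field_derivative_def
      by (auto elim!: has_derivative_subset)
  qed (use s in auto)
  then obtain x where x: "x \<in> {0..s}"
    "D s - D 0 = (v' x - m' x - a x * (v x - m x)) * exp (- A x) * s" by auto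
  have "v' x - m' x - a x * (v x - m x) \<le> 0"
    using sub[of x] super[of x] x(1) s by (auto simp: algebra_simps)
  then have "D s - D 0 \<le> 0" unfolding x(2)
    using s by (intro mult_nonpos_nonneg) auto
  moreover have "D 0 \<le> 0" using init by (simp add: D_def mult_nonpos_nonneg)
  ultimately have "D s \<le> 0" by linarith
  then show ?thesis by (simp add: D_def mult_le_0_iff)
qed

lemma has_real_derivative_norm_sq:
  fixes u :: "real \<Rightarrow> 'a::real_inner"
  assumes "(u has_vector_derivative u') (at t within X)"
  shows "((\<lambda>t. (norm (u t))\<^sup>2) has_real_derivative 2 * (u t \<bullet> u')) (at t within X)"
proof -
  have "((\<lambda>t. u t \<bullet> u t) has_derivative (\<lambda>h. u t \<bullet> (h *\<^sub>R u') + (h *\<^sub>R u') \<bullet> u t)) (at t within X)"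
    using assms unfolding has_vector_derivative_def by (intro has_derivative_inner)
  then show ?thesis
    unfolding has_field_derivative_def power2_norm_eq_inner
    by (rule has_derivative_eq_rhs) (auto simp: fun_eq_iff inner_commute)
qed

lemma continuous_on_interval_bound:
  fixes u :: "real \<Rightarrow> 'a::real_normed_vector"
  assumes "continuous_on {a..b} u"
  obtains B where "\<And>s. s \<in> {a..b} \<Longrightarrow> norm (u s) \<le> B"
proof -
  have "bounded (u ` {a..b})" by (intro compact_imp_bounded compact_continuous_image assms) simp
  then obtain B where "\<forall>x\<in>u ` {a..b}. norm x \<le> B" unfolding bounded_iff by blast
  then show ?thesis using that by blast
qed

text \<open>
  Two solutions on a compact interval lie in a common ball, and there the squared norm of their
  difference satisfies \<open>v' \<le> 2 L v\<close>.
\<close>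

lemma ode_unique:
  fixes F :: "'a::real_inner \<Rightarrow> 'a"
  assumes F: "lip_bounded F"
    and u: "\<And>t. t \<in> {0..b} \<Longrightarrow> (u has_vector_derivative F (u t)) (at t within {0..b})"
    and v: "\<And>t. t \<in> {0..b} \<Longrightarrow> (v has_vector_derivative F (v t)) (at t within {0..b})"
    and "u 0 = v 0" and t: "t \<in> {0..b}"
  shows "u t = v t"
proof -
  have "bounded (u ` {0..b})" "bounded (v ` {0..b})"
    by (auto intro!: compact_imp_bounded compact_continuous_image
        continuous_on_vector_derivative u v)
  then obtain R1 R2 where "\<forall>x\<in>u ` {0..b}. norm x \<le> R1" "\<forall>x\<in>v ` {0..b}. norm x \<le> R2"
    unfolding bounded_iff by blast
  then have R: "\<And>t. t \<in> {0..b} \<Longrightarrow> norm (u t) \<le> R1" "\<And>t. t \<in> {0..b} \<Longrightarrow> norm (v t) \<le> R2"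
    by auto
  obtain L where L: "0 \<le> L" "\<And>z w. norm z \<le> max R1 R2 \<Longrightarrow> norm w \<le> max R1 R2 \<Longrightarrow>
      norm (F z - F w) \<le> L * norm (z - w)"
    using lip_boundedE[OF F] by blast
  have "(norm (u t - v t))\<^sup>2 \<le> 0"
  proof (rule comparison[where v = "\<lambda>t. (norm (u t - v t))\<^sup>2" and m = "\<lambda>_. 0" and s = t and b = b
        and v' = "\<lambda>t. 2 * ((u t - v t) \<bullet> (F (u t) - F (v t)))" and m' = "\<lambda>_. 0"
        and a = "\<lambda>_. 2 * L" and A = "\<lambda>s. 2 * L * s" and r = "\<lambda>_. 0"])
    show "((\<lambda>t. (norm (u t - v t))\<^sup>2) has_real_derivative 2 * ((u t - v t) \<bullet> (F (u t) - F (v t))))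
        (at t within {0..b})" if "t \<in> {0..b}" for t
      using u[OF that] v[OF that] by (intro has_real_derivative_norm_sq derivative_intros)
    show "2 * ((u t - v t) \<bullet> (F (u t) - F (v t))) \<le> 2 * L * (norm (u t - v t))\<^sup>2 + 0"
      if "t \<in> {0..b}" for t
    proof -
      have "(u t - v t) \<bullet> (F (u t) - F (v t)) \<le> norm (u t - v t) * norm (F (u t) - F (v t))"
        by (rule norm_cauchy_schwarz)
      also have "\<dots> \<le> norm (u t - v t) * (L * norm (u t - v t))"
        using R[OF that] by (intro mult_left_mono L) auto
      finally show ?thesis by (simp add: power2_eq_square mult_ac)
    qed
  qed (use assms t in \<open>auto intro!: derivative_eq_intros\<close>)
  then show ?thesis by simp
qed

lemma has_vector_derivative_reflect:
  fixes P :: "real \<Rightarrow> 'a::real_normed_vector"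
  assumes "(P has_vector_derivative P') (at (T - s) within {0..T})"
  shows "((\<lambda>s. P (T - s)) has_vector_derivative - P') (at s within {0..T})"
proof -
  have "((P \<circ> (\<lambda>s. T - s)) has_vector_derivative (- 1) *\<^sub>R P') (at s within {0..T})"
  proof (rule vector_diff_chain_within)
    show "((\<lambda>s. T - s) has_vector_derivative - 1) (at s within {0..T})"
      by (auto intro!: derivative_eq_intros)
    have "(\<lambda>s. T - s) ` {0..T} = {0..T}" by (simp add: image_diff_atLeastAtMost)
    then show "(P has_vector_derivative P') (at (T - s) within (\<lambda>s. T - s) ` {0..T})"
      using assms by simp
  qed
  then show ?thesis by (simp add: o_def)
qed

section \<open>Differential inequalities with a boundary layer\<close>

lemma exp_decay_mult_le:
  fixes s \<epsilon> \<kappa> :: real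
  assumes "0 < \<kappa>" "0 < \<epsilon>" "0 \<le> s"
  shows "s * exp (- \<kappa> * (s / \<epsilon>)) \<le> \<epsilon> / \<kappa>"
proof -
  define u where "u = \<kappa> * (s / \<epsilon>)"
  have "u \<le> exp u" using exp_ge_add_one_self[of u] by linarith
  then have "u * exp (- u) \<le> 1" by (simp add: exp_minus field_simps)
  moreover have "s = (\<epsilon> / \<kappa>) * u" using assms by (simp add: u_def)
  ultimately show ?thesis
    using mult_left_mono[of "u * exp (- u)" 1 "\<epsilon> / \<kappa>"] assms by (simp add: u_def[symmetric] mult.assoc)
qed

text \<open>
  The coefficient \<open>C exp (- \<kappa> s / \<epsilon>) / \<epsilon>\<close> is large near \<open>0\<close>, but its time integral is at most
  \<open>C / \<kappa>\<close> for every \<open>\<epsilon>\<close>. It therefore costs the factor \<open>exp (C / \<kappa>)\<close> only, and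
  the damping \<open>a\<close> limits the effect of the forcing \<open>r\<close> to \<open>r / a\<close>.
\<close>

lemma layer_gronwall:
  fixes q :: "real \<Rightarrow> real"
  assumes "0 < \<epsilon>" "0 < a" "0 < \<kappa>" "0 \<le> C" "0 \<le> r" "0 \<le> q 0"
    and q: "\<And>s. s \<in> {0..b} \<Longrightarrow> (q has_real_derivative q' s) (at s within {0..b})"
    and le: "\<And>s. s \<in> {0..b} \<Longrightarrow> \<epsilon> * q' s \<le> (C * exp (- \<kappa> * (s / \<epsilon>)) - a) * q s + r"
    and s: "s \<in> {0..b}"
  shows "q s \<le> (q 0 + r / a) * exp (C / \<kappa>)"
proof -
  define e where "e s = exp (- \<kappa> * (s / \<epsilon>))" for s
  \<comment> \<open>a supersolution: it absorbs the transient coefficient exactly and dominates \<open>r\<close> through \<open>a m \<ge> r\<close>\<close>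
  define m where "m s = (q 0 + r / a) * exp (C / \<kappa> * (1 - e s))" for s
  have e': "(e has_real_derivative (- \<kappa> / \<epsilon>) * e s) (at s within {0..b})" for s
    unfolding e_def using \<open>0 < \<epsilon>\<close> by (auto intro!: derivative_eq_intros)
  have e1: "e s \<le> 1" if "0 \<le> s" for s using that \<open>0 < \<epsilon>\<close> \<open>0 < \<kappa>\<close> by (simp add: e_def)
  have "q s \<le> m s"
  proof (rule comparison[where v = q and m = m and s = s and v' = q' and b = b and m' = "\<lambda>s. (C / \<epsilon>) * e s * m s"
        and a = "\<lambda>s. (C * e s - a) / \<epsilon>" and r = "\<lambda>s. r / \<epsilon>"
        and A = "\<lambda>s. - (C / \<kappa>) * e s - a / \<epsilon> * s"])
    show "(m has_real_derivative (C / \<epsilon>) * e s * m s) (at s within {0..b})" for s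
      unfolding m_def using \<open>0 < \<kappa>\<close> by (auto intro!: derivative_eq_intros e')
    show "((\<lambda>s. - (C / \<kappa>) * e s - a / \<epsilon> * s) has_real_derivative (C * e s - a) / \<epsilon>) (at s within {0..b})" for s
      using \<open>0 < \<kappa>\<close> \<open>0 < \<epsilon>\<close> by (auto intro!: derivative_eq_intros e' simp: field_simps)
    show "q' s \<le> (C * e s - a) / \<epsilon> * q s + r / \<epsilon>" if "s \<in> {0..b}" for s
      using le[OF that] \<open>0 < \<epsilon>\<close> by (simp add: e_def field_simps)
    show "(C * e s - a) / \<epsilon> * m s + r / \<epsilon> \<le> C / \<epsilon> * e s * m s" if "s \<in> {0..b}" for s
    proof -
      have "r / a * 1 \<le> m s" unfolding m_def using assms e1[of s] that
        by (intro mult_mono) auto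
      then have "r \<le> a * m s" using \<open>0 < a\<close> by (simp add: field_simps)
      then show ?thesis using \<open>0 < \<epsilon>\<close> by (simp add: field_simps)
    qed
    show "q 0 \<le> m 0" using assms by (simp add: m_def e_def)
  qed (use q s in auto)
  also have "m s \<le> (q 0 + r / a) * exp (C / \<kappa>)"
    unfolding m_def using assms by (intro mult_left_mono) (auto simp: e_def field_simps)
  finally show ?thesis .
qed

text \<open>
  The two members of the maximum bound \<open>p / \<epsilon>\<^sup>2\<close> and \<open>q / \<epsilon>\<^sup>2\<close> in the energy estimate
  \<open>slow_fast_energy\<close>. What matters is that \<open>\<epsilon>\<close> does not occur.
\<close>

definition energy_constant :: "real \<Rightarrow> real \<Rightarrow> real \<Rightarrow> real \<Rightarrow> real \<Rightarrow> real" where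
  "energy_constant K C a \<kappa> T = (let K' = K + K\<^sup>2 / a;
     M1 = (C / \<kappa> + K' * T) * exp (K' * T + C / \<kappa>)
   in max M1 ((K * M1 + K) / a * exp (C / \<kappa>)))"

lemma energy_constant_nonneg:
  assumes "0 \<le> K" "0 \<le> C" "0 < a" "0 < \<kappa>" "0 \<le> T"
  shows "0 \<le> energy_constant K C a \<kappa> T"
  using assms by (simp add: energy_constant_def Let_def le_max_iff_disj)

text \<open>
  Here \<open>p\<close> and \<open>q\<close> stand for the squared norms of the slow and of the fast error. In
  \<open>E = p + (K / a) \<epsilon> q\<close> the damping \<open>- a q\<close> of the fast inequality cancels the coupling \<open>K q\<close>
  of the slow one. What remains is an inequality for \<open>E\<close> whose coefficient has a bounded time
  integral and whose forcing has a time integral of order \<open>\<epsilon>\<^sup>2\<close>: the term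
  \<open>C \<epsilon> exp (- \<kappa> s / \<epsilon>)\<close> has size \<open>\<epsilon>\<close> but lives for a time of order \<open>\<epsilon>\<close>. The bound for \<open>p\<close> is
  then fed into the fast inequality.
\<close>

lemma slow_fast_energy:
  fixes p q :: "real \<Rightarrow> real"
  assumes "0 \<le> K" "0 \<le> C" "0 < a" "0 < \<kappa>" "0 \<le> T" and \<epsilon>: "0 < \<epsilon>" and p0: "p 0 = 0" and q0: "q 0 = 0"
    and p: "\<And>s. s \<in> {0..T} \<Longrightarrow> (p has_real_derivative p' s) (at s within {0..T})"
    and q: "\<And>s. s \<in> {0..T} \<Longrightarrow> (q has_real_derivative q' s) (at s within {0..T})"
    and pp: "\<And>s. s \<in> {0..T} \<Longrightarrow> 0 \<le> p s" and qq: "\<And>s. s \<in> {0..T} \<Longrightarrow> 0 \<le> q s"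
    and p': "\<And>s. s \<in> {0..T} \<Longrightarrow> p' s \<le> (K + C / \<epsilon> * exp (- \<kappa> * (s / \<epsilon>))) * p s + K * q s
         + C * \<epsilon> * exp (- \<kappa> * (s / \<epsilon>))"
    and q': "\<And>s. s \<in> {0..T} \<Longrightarrow>
         \<epsilon> * q' s \<le> (C * exp (- \<kappa> * (s / \<epsilon>)) - a) * q s + K * p s + K * \<epsilon>\<^sup>2"
    and s: "s \<in> {0..T}"
  shows "p s \<le> energy_constant K C a \<kappa> T * \<epsilon>\<^sup>2 \<and> q s \<le> energy_constant K C a \<kappa> T * \<epsilon>\<^sup>2"
proof -
  define K' where "K' = K + K\<^sup>2 / a"
  have K': "0 \<le> K'" using assms by (simp add: K'_def)
  define M1 where "M1 = (C / \<kappa> + K' * T) * exp (K' * T + C / \<kappa>)"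
  have M1: "0 \<le> M1" using assms K' by (simp add: M1_def)
  define M2 where "M2 = (K * M1 + K) / a * exp (C / \<kappa>)"
  have const: "energy_constant K C a \<kappa> T = max M1 M2"
    by (simp add: energy_constant_def Let_def M2_def M1_def K'_def)
  define e where "e s = exp (- \<kappa> * (s / \<epsilon>))" for s
  have e': "(e has_real_derivative (- \<kappa> / \<epsilon>) * e s) (at s within {0..T})" for s
    unfolding e_def using \<epsilon> by (auto intro!: derivative_eq_intros)
  have e01: "0 \<le> e s" "0 \<le> s \<Longrightarrow> e s \<le> 1" for s
    using \<epsilon> \<open>0 < \<kappa>\<close> by (auto simp: e_def)
  define A where "A s = K' * s + C / \<kappa> * (1 - e s)" for s
  \<comment> \<open>\<open>A\<close> and \<open>\<mu>\<close> are primitives of the coefficient and of the forcing; \<open>\<mu> exp A\<close> is a supersolution\<close>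
  define \<mu> where "\<mu> s = C / \<kappa> * \<epsilon>\<^sup>2 * (1 - e s) + K' * \<epsilon>\<^sup>2 * s" for s
  define E where "E s = p s + K / a * \<epsilon> * q s" for s
  have A0: "0 \<le> A s" if "0 \<le> s" for s
    using assms K' e01(2)[OF that] that by (simp add: A_def)
  have \<mu>0: "0 \<le> \<mu> s" if "0 \<le> s" for s
    using assms K' e01(2)[OF that] that by (simp add: \<mu>_def)
  have A': "(A has_real_derivative (K' + C / \<epsilon> * e s)) (at s within {0..T})" for s
    unfolding A_def using \<open>0 < \<kappa>\<close> by (auto intro!: derivative_eq_intros e')
  have \<mu>': "(\<mu> has_real_derivative (C * \<epsilon> * e s + K' * \<epsilon>\<^sup>2)) (at s within {0..T})" for s
    unfolding \<mu>_def using \<open>0 < \<kappa>\<close> \<epsilon>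
    by (auto intro!: derivative_eq_intros e' simp: power2_eq_square)
  have "E s \<le> \<mu> s * exp (A s)" if s: "s \<in> {0..T}" for s
  proof (rule comparison[where v = E and m = "\<lambda>s. \<mu> s * exp (A s)" and s = s and b = T and A = A
        and v' = "\<lambda>s. p' s + K / a * \<epsilon> * q' s" and a = "\<lambda>s. K' + C / \<epsilon> * e s"
        and m' = "\<lambda>s. (C * \<epsilon> * e s + K' * \<epsilon>\<^sup>2) * exp (A s) + \<mu> s * ((K' + C / \<epsilon> * e s) * exp (A s))"
        and r = "\<lambda>s. C * \<epsilon> * e s + K' * \<epsilon>\<^sup>2"])
    show "(E has_real_derivative p' s + K / a * \<epsilon> * q' s) (at s within {0..T})" if "s \<in> {0..T}" for s
      unfolding E_def using p[OF that] q[OF that] \<open>0 < a\<close> by (auto intro!: derivative_eq_intros)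
    show "((\<lambda>s. \<mu> s * exp (A s)) has_real_derivative
        (C * \<epsilon> * e s + K' * \<epsilon>\<^sup>2) * exp (A s) + \<mu> s * ((K' + C / \<epsilon> * e s) * exp (A s))) (at s within {0..T})" for s
      by (auto intro!: derivative_eq_intros \<mu>' A')
    show "p' s + K / a * \<epsilon> * q' s \<le> (K' + C / \<epsilon> * e s) * E s + (C * \<epsilon> * e s + K' * \<epsilon>\<^sup>2)"
      if s: "s \<in> {0..T}" for s
    proof -
      have "K / a * (\<epsilon> * q' s) \<le> K / a * ((C * e s - a) * q s + K * p s + K * \<epsilon>\<^sup>2)"
        using assms q'[OF s] by (intro mult_left_mono) (auto simp: e_def)
      also have "\<dots> = C / \<epsilon> * e s * (K / a * \<epsilon> * q s) - K * q s + K\<^sup>2 / a * p s + K\<^sup>2 / a * \<epsilon>\<^sup>2"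
        using assms \<epsilon> by (simp add: field_simps power2_eq_square)
      finally have "p' s + K / a * \<epsilon> * q' s \<le> (K + K\<^sup>2 / a) * p s + C / \<epsilon> * e s * E s
          + C * \<epsilon> * e s + K\<^sup>2 / a * \<epsilon>\<^sup>2"
        using p'[OF s, folded e_def] by (simp add: E_def algebra_simps)
      also have "\<dots> \<le> K' * E s + C / \<epsilon> * e s * E s + C * \<epsilon> * e s + K' * \<epsilon>\<^sup>2"
      proof -
        have "(K + K\<^sup>2 / a) * p s \<le> K' * E s" unfolding K'_def[symmetric] E_def
          using K' qq[OF s] assms \<epsilon> by (intro mult_left_mono) auto
        moreover have "K\<^sup>2 / a * \<epsilon>\<^sup>2 \<le> K' * \<epsilon>\<^sup>2" using assms by (simp add: K'_def distrib_right)
        ultimately show ?thesis by linarith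
      qed
      finally show ?thesis by (simp add: algebra_simps)
    qed
    show "(K' + C / \<epsilon> * e s) * (\<mu> s * exp (A s)) + (C * \<epsilon> * e s + K' * \<epsilon>\<^sup>2) \<le>
       (C * \<epsilon> * e s + K' * \<epsilon>\<^sup>2) * exp (A s) + \<mu> s * ((K' + C / \<epsilon> * e s) * exp (A s))"
      if "s \<in> {0..T}" for s
    proof -
      have "(C * \<epsilon> * e s + K' * \<epsilon>\<^sup>2) * 1 \<le> (C * \<epsilon> * e s + K' * \<epsilon>\<^sup>2) * exp (A s)"
        using assms \<epsilon> K' e01[of s] A0[of s] that by (intro mult_left_mono) auto
      then show ?thesis by (simp add: algebra_simps)
    qed
    show "E 0 \<le> \<mu> 0 * exp (A 0)" using \<mu>0[of 0] by (simp add: E_def p0 q0)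
  qed (use A' s in auto)
  moreover have "\<mu> s * exp (A s) \<le> M1 * \<epsilon>\<^sup>2" if s: "s \<in> {0..T}" for s
  proof -
    have 1: "C / \<kappa> * (1 - e s) \<le> C / \<kappa> * 1"
      using assms e01[of s] by (intro mult_left_mono) auto
    have 2: "K' * s \<le> K' * T" using K' s by (intro mult_left_mono) auto
    have "\<mu> s = (C / \<kappa> * (1 - e s) + K' * s) * \<epsilon>\<^sup>2" unfolding \<mu>_def distrib_right by (simp only: mult_ac)
    also have "\<dots> \<le> (C / \<kappa> + K' * T) * \<epsilon>\<^sup>2" using 1 2 by (intro mult_right_mono) auto
    finally have "\<mu> s * exp (A s) \<le> (C / \<kappa> + K' * T) * \<epsilon>\<^sup>2 * exp (K' * T + C / \<kappa>)"
      using 1 2 assms K' s \<mu>0[of s] by (intro mult_mono) (auto simp: A_def)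
    then show ?thesis by (simp add: M1_def mult_ac)
  qed
  ultimately have E: "E s \<le> M1 * \<epsilon>\<^sup>2" if "s \<in> {0..T}" for s using that by fastforce
  have ple: "p s \<le> M1 * \<epsilon>\<^sup>2" if "s \<in> {0..T}" for s
  proof -
    have "0 \<le> K / a * \<epsilon> * q s" using assms \<epsilon> qq[OF that] by simp
    then show ?thesis using E[OF that] by (simp add: E_def)
  qed
  have "q s \<le> (q 0 + (K * M1 + K) * \<epsilon>\<^sup>2 / a) * exp (C / \<kappa>)"
  proof (rule layer_gronwall[where q = q and \<epsilon> = \<epsilon> and b = T and q' = q'])
    show "\<epsilon> * q' s \<le> (C * exp (- \<kappa> * (s / \<epsilon>)) - a) * q s + (K * M1 + K) * \<epsilon>\<^sup>2"
      if "s \<in> {0..T}" for s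
      using q'[OF that] mult_left_mono[OF ple[OF that], of K] assms by (simp add: algebra_simps)
  qed (use assms \<epsilon> q s q0 M1 in auto)
  then have "q s \<le> M2 * \<epsilon>\<^sup>2" by (simp add: M2_def q0 mult_ac)
  moreover have "M * \<epsilon>\<^sup>2 \<le> max M1 M2 * \<epsilon>\<^sup>2" if "M \<in> {M1, M2}" for M
    using that by (intro mult_right_mono) auto
  ultimately show ?thesis
    unfolding const using ple[OF s] by (meson insertI1 insertI2 order_trans)
qed

section \<open>Norms, inner products and blocks of matrices\<close>

lemma norm_matrix_vector_mult_le: "norm (M *v x) \<le> norm M * norm (x::real^'n)" for M :: "real^'n^'m"
proof -
  have "norm (M *v x) \<le> L2_set (\<lambda>i. norm (M $ i) * norm x) UNIV"
    unfolding norm_vec_def[of "M *v x"]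
    by (rule L2_set_mono) (auto simp: matrix_vector_mul_component Cauchy_Schwarz_ineq2)
  also have "\<dots> = norm M * norm x"
    unfolding norm_vec_def[of M] by (simp add: L2_set_left_distrib)
  finally show ?thesis .
qed

lemma matrix_mult_row: "(A ** B) $ i = transpose B *v (A $ i)" for A :: "real^'n^'m" and B :: "real^'k^'n"
  by (simp add: vec_eq_iff matrix_matrix_mult_def matrix_vector_mult_def transpose_def mult.commute)

lemma inner_transpose: "transpose A \<bullet> transpose B = A \<bullet> (B :: real^'n^'m)"
  unfolding inner_vec_def transpose_def by (simp, subst sum.swap, simp)

lemma norm_transpose: "norm (transpose A) = norm (A :: real^'n^'m)"
  by (simp add: norm_eq_sqrt_inner inner_transpose)

lemma norm_matrix_mult_le: "norm (A ** B) \<le> norm A * norm B" for A :: "real^'n^'m" and B :: "real^'k^'n"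
proof -
  have "norm (A ** B) \<le> L2_set (\<lambda>i. norm (A $ i) * norm B) UNIV"
    unfolding norm_vec_def[of "A ** B"]
  proof (rule L2_set_mono)
    show "norm ((A ** B) $ i) \<le> norm (A $ i) * norm B" for i
      using norm_matrix_vector_mult_le[of "transpose B" "A $ i"]
      by (simp only: matrix_mult_row norm_transpose mult.commute)
  qed auto
  also have "\<dots> = norm A * norm B"
    unfolding norm_vec_def[of A] by (simp add: L2_set_left_distrib)
  finally show ?thesis .
qed

lemma norm_mult3_le:
  fixes A :: "real^'b^'a" and B :: "real^'c^'b" and C :: "real^'e^'c"
  shows "norm (A ** B ** C) \<le> norm A * norm B * norm C"
  by (intro order_trans[OF norm_matrix_mult_le] mult_right_mono norm_matrix_mult_le) auto

lemma norm_triple_le: "norm (a, b, c) \<le> norm a + norm b + norm c"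
  using norm_Pair_le[of a "(b, c)"] norm_Pair_le[of b c] by linarith

lemma bounded_bilinear_matrix_mult:
  "bounded_bilinear ((**) :: real^'n^'m \<Rightarrow> real^'k^'n \<Rightarrow> real^'k^'m)"
proof
  show "\<exists>K. \<forall>(a::real^'n^'m) (b::real^'k^'n). norm (a ** b) \<le> norm a * norm b * K"
    by (rule exI[of _ 1]) (simp add: norm_matrix_mult_le)
qed (auto simp: vec_eq_iff matrix_matrix_mult_def algebra_simps sum.distrib sum_distrib_left)

interpretation matmul: bounded_bilinear
  "(**) :: real^'n::finite^'m::finite \<Rightarrow> real^'k::finite^'n \<Rightarrow> real^'k^'m"
  by (rule bounded_bilinear_matrix_mult)

lemma bounded_linear_transpose: "bounded_linear (transpose :: real^'n^'m \<Rightarrow> real^'m^'n)"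
proof (rule bounded_linear_intro[where K = 1])
  show "transpose (x + y) = transpose x + transpose y" for x y :: "real^'n^'m"
    by (simp add: transpose_def vec_eq_iff)
qed (simp_all add: norm_transpose transpose_scalar)

lemmas linear_transpose = bounded_linear.linear[OF bounded_linear_transpose]

lemmas matrix_distribs =
  matmul.add_left matmul.add_right matmul.diff_left matmul.diff_right matmul.minus_left matmul.minus_right
  matmul.zero_left matmul.zero_right matmul.scaleR_left matmul.scaleR_right

lemmas transpose_distribs =
  linear_add[OF linear_transpose] linear_diff[OF linear_transpose] linear_neg[OF linear_transpose]
  linear_0[OF linear_transpose] linear_scale[OF linear_transpose] matrix_transpose_mul transpose_transpose

text \<open>
  The Frobenius inner product of \<open>Y\<close> and \<open>Y M\<close> is the sum of \<open>y \<bullet> M y\<close> over the rows \<open>y\<close> of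
  \<open>Y\<close>, so that a bound on the quadratic form of \<open>M\<close> carries over.
\<close>

lemma inner_mult_right_le:
  fixes Y :: "real^'n^'m"
  assumes "\<And>x. x \<bullet> (M *v x) \<le> c * (norm x)\<^sup>2"
  shows "Y \<bullet> (Y ** M) \<le> c * (norm Y)\<^sup>2"
proof -
  have "Y \<bullet> (Y ** M) = (\<Sum>i\<in>UNIV. (Y $ i) \<bullet> (M *v (Y $ i)))"
    unfolding inner_vec_def[of Y]
    by (intro sum.cong refl) (simp add: matrix_mult_row dot_lmul_matrix[symmetric] inner_commute)
  also have "\<dots> \<le> (\<Sum>i\<in>UNIV. c * (norm (Y $ i))\<^sup>2)" by (intro sum_mono assms)
  also have "\<dots> = c * (norm Y)\<^sup>2"
    by (simp add: sum_distrib_left power2_norm_eq_inner inner_vec_def[of Y])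
  finally show ?thesis .
qed

lemma psd_le_sym_part_iff:
  fixes M :: "real^'n^'n"
  shows "psd_le ((1/2) *\<^sub>R (transpose M + M)) (c *\<^sub>R mat 1) \<longleftrightarrow> (\<forall>x. x \<bullet> (M *v x) \<le> c * (norm x)\<^sup>2)"
proof -
  have "x \<bullet> (transpose M *v x) = x \<bullet> (M *v x)" for x
    by (simp add: dot_lmul_matrix[symmetric] inner_commute)
  then have "x \<bullet> (((1/2) *\<^sub>R (transpose M + M)) *v x) = x \<bullet> (M *v x)" for x
    by (simp add: scaleR_matrix_vector_assoc[symmetric] matrix_vector_mult_add_rdistrib inner_add_right
        del: transpose_matrix_vector)
  moreover have "x \<bullet> ((c *\<^sub>R mat 1) *v x) = c * (norm x)\<^sup>2" for x :: "real^'n"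
    by (simp add: scaleR_matrix_vector_assoc[symmetric] power2_norm_eq_inner)
  ultimately show ?thesis by (simp only: psd_le_def)
qed

definition sym_part :: "real^'n^'n \<Rightarrow> real^'n^'n" where
  "sym_part M = (1/2) *\<^sub>R (M + transpose M)"

lemma sym_part:
  "bounded_linear (sym_part :: real^'n^'n \<Rightarrow> real^'n^'n)"
  "transpose (sym_part M) = sym_part (M :: real^'n^'n)"
  "sym_part M = M \<longleftrightarrow> transpose M = M"
  "norm (sym_part M) \<le> norm M"
proof -
  show "bounded_linear (sym_part :: real^'n^'n \<Rightarrow> real^'n^'n)" unfolding sym_part_def
    by (intro bounded_linear_compose[OF bounded_linear_scaleR_right] bounded_linear_add
        bounded_linear_ident bounded_linear_transpose)
  show "transpose (sym_part M) = sym_part M" by (simp add: sym_part_def transpose_distribs add.commute)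
  then show "sym_part M = M \<longleftrightarrow> transpose M = M"
    by (metis sym_part_def scaleR_half_double)
  show "norm (sym_part M) \<le> norm M"
    using norm_triangle_ineq[of M "transpose M"] by (simp add: sym_part_def norm_transpose)
qed

lemma transpose_clamp_ball: "transpose (clamp_ball r M) = clamp_ball r (transpose M)"
  for M :: "real^'n^'m"
  by (simp add: clamp_ball_def transpose_distribs norm_transpose)

lemmas lip_bounded_matrix_mult = lip_bounded_bilinear[OF bounded_bilinear_matrix_mult]

lemmas lip_bounded_scaleR = lip_bounded_bilinear[OF bounded_bilinear_scaleR]

lemmas lip_bounded_mult = lip_bounded_bilinear[OF bounded_bilinear_mult]

lemmas lip_bounded_transpose = lip_bounded_compose_linear[OF bounded_linear_transpose]

lemmas lip_bounded_fst = lip_bounded_compose_linear[OF bounded_linear_fst]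

lemmas lip_bounded_snd = lip_bounded_compose_linear[OF bounded_linear_snd]

lemmas lip_intros = lip_bounded_const lip_bounded_ident lip_bounded_Pair lip_bounded_add lip_bounded_matrix_mult
  lip_bounded_scaleR lip_bounded_mult lip_bounded_transpose lip_bounded_fst lip_bounded_snd

lemma sum_UNIV_sum:
  "(\<Sum>k\<in>UNIV. f k) = (\<Sum>a\<in>UNIV. f (Inl a)) + (\<Sum>b\<in>UNIV. f (Inr b))"
  for f :: "'a::finite + 'b::finite \<Rightarrow> 'c::comm_monoid_add"
  unfolding UNIV_Plus_UNIV[symmetric] by (subst sum.Plus) (auto simp: o_def)

lemma block_mat_nth [simp]:
  "block_mat A B C D $ Inl a $ Inl b = A $ a $ b" "block_mat A B C D $ Inl a $ Inr b' = B $ a $ b'"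
  "block_mat A B C D $ Inr a' $ Inl b = C $ a' $ b" "block_mat A B C D $ Inr a' $ Inr b' = D $ a' $ b'"
  by (simp_all add: block_mat_def)

definition block11 ::
  "real^('n1::finite+'n2::finite)^('m1::finite+'m2::finite) \<Rightarrow> real^'n1^'m1" where
  "block11 M = (\<chi> i j. M $ Inl i $ Inl j)"

definition block12 ::
  "real^('n1::finite+'n2::finite)^('m1::finite+'m2::finite) \<Rightarrow> real^'n2^'m1" where
  "block12 M = (\<chi> i j. M $ Inl i $ Inr j)"

definition block21 ::
  "real^('n1::finite+'n2::finite)^('m1::finite+'m2::finite) \<Rightarrow> real^'n1^'m2" where
  "block21 M = (\<chi> i j. M $ Inr i $ Inl j)"

definition block22 ::
  "real^('n1::finite+'n2::finite)^('m1::finite+'m2::finite) \<Rightarrow> real^'n2^'m2" where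
  "block22 M = (\<chi> i j. M $ Inr i $ Inr j)"

lemma block_mat_eqI:
  "M = block_mat (block11 M) (block12 M) (block21 M) (block22 M)"
  by (simp add: vec_eq_iff split_sum_all block11_def block12_def block21_def block22_def)

lemma block_of_block_mat [simp]:
  "block11 (block_mat A B C D) = A" "block12 (block_mat A B C D) = B"
  "block21 (block_mat A B C D) = C" "block22 (block_mat A B C D) = D"
  by (simp_all add: vec_eq_iff block11_def block12_def block21_def block22_def)

lemma block_mat_eq_iff:
  "block_mat A B C D = block_mat A' B' C' D' \<longleftrightarrow> A = A' \<and> B = B' \<and> C = C' \<and> D = D'"
  by (metis block_of_block_mat)

lemma block_mat_zero: "block_mat 0 0 0 0 = 0"
  by (simp add: vec_eq_iff split_sum_all)

lemma block_mat_add: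
  "block_mat A B C D + block_mat A' B' C' D' = block_mat (A + A') (B + B') (C + C') (D + D')"
  by (simp add: vec_eq_iff split_sum_all)

lemma block_mat_diff:
  "block_mat A B C D - block_mat A' B' C' D' = block_mat (A - A') (B - B') (C - C') (D - D')"
  by (simp add: vec_eq_iff split_sum_all)

lemma block_mat_transpose:
  "transpose (block_mat A B C D) = block_mat (transpose A) (transpose C) (transpose B) (transpose D)"
  by (simp add: vec_eq_iff split_sum_all transpose_def)

lemma block_mat_mult:
  "block_mat A B C D ** block_mat A' B' C' D' =
   block_mat (A ** A' + B ** C') (A ** B' + B ** D') (C ** A' + D ** C') (C ** B' + D ** D')"
  for A :: "real^'n1::finite^'m1::finite" and D :: "real^'n2::finite^'m2::finite"
  by (simp add: vec_eq_iff split_sum_all matrix_matrix_mult_def sum_UNIV_sum)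

lemma norm_block_mat_sq:
  "(norm (block_mat A B C D))\<^sup>2 = (norm A)\<^sup>2 + (norm B)\<^sup>2 + (norm C)\<^sup>2 + (norm D)\<^sup>2"
  by (simp add: power2_norm_eq_inner inner_vec_def sum_UNIV_sum sum.distrib)

lemma norm_block_mat_le:
  "norm (block_mat A B C D) \<le> norm A + norm B + norm C + norm D"
proof (rule power2_le_imp_le)
  show "(norm (block_mat A B C D))\<^sup>2 \<le> (norm A + norm B + norm C + norm D)\<^sup>2"
    unfolding norm_block_mat_sq by (simp add: power2_eq_square algebra_simps)
qed auto

lemma norm_block_le:
  "norm (block11 M) \<le> norm M" "norm (block12 M) \<le> norm M"
  "norm (block21 M) \<le> norm M" "norm (block22 M) \<le> norm M"
  using norm_block_mat_sq[of "block11 M" "block12 M" "block21 M" "block22 M"]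
  unfolding block_mat_eqI[symmetric] by - (rule power2_le_imp_le; simp)+

lemma bounded_linear_blocks:
  "bounded_linear (block11 :: real^('n1::finite+'n2::finite)^('m1::finite+'m2::finite) \<Rightarrow> _)"
  "bounded_linear (block12 :: real^('n1::finite+'n2::finite)^('m1::finite+'m2::finite) \<Rightarrow> _)"
  "bounded_linear (block21 :: real^('n1::finite+'n2::finite)^('m1::finite+'m2::finite) \<Rightarrow> _)"
  "bounded_linear (block22 :: real^('n1::finite+'n2::finite)^('m1::finite+'m2::finite) \<Rightarrow> _)"
  by (rule bounded_linear_intro[where K = 1]; (simp only: mult_1_right norm_block_le)?;
      simp add: vec_eq_iff block11_def block12_def block21_def block22_def)+

lemma bounded_linear_block_mat:
  "bounded_linear (\<lambda>(A :: real^'a^'b, B :: real^'c^'b, C :: real^'a^'d, D :: real^'c^'d). block_mat A B C D)"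
proof (rule bounded_linear_intro[where K = 4])
  fix x :: "(real^'a^'b) \<times> (real^'c^'b) \<times> (real^'a^'d) \<times> (real^'c^'d)"
  obtain A B C D where x: "x = (A, B, C, D)" by (cases x)
  have "norm A \<le> norm x" "norm B \<le> norm x" "norm C \<le> norm x" "norm D \<le> norm x"
    unfolding x by (auto simp: norm_Pair intro!: real_le_rsqrt) 
  then show "norm (case x of (A, B, C, D) \<Rightarrow> block_mat A B C D) \<le> norm x * 4"
    using norm_block_mat_le[of A B C D] by (simp add: x)
qed (auto simp: vec_eq_iff split_sum_all split: prod.splits)

lemma matrix_inv_inverse:
  assumes "invertible (A :: real^'n^'m)"
  shows "A ** matrix_inv A = mat 1" "matrix_inv A ** A = mat 1"
  using someI_ex[of "\<lambda>A'. A ** A' = mat 1 \<and> A' ** A = mat 1"] assms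
  unfolding matrix_inv_def invertible_def by auto

lemma matrix_inv_eqI:
  fixes A :: "real^'n^'m"
  assumes "A ** B = mat 1" "B ** A = mat 1" shows "matrix_inv A = B"
proof -
  have "invertible A" using assms unfolding invertible_def by blast
  then show ?thesis
    by (metis matrix_inv_inverse(2) assms(1) matrix_mul_assoc matrix_mul_lid matrix_mul_rid)
qed

lemma Rmat_inv: "matrix_inv (Rmat :: real^('k1::finite + 'k2::finite)^('k1 + 'k2)) = Rmat"
proof -
  have "(Rmat :: real^('k1 + 'k2)^('k1 + 'k2)) ** Rmat = block_mat (mat 1) 0 0 (mat 1)"
    unfolding Rmat_def by (simp add: block_mat_mult matrix_distribs)
  also have "\<dots> = mat 1" by (auto simp: vec_eq_iff split_sum_all mat_def)
  finally have "(Rmat :: real^('k1 + 'k2)^('k1 + 'k2)) ** Rmat = mat 1" .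
  then show ?thesis
    by (intro matrix_inv_eqI)
qed

section \<open>The full system\<close>

lemma Beps_quadratic:
  "- (Beps d \<epsilon> ** Rmat ** transpose (Beps d \<epsilon>)) =
    block_mat (Delta1 d) ((1/\<epsilon>) *\<^sub>R Delta d) ((1/\<epsilon>) *\<^sub>R transpose (Delta d)) ((1/\<epsilon>\<^sup>2) *\<^sub>R Delta2 d)"
proof -
  have "block_mat (Delta1 d) ((1/\<epsilon>) *\<^sub>R Delta d) ((1/\<epsilon>) *\<^sub>R transpose (Delta d)) ((1/\<epsilon>\<^sup>2) *\<^sub>R Delta2 d)
    + Beps d \<epsilon> ** Rmat ** transpose (Beps d \<epsilon>) = 0"
    unfolding Beps_def Rmat_def Delta1_def Delta_def Delta2_def
    by (simp add: block_mat_transpose block_mat_mult block_mat_add matrix_distribs transpose_distribs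
        block_mat_zero[symmetric] block_mat_eq_iff algebra_simps power2_eq_square)
  then show ?thesis by (metis add.commute neg_eq_iff_add_eq_0)
qed

abbreviation full_block ::
  "('n1::finite, 'n2::finite, 'k1::finite, 'k2::finite) riccati_data \<Rightarrow>
   real^'n1^'n1 \<Rightarrow> real^'n2^'n1 \<Rightarrow> real^'n2^'n2 \<Rightarrow> real \<Rightarrow> real^('n1 + 'n2)^('n1 + 'n2)" where
  "full_block d X Y W \<epsilon> \<equiv> block_mat (full_f d X Y W \<epsilon>) (full_g1 d X Y W \<epsilon>)
     (transpose (full_g1 d X Y W \<epsilon>)) (full_g2 d X Y W \<epsilon>)"

lemma sym_Delta: "transpose (Delta1 d) = Delta1 d" "transpose (Delta2 d) = Delta2 d"
  by (simp_all add: Delta1_def Delta2_def transpose_distribs)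

text \<open>
  The blocks of \<open>P\<close> in the rows and columns of the fast variables carry a factor \<open>\<epsilon>\<close>, and it cancels
  every negative power of \<open>\<epsilon>\<close> in the coefficients.
\<close>

lemma riccati_blocks:
  fixes d :: "('n1::finite, 'n2::finite, 'k1::finite, 'k2::finite) riccati_data" and Y :: "real^'n2^'n1"
  assumes "\<epsilon> \<noteq> 0" "transpose X = X" "transpose W = W" "Q2 d \<in> sym_mats"
  defines "P \<equiv> block_mat X (\<epsilon> *\<^sub>R Y) (\<epsilon> *\<^sub>R transpose Y) (\<epsilon> *\<^sub>R W)"
  shows "transpose (Aeps d \<epsilon>) ** P + P ** Aeps d \<epsilon>
          - P ** Beps d \<epsilon> ** matrix_inv Rmat ** transpose (Beps d \<epsilon>) ** P + Qmat d
    = full_block d X Y W \<epsilon>"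
proof -
  have "P ** Beps d \<epsilon> ** matrix_inv Rmat ** transpose (Beps d \<epsilon>) ** P
      = - (P ** (- (Beps d \<epsilon> ** Rmat ** transpose (Beps d \<epsilon>))) ** P)"
    by (simp add: Rmat_inv matrix_mul_assoc matrix_distribs)
  then have "transpose (Aeps d \<epsilon>) ** P + P ** Aeps d \<epsilon>
          - P ** Beps d \<epsilon> ** matrix_inv Rmat ** transpose (Beps d \<epsilon>) ** P + Qmat d
    = transpose (Aeps d \<epsilon>) ** P + P ** Aeps d \<epsilon> + P ** 
     block_mat (Delta1 d) ((1/\<epsilon>) *\<^sub>R Delta d) ((1/\<epsilon>) *\<^sub>R transpose (Delta d)) ((1/\<epsilon>\<^sup>2) *\<^sub>R Delta2 d) ** P + Qmat d"
    by (simp only: Beps_quadratic) simp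
  also have "\<dots> = full_block d X Y W \<epsilon>"
  proof -
    have D: "transpose (Delta1 d) = Delta1 d" "transpose (Delta2 d) = Delta2 d"
      by (simp_all add: Delta1_def Delta2_def transpose_distribs)
    show ?thesis
    unfolding P_def Aeps_def Qmat_def full_f_def full_g1_def full_g2_def using assms(1-3)
    by (simp add: block_mat_transpose block_mat_mult block_mat_add matrix_distribs transpose_distribs D
        block_mat_eq_iff scaleR_add_right power2_eq_square matrix_mul_assoc add_ac)
  qed
  finally show ?thesis .
qed

lemma full_imp_riccati_solution:
  fixes d :: "('n1::finite, 'n2::finite, 'k1::finite, 'k2::finite) riccati_data"
  assumes \<epsilon>: "0 < \<epsilon>" and Q2: "Q2 d \<in> sym_mats"
    and sol: "full_solution d T \<epsilon> (\<lambda>t. (X t, Y t, W t))"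
  shows "riccati_solution d T \<epsilon>
     (\<lambda>t. block_mat (X t) (\<epsilon> *\<^sub>R Y t) (\<epsilon> *\<^sub>R transpose (Y t)) (\<epsilon> *\<^sub>R W t))" (is "riccati_solution d T \<epsilon> ?P")
  unfolding riccati_solution_def
proof (intro conjI ballI)
  define J where "J = (\<lambda>(A :: real^'n1^'n1, B :: real^'n2^'n1, D :: real^'n2^'n2).
      block_mat A (\<epsilon> *\<^sub>R B) (\<epsilon> *\<^sub>R transpose B) (\<epsilon> *\<^sub>R D))"
  have J: "bounded_linear J"
  proof -
    have "bounded_linear (\<lambda>z :: (real^'n1^'n1) \<times> (real^'n2^'n1) \<times> (real^'n2^'n2).
        (fst z, \<epsilon> *\<^sub>R fst (snd z), \<epsilon> *\<^sub>R transpose (fst (snd z)), \<epsilon> *\<^sub>R snd (snd z)))"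
      by (intro bounded_linear_Pair bounded_linear_fst bounded_linear_snd
        bounded_linear_compose[OF bounded_linear_scaleR_right]
        bounded_linear_compose[OF bounded_linear_transpose]
        bounded_linear_compose[OF bounded_linear_fst] bounded_linear_compose[OF bounded_linear_snd])
    from bounded_linear_compose[OF bounded_linear_block_mat this] show ?thesis
      by (simp add: J_def case_prod_unfold)
  qed
  have PJ: "?P = (\<lambda>t. J (X t, Y t, W t))" by (simp add: J_def)
  show "continuous_on {0..T} ?P" unfolding PJ
    using sol by (intro bounded_linear.continuous_on[OF J]) (auto simp: full_solution_def)
  show "?P T = 0" using sol by (simp add: full_solution_def transpose_distribs block_mat_zero)
  fix t assume t: "t \<in> {0..T}"
  have sym: "transpose (X t) = X t" "transpose (W t) = W t"
    using sol t by (auto simp: full_solution_def sym_mats_def)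
  then show "?P t \<in> sym_mats"
    by (simp add: sym_mats_def block_mat_transpose transpose_distribs)
  obtain X' Y' W' where d: "((\<lambda>t. (X t, Y t, W t)) has_vector_derivative (X', Y', W')) (at t within {0..T})"
    and eq: "X' + full_f d (X t) (Y t) (W t) \<epsilon> = 0" "\<epsilon> *\<^sub>R Y' + full_g1 d (X t) (Y t) (W t) \<epsilon> = 0"
       "\<epsilon> *\<^sub>R W' + full_g2 d (X t) (Y t) (W t) \<epsilon> = 0"
  proof -
    have "\<exists>X' Y' W'. ((\<lambda>t. (X t, Y t, W t)) has_vector_derivative (X', Y', W')) (at t within {0..T}) \<and>
       X' + full_f d (X t) (Y t) (W t) \<epsilon> = 0 \<and> \<epsilon> *\<^sub>R Y' + full_g1 d (X t) (Y t) (W t) \<epsilon> = 0 \<and>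
       \<epsilon> *\<^sub>R W' + full_g2 d (X t) (Y t) (W t) \<epsilon> = 0"
      using sol t by (simp add: full_solution_def)
    then show ?thesis using that by blast
  qed
  show "\<exists>P'. (?P has_vector_derivative P') (at t within {0..T}) \<and>
        P' + transpose (Aeps d \<epsilon>) ** ?P t + ?P t ** Aeps d \<epsilon>
          - ?P t ** Beps d \<epsilon> ** matrix_inv Rmat ** transpose (Beps d \<epsilon>) ** ?P t + Qmat d = 0"
  proof (intro exI conjI)
    show "(?P has_vector_derivative J (X', Y', W')) (at t within {0..T})"
      unfolding PJ by (rule bounded_linear.has_vector_derivative[OF J d])
    have eqT: "\<epsilon> *\<^sub>R transpose Y' + transpose (full_g1 d (X t) (Y t) (W t) \<epsilon>) = 0"
      using arg_cong[OF eq(2), of transpose] by (simp only: transpose_distribs)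
    have "J (X', Y', W') + full_block d (X t) (Y t) (W t) \<epsilon> = 0"
      using eq eqT by (simp add: J_def block_mat_add block_mat_zero[symmetric] block_mat_eq_iff transpose_distribs)
    then show "J (X', Y', W') + transpose (Aeps d \<epsilon>) ** ?P t + ?P t ** Aeps d \<epsilon>
          - ?P t ** Beps d \<epsilon> ** matrix_inv Rmat ** transpose (Beps d \<epsilon>) ** ?P t + Qmat d = 0"
      unfolding riccati_blocks[OF less_imp_neq[OF \<epsilon>, symmetric] sym Q2, symmetric]
      by (simp only: add_diff_eq add.assoc[symmetric])
  qed
qed

lemma riccati_imp_full_solution:
  fixes d :: "('n1::finite, 'n2::finite, 'k1::finite, 'k2::finite) riccati_data"
  assumes \<epsilon>: "0 < \<epsilon>" and Q2: "Q2 d \<in> sym_mats"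
    and sol: "riccati_solution d T \<epsilon> P"
  obtains X Y W where "full_solution d T \<epsilon> (\<lambda>t. (X t, Y t, W t))"
    "\<And>t. t \<in> {0..T} \<Longrightarrow> P t = block_mat (X t) (\<epsilon> *\<^sub>R Y t) (\<epsilon> *\<^sub>R transpose (Y t)) (\<epsilon> *\<^sub>R W t)"
proof -
  define X where "X t = block11 (P t)" for t
  define Y where "Y t = (1/\<epsilon>) *\<^sub>R block12 (P t)" for t
  define W where "W t = (1/\<epsilon>) *\<^sub>R block22 (P t)" for t
  define J where "J M = (block11 M, (1/\<epsilon>) *\<^sub>R block12 M, (1/\<epsilon>) *\<^sub>R block22 M)"
    for M :: "real^('n1+'n2)^('n1+'n2)"
  have J: "bounded_linear J" unfolding J_def
    by (intro bounded_linear_Pair bounded_linear_compose[OF bounded_linear_scaleR_right] bounded_linear_blocks)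
  have PJ: "(\<lambda>t. (X t, Y t, W t)) = (\<lambda>t. J (P t))" by (simp add: J_def X_def Y_def W_def)
  have blocks: "transpose (X t) = X t" "transpose (W t) = W t"
    "P t = block_mat (X t) (\<epsilon> *\<^sub>R Y t) (\<epsilon> *\<^sub>R transpose (Y t)) (\<epsilon> *\<^sub>R W t)" if t: "t \<in> {0..T}" for t
  proof -
    have "transpose (P t) = P t" using sol t by (auto simp: riccati_solution_def sym_mats_def)
    then have "block_mat (transpose (block11 (P t))) (transpose (block21 (P t)))
        (transpose (block12 (P t))) (transpose (block22 (P t)))
      = block_mat (block11 (P t)) (block12 (P t)) (block21 (P t)) (block22 (P t))"
      by (simp flip: block_mat_transpose block_mat_eqI)
    then have s: "transpose (block11 (P t)) = block11 (P t)" "transpose (block12 (P t)) = block21 (P t)"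
      "transpose (block22 (P t)) = block22 (P t)"
      by (simp_all add: block_mat_eq_iff)
    then show "transpose (X t) = X t" "transpose (W t) = W t"
      by (simp_all add: X_def W_def transpose_distribs)
    show "P t = block_mat (X t) (\<epsilon> *\<^sub>R Y t) (\<epsilon> *\<^sub>R transpose (Y t)) (\<epsilon> *\<^sub>R W t)"
      using \<epsilon> s by (simp add: X_def Y_def W_def transpose_distribs flip: block_mat_eqI)
  qed
  have "full_solution d T \<epsilon> (\<lambda>t. (X t, Y t, W t))"
    unfolding full_solution_def
  proof (intro conjI ballI)
    show "continuous_on {0..T} (\<lambda>t. (X t, Y t, W t))" unfolding PJ
      using sol by (intro bounded_linear.continuous_on[OF J]) (auto simp: riccati_solution_def)
    show "(X T, Y T, W T) = (0, 0, 0)"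
      using sol linear_0[OF bounded_linear.linear[OF J]]
      by (simp add: riccati_solution_def X_def Y_def W_def J_def zero_prod_def)
    fix t assume t: "t \<in> {0..T}"
    show "(X t, Y t, W t) \<in> sym_mats \<times> UNIV \<times> sym_mats" using blocks[OF t] by (simp add: sym_mats_def)
    obtain P' where d: "(P has_vector_derivative P') (at t within {0..T})"
      and eq: "P' + transpose (Aeps d \<epsilon>) ** P t + P t ** Aeps d \<epsilon>
          - P t ** Beps d \<epsilon> ** matrix_inv Rmat ** transpose (Beps d \<epsilon>) ** P t + Qmat d = 0"
      using sol t unfolding riccati_solution_def by blast
    have "P' + full_block d (X t) (Y t) (W t) \<epsilon> = 0"
      using eq
      unfolding riccati_blocks[OF less_imp_neq[OF \<epsilon>, symmetric] blocks(1,2)[OF t] Q2, symmetric]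
        blocks(3)[OF t, symmetric]
      by (simp only: add_diff_eq add.assoc[symmetric])
    then have "block_mat (block11 P') (block12 P') (block21 P') (block22 P')
      + full_block d (X t) (Y t) (W t) \<epsilon> = 0"
      by (simp flip: block_mat_eqI)
    then have eqs: "block11 P' + full_f d (X t) (Y t) (W t) \<epsilon> = 0"
       "block12 P' + full_g1 d (X t) (Y t) (W t) \<epsilon> = 0" "block22 P' + full_g2 d (X t) (Y t) (W t) \<epsilon> = 0"
      by (simp_all add: block_mat_add block_mat_zero[symmetric] block_mat_eq_iff)
    show "\<exists>P11' P12' P22'.
            ((\<lambda>t. (X t, Y t, W t)) has_vector_derivative (P11', P12', P22')) (at t within {0..T}) \<and>
            (case (X t, Y t, W t) of (P11, P12, P22) \<Rightarrow> P11' + full_f d P11 P12 P22 \<epsilon> = 0 \<and>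
             \<epsilon> *\<^sub>R P12' + full_g1 d P11 P12 P22 \<epsilon> = 0 \<and> \<epsilon> *\<^sub>R P22' + full_g2 d P11 P12 P22 \<epsilon> = 0)"
    proof (intro exI conjI)
      show "((\<lambda>t. (X t, Y t, W t)) has_vector_derivative
          (block11 P', (1/\<epsilon>) *\<^sub>R block12 P', (1/\<epsilon>) *\<^sub>R block22 P')) (at t within {0..T})"
        using bounded_linear.has_vector_derivative[OF J d] unfolding PJ by (simp add: J_def)
    qed (use eqs \<epsilon> in simp)
  qed
  then show ?thesis using that blocks(3) by blast
qed

lemma lip_bounded_full:
  assumes "lip_bounded X" "lip_bounded Y" "lip_bounded W" "lip_bounded e"
  shows "lip_bounded (\<lambda>z. full_f d (X z) (Y z) (W z) (e z))"
    "lip_bounded (\<lambda>z. full_g1 d (X z) (Y z) (W z) (e z))"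
    "lip_bounded (\<lambda>z. full_g2 d (X z) (Y z) (W z) (e z))"
  unfolding full_f_def full_g1_def full_g2_def power2_eq_square
  by (intro lip_intros assms)+

text \<open>
  Reversing time absorbs the signs of the full system: this is its field in the variable \<open>s = T - t\<close>.
\<close>

definition full_field ::
  "('n1::finite, 'n2::finite, 'k1::finite, 'k2::finite) riccati_data \<Rightarrow> real \<Rightarrow>
   (real^'n1^'n1) \<times> (real^'n2^'n1) \<times> (real^'n2^'n2) \<Rightarrow> (real^'n1^'n1) \<times> (real^'n2^'n1) \<times> (real^'n2^'n2)" where
  "full_field d \<epsilon> z = (full_f d (fst z) (fst (snd z)) (snd (snd z)) \<epsilon>,
     (1/\<epsilon>) *\<^sub>R full_g1 d (fst z) (fst (snd z)) (snd (snd z)) \<epsilon>,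
     (1/\<epsilon>) *\<^sub>R full_g2 d (fst z) (fst (snd z)) (snd (snd z)) \<epsilon>)"

lemma lip_bounded_full_field: "lip_bounded (full_field d \<epsilon>)"
proof -
  have "lip_bounded (\<lambda>z. full_field d \<epsilon> z)"
    unfolding full_field_def by (intro lip_intros lip_bounded_full)
  then show ?thesis by simp
qed

lemma full_solution_reversed:
  assumes "0 < \<epsilon>" "full_solution d T \<epsilon> P" "s \<in> {0..T}"
  shows "((\<lambda>s. P (T - s)) has_vector_derivative full_field d \<epsilon> (P (T - s))) (at s within {0..T})"
proof -
  let ?full_f = "\<lambda>z. full_f d (fst z) (fst (snd z)) (snd (snd z)) \<epsilon>"
  let ?full_g1 = "\<lambda>z. full_g1 d (fst z) (fst (snd z)) (snd (snd z)) \<epsilon>"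
  let ?full_g2 = "\<lambda>z. full_g2 d (fst z) (fst (snd z)) (snd (snd z)) \<epsilon>"
  have "T - s \<in> {0..T}" using assms(3) by auto
  then obtain X' Y' W' where d: "(P has_vector_derivative (X', Y', W')) (at (T - s) within {0..T})"
    and eq: "X' + ?full_f (P (T - s)) = 0"
      "\<epsilon> *\<^sub>R Y' + ?full_g1 (P (T - s)) = 0"
      "\<epsilon> *\<^sub>R W' + ?full_g2 (P (T - s)) = 0"
    using assms(2) unfolding full_solution_def case_prod_unfold by blast
  have "- (X', Y', W') = full_field d \<epsilon> (P (T - s))"
  proof -
    have neg: "- Y = (1/\<epsilon>) *\<^sub>R G" if "\<epsilon> *\<^sub>R Y + G = 0" for Y G :: "'z::real_vector"
    proof -
      have "G = \<epsilon> *\<^sub>R (- Y)" using that by (simp add: eq_neg_iff_add_eq_0 add.commute)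
      then show ?thesis using \<open>0 < \<epsilon>\<close> by simp
    qed
    have "- X' = ?full_f (P (T - s))"
      by (rule minus_unique[OF eq(1)])
    then show ?thesis by (simp add: full_field_def neg[OF eq(2)] neg[OF eq(3)])
  qed
  then show ?thesis using has_vector_derivative_reflect[OF d] by simp
qed

lemma reversed_full_solution:
  assumes "0 < \<epsilon>" "Z 0 = 0" and sym: "\<And>s. s \<in> {0..T} \<Longrightarrow> Z s \<in> sym_mats \<times> UNIV \<times> sym_mats"
    and Z: "\<And>s. s \<in> {0..T} \<Longrightarrow> (Z has_vector_derivative full_field d \<epsilon> (Z s)) (at s within {0..T})"
  shows "full_solution d T \<epsilon> (\<lambda>t. Z (T - t))"
proof -
  let ?full_f = "\<lambda>z. full_f d (fst z) (fst (snd z)) (snd (snd z)) \<epsilon>"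
  let ?full_g1 = "\<lambda>z. full_g1 d (fst z) (fst (snd z)) (snd (snd z)) \<epsilon>"
  let ?full_g2 = "\<lambda>z. full_g2 d (fst z) (fst (snd z)) (snd (snd z)) \<epsilon>"
  have dv: "((\<lambda>t. Z (T - t)) has_vector_derivative - full_field d \<epsilon> (Z (T - t))) (at t within {0..T})"
    if "t \<in> {0..T}" for t
    using that by (intro has_vector_derivative_reflect Z) auto
  then have "continuous_on {0..T} (\<lambda>t. Z (T - t))" by (rule continuous_on_vector_derivative)
  moreover have "Z (T - t) \<in> sym_mats \<times> UNIV \<times> sym_mats" if "t \<in> {0..T}" for t
    using that by (intro sym) auto
  moreover have "\<exists>X' Y' W'. ((\<lambda>t. Z (T - t)) has_vector_derivative (X', Y', W')) (at t within {0..T}) \<and>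
      X' + ?full_f (Z (T - t)) = 0 \<and>
      \<epsilon> *\<^sub>R Y' + ?full_g1 (Z (T - t)) = 0 \<and>
      \<epsilon> *\<^sub>R W' + ?full_g2 (Z (T - t)) = 0"
    if "t \<in> {0..T}" for t
  proof -
    have cancel: "\<epsilon> *\<^sub>R - ((1/\<epsilon>) *\<^sub>R G) + G = 0" for G :: "'z::real_vector"
      using \<open>0 < \<epsilon>\<close> by simp
    show ?thesis
      by (intro exI conjI, rule dv[OF that, unfolded full_field_def uminus_Pair])
        (simp_all only: cancel left_minus)
  qed
  ultimately show ?thesis
    unfolding full_solution_def case_prod_unfold using assms(2) by (auto simp: zero_prod_def)
qed

lemma full_solution_unique:
  assumes "0 < \<epsilon>" "full_solution d T \<epsilon> P" "full_solution d T \<epsilon> P'" "t \<in> {0..T}"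
  shows "P t = P' t"
proof -
  have "P (T - (T - t)) = P' (T - (T - t))"
  proof (rule ode_unique[OF lip_bounded_full_field, where u = "\<lambda>s. P (T - s)" and v = "\<lambda>s. P' (T - s)" and b = T])
    show "((\<lambda>s. P (T - s)) has_vector_derivative full_field d \<epsilon> (P (T - s))) (at s within {0..T})"
      if "s \<in> {0..T}" for s by (rule full_solution_reversed[OF assms(1,2) that])
    show "((\<lambda>s. P' (T - s)) has_vector_derivative full_field d \<epsilon> (P' (T - s))) (at s within {0..T})"
      if "s \<in> {0..T}" for s by (rule full_solution_reversed[OF assms(1,3) that])
    show "P (T - 0) = P' (T - 0)" using assms(2,3) by (simp add: full_solution_def)
  qed (use assms(4) in auto)
  then show ?thesis by simp
qed

lemma full_sym:
  assumes "transpose X = X" "transpose W = W"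
  shows "Q1 d \<in> sym_mats \<Longrightarrow> transpose (full_f d X Y W \<epsilon>) = full_f d X Y W \<epsilon>"
    "Q2 d \<in> sym_mats \<Longrightarrow> transpose (full_g2 d X Y W \<epsilon>) = full_g2 d X Y W \<epsilon>"
proof -
  have D: "transpose (Delta1 d) = Delta1 d" "transpose (Delta2 d) = Delta2 d"
    by (simp_all add: Delta1_def Delta2_def transpose_distribs)
  show "Q1 d \<in> sym_mats \<Longrightarrow> transpose (full_f d X Y W \<epsilon>) = full_f d X Y W \<epsilon>"
    using assms by (simp add: full_f_def transpose_distribs D sym_mats_def matrix_mul_assoc add_ac)
  show "Q2 d \<in> sym_mats \<Longrightarrow> transpose (full_g2 d X Y W \<epsilon>) = full_g2 d X Y W \<epsilon>"
    using assms by (simp add: full_g2_def transpose_distribs D sym_mats_def matrix_mul_assoc add_ac)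
qed

section \<open>The stable equilibrium of the fast system and the reduced equation\<close>

text \<open>
  \<open>Pb\<close> is an equilibrium of the fast Riccati equation at which \<open>S\<close> is dissipative. The last
  condition places the initial value of the boundary layer in the ball on which the
  quadratic term cannot destroy this dissipation.
\<close>

locale stable_riccati =
  fixes d :: "('n1::finite, 'n2::finite, 'k1::finite, 'k2::finite) riccati_data"
    and Pb :: "real^'n2^'n2" and \<gamma> \<delta> :: real
  assumes inv_Delta2: "invertible (Delta2 d)"
    and sym_Pb: "transpose Pb = Pb"
    and are: "algebraic_riccati d Pb"
    and gamma: "0 < \<gamma>" and dissipative: "\<And>x. x \<bullet> (Smat d Pb *v x) \<le> - \<gamma> * (norm x)\<^sup>2"
    and delta: "0 < \<delta>" "\<delta> < \<gamma>"
    and Pb_ball: "- Pb \<in> Bball d Pb \<delta>"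
begin

abbreviation "S \<equiv> Smat d Pb"

abbreviation "h \<equiv> hmap d Pb"

abbreviation "layer_field X \<equiv> transpose S ** X + X ** S + X ** Delta2 d ** X"

lemma transpose_S: "transpose S = transpose (A22 d) + Pb ** Delta2 d"
  by (simp add: Smat_def transpose_distribs sym_Delta sym_Pb)

lemma invertible_S: "invertible S"
proof -
  have "x = 0" if "S *v x = 0" for x
    using dissipative[of x] that gamma by (simp add: mult_le_0_iff)
  then show ?thesis
    by (simp add: invertible_left_inverse matrix_left_invertible_ker)
qed

lemmas S_inverse = matrix_inv_inverse[OF invertible_S]

lemmas Delta2_inverse = matrix_inv_inverse[OF inv_Delta2]

text \<open>
  This equation says that \<open>(h X, Pb)\<close> is a zero of the first fast right-hand side at \<open>\<epsilon> = 0\<close>.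
\<close>

lemma h_S: "h X ** S = - (transpose (A21 d) ** Pb + X ** A12 d + X ** Delta d ** Pb)"
proof -
  have "h X ** S = - ((transpose (A21 d) ** Pb + X ** A12 d + X ** Delta d ** Pb) ** (matrix_inv S ** S))"
    unfolding hmap_def Smat_def[symmetric] by (simp add: matrix_distribs matrix_mul_assoc)
  then show ?thesis by (simp add: S_inverse)
qed

text \<open>
  Around the equilibrium the limit of the fast system is triangular: the deviation \<open>\<omega>\<close> of \<open>P\<^sub>2\<^sub>2\<close>
  evolves on its own (next lemma), and for given \<open>\<omega>\<close> the deviation \<open>\<eta>\<close> of \<open>P\<^sub>1\<^sub>2\<close> obeys an affine
  equation.
\<close>

lemma full_g1_layer:
  "full_g1 d X (\<eta> + h X) (\<omega> + Pb) 0 =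
    \<eta> ** S + (transpose (A21 d) + X ** Delta d + (\<eta> + h X) ** Delta2 d) ** \<omega>"
proof -
  have "full_g1 d X (\<eta> + h X) (\<omega> + Pb) 0 =
    (h X ** S + (transpose (A21 d) ** Pb + X ** A12 d + X ** Delta d ** Pb)) +
    (\<eta> ** S + (transpose (A21 d) + X ** Delta d + (\<eta> + h X) ** Delta2 d) ** \<omega>)"
    by (simp add: full_g1_def Smat_def matrix_distribs matrix_mul_assoc algebra_simps)
  then show ?thesis by (simp add: h_S)
qed

lemma full_g2_layer:
  "full_g2 d X Y (\<omega> + Pb) 0 = layer_field \<omega>"
proof -
  have "full_g2 d X Y (\<omega> + Pb) 0 =
    (transpose (A22 d) ** Pb + Pb ** A22 d + Pb ** Delta2 d ** Pb + Q2 d) +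
    layer_field \<omega>"
    unfolding transpose_S
    by (simp add: full_g2_def Smat_def matrix_distribs matrix_mul_assoc algebra_simps)
  then show ?thesis using are by (simp add: algebraic_riccati_def)
qed

text \<open>
  The expansion of the right-hand side yields \<open>A\<^sub>2\<^sub>2\<^sup>* \<Delta>\<^sub>2\<^sup>-\<^sup>1 A\<^sub>2\<^sub>2\<close> and three terms
  that the algebraic Riccati equation identifies as \<open>- Q\<^sub>2\<close>.
\<close>

lemma Lam_factor: "Lam d = transpose S ** matrix_inv (Delta2 d) ** S"
proof -
  have c: "M ** Delta2 d ** matrix_inv (Delta2 d) = M" for M :: "real^'n2^'n2"
    by (simp add: matrix_mul_assoc[symmetric] Delta2_inverse)
  have "transpose S ** matrix_inv (Delta2 d) ** S = 
    transpose (A22 d) ** matrix_inv (Delta2 d) ** A22 d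
      + transpose (A22 d) ** (matrix_inv (Delta2 d) ** Delta2 d) ** Pb + Pb ** A22 d + Pb ** Delta2 d ** Pb"
    unfolding transpose_S by (simp add: Smat_def matrix_distribs matrix_mul_assoc c)
  also have "\<dots> = transpose (A22 d) ** matrix_inv (Delta2 d) ** A22 d
      + (transpose (A22 d) ** Pb + Pb ** A22 d + Pb ** Delta2 d ** Pb)"
    by (simp add: Delta2_inverse)
  also have "transpose (A22 d) ** Pb + Pb ** A22 d + Pb ** Delta2 d ** Pb = - Q2 d"
    using are by (simp add: algebraic_riccati_def eq_neg_iff_add_eq_0)
  finally show ?thesis by (simp add: Lam_def)
qed

lemma transpose_inverse_Delta2: "transpose (matrix_inv (Delta2 d)) = matrix_inv (Delta2 d)"
proof -
  have "transpose (matrix_inv (Delta2 d)) ** Delta2 d = mat 1"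
    "Delta2 d ** transpose (matrix_inv (Delta2 d)) = mat 1"
    using arg_cong[OF Delta2_inverse(1), of transpose] arg_cong[OF Delta2_inverse(2), of transpose]
    by (simp_all add: transpose_distribs sym_Delta)
  then show ?thesis using matrix_inv_eqI by metis
qed

lemma S_inverse_transpose:
  "transpose S ** transpose (matrix_inv S) = mat 1" "transpose (matrix_inv S) ** transpose S = mat 1"
  using S_inverse by (simp_all add: transpose_distribs(6)[symmetric])

lemma inverse_Lam: "matrix_inv (Lam d) = matrix_inv S ** Delta2 d ** transpose (matrix_inv S)"
proof (rule matrix_inv_eqI)
  have "Lam d ** (matrix_inv S ** Delta2 d ** transpose (matrix_inv S))
    = transpose S ** (matrix_inv (Delta2 d) ** ((S ** matrix_inv S) ** Delta2 d)) ** transpose (matrix_inv S)"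
    by (simp only: Lam_factor matrix_mul_assoc)
  then show "Lam d ** (matrix_inv S ** Delta2 d ** transpose (matrix_inv S)) = mat 1"
    by (simp add: S_inverse Delta2_inverse S_inverse_transpose)
  have "matrix_inv S ** Delta2 d ** transpose (matrix_inv S) ** Lam d
    = matrix_inv S ** (Delta2 d ** ((transpose (matrix_inv S) ** transpose S) ** matrix_inv (Delta2 d))) ** S"
    by (simp only: Lam_factor matrix_mul_assoc)
  then show "matrix_inv S ** Delta2 d ** transpose (matrix_inv S) ** Lam d = mat 1"
    by (simp add: S_inverse Delta2_inverse S_inverse_transpose)
qed

text \<open>
  Substituting \<open>Pb = (S\<^sup>* - A\<^sub>2\<^sub>2\<^sup>*) \<Delta>\<^sub>2\<^sup>-\<^sup>1\<close> removes \<open>Pb\<close> from \<open>h\<close>. This leads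
  towards the coefficients of the reduced equation, which contain \<open>A\<^sub>2\<^sub>2\<close> and \<open>\<Lambda>\<close> only.
\<close>

lemma transpose_h:
  assumes "transpose X = X"
  shows "transpose (h X) = transpose (matrix_inv S) ** (transpose (A22 d) ** matrix_inv (Delta2 d) **
      (A21 d + transpose (Delta d) ** X) - transpose (A12 d) ** X)
    - matrix_inv (Delta2 d) ** (A21 d + transpose (Delta d) ** X)"
proof -
  define V where "V = A21 d + transpose (Delta d) ** X"
  have Pb: "Pb = (transpose S - transpose (A22 d)) ** matrix_inv (Delta2 d)"
  proof -
    have "(transpose S - transpose (A22 d)) ** matrix_inv (Delta2 d) = Pb ** (Delta2 d ** matrix_inv (Delta2 d))"
      by (simp add: transpose_S matrix_mul_assoc)
    then show ?thesis by (simp add: Delta2_inverse)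
  qed
  have "transpose (h X) = - (transpose (matrix_inv S) ** (Pb ** V + transpose (A12 d) ** X))"
    unfolding hmap_def Smat_def[symmetric] V_def
    by (simp add: transpose_distribs assms sym_Pb matrix_distribs matrix_mul_assoc)
  also have "\<dots> = - ((transpose (matrix_inv S) ** transpose S) ** matrix_inv (Delta2 d) ** V
      + transpose (matrix_inv S) ** (transpose (A12 d) ** X - transpose (A22 d) ** matrix_inv (Delta2 d) ** V))"
    by (subst Pb) (simp add: matrix_distribs matrix_mul_assoc)
  also have "\<dots> = transpose (matrix_inv S) ** (transpose (A22 d) ** matrix_inv (Delta2 d) ** V - transpose (A12 d) ** X)
    - matrix_inv (Delta2 d) ** V"
    by (simp add: S_inverse_transpose matrix_distribs)
  finally show ?thesis unfolding V_def .
qed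

text \<open>
  Write \<open>E = \<Delta>\<^sub>2\<^sup>-\<^sup>1\<close>, \<open>V = A\<^sub>2\<^sub>1 + \<Delta>\<^sup>* X\<close> and \<open>U = A\<^sub>2\<^sub>2\<^sup>* E V - A\<^sub>1\<^sub>2\<^sup>* X\<close>. Then
  \<open>h X = U\<^sup>* S\<^sup>-\<^sup>1 - V\<^sup>* E\<close>, and completing the square turns the terms that contain \<open>h X\<close> into
  \<open>U\<^sup>* \<Lambda>\<^sup>-\<^sup>1 U - V\<^sup>* E V\<close>. Its expansion in \<open>X\<close> yields the reduced coefficients.
\<close>

lemma reduced_equation:
  assumes X: "transpose X = X"
  shows "full_f d X (h X) W \<epsilon> = transpose (Atilde d) ** X + X ** Atilde d + X ** Mred d ** X + Nred d"
proof -
  define V where "V = A21 d + transpose (Delta d) ** X"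
  define E where "E = matrix_inv (Delta2 d)"
  define Si where "Si = matrix_inv S"
  define L where "L = matrix_inv (Lam d)"
  define U where "U = transpose (A22 d) ** E ** V - transpose (A12 d) ** X"
  have E: "transpose E = E" "Delta2 d ** E = mat 1" "E ** Delta2 d = mat 1"
    using transpose_inverse_Delta2 Delta2_inverse by (auto simp: E_def)
  have L: "L = Si ** Delta2 d ** transpose Si" by (simp add: L_def Si_def inverse_Lam)
  have LT: "transpose L = L" by (simp add: L transpose_distribs sym_Delta matrix_mul_assoc)
  have hT: "transpose (h X) = transpose Si ** U - E ** V"
    unfolding transpose_h[OF X] U_def Si_def E_def V_def ..
  have h: "h X = transpose U ** Si - transpose V ** E"
    using arg_cong[OF hT, of transpose] by (simp add: transpose_distribs E)
  have cancel: "M ** E ** Delta2 d = M" "M ** Delta2 d ** E = M" for M :: "real^'n2^'k"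
    by (simp_all add: matrix_mul_assoc[symmetric] E)
  have "full_f d X (h X) W \<epsilon> = transpose (A11 d) ** X + X ** A11 d + X ** Delta1 d ** X + Q1 d
      + (transpose V ** transpose (h X) + h X ** V + h X ** Delta2 d ** transpose (h X))"
    by (simp add: full_f_def V_def matrix_distribs transpose_distribs X matrix_mul_assoc add_ac)
  also have "transpose V ** transpose (h X) + h X ** V + h X ** Delta2 d ** transpose (h X)
      = transpose U ** L ** U - transpose V ** E ** V"
    unfolding hT unfolding h L
    by (simp add: matrix_distribs matrix_mul_assoc cancel)
  finally have "full_f d X (h X) W \<epsilon> = transpose (A11 d) ** X + X ** A11 d + X ** Delta1 d ** X + Q1 d
      + (transpose U ** L ** U - transpose V ** E ** V)" .
  also have "\<dots> = transpose (Atilde d) ** X + X ** Atilde d + X ** Mred d ** X + Nred d"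
    unfolding U_def V_def Atilde_def Mred_def Nred_def Let_def E_def[symmetric] L_def[symmetric]
    by (simp add: matrix_distribs transpose_distribs X E(1) LT matrix_mul_assoc cancel sym_Delta algebra_simps)
  finally show ?thesis .
qed

text \<open>
  The maximum that defines the radius is attained: admissible radii are bounded, because
  \<open>c \<Delta>\<^sub>2\<close> violates the defining inequality for large \<open>c\<close>, and their supremum is admissible, because
  the inequality is affine along rays. The radius is positive because \<open>S\<close> is dissipative, so that
  there is room for a small \<open>\<Delta>\<^sub>2 P\<close>.
\<close>

lemma Bball_subset: "Bball d Pb \<delta> \<subseteq> Rset d Pb \<delta>" and q2_pos: "0 < q2_radius d Pb \<delta>"
proof -
  have Rset: "P \<in> Rset d Pb \<delta> \<longleftrightarrow> transpose P = P \<and>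
      (\<forall>x. x \<bullet> (S *v x) + x \<bullet> ((Delta2 d ** P) *v x) \<le> \<delta> * (norm x)\<^sup>2)" for P
    unfolding Rset_def sym_mats_def
    by (simp add: psd_le_sym_part_iff matrix_vector_mult_add_rdistrib inner_add_right)
  define Rs where "Rs = {r. 0 \<le> r \<and> cball 0 r \<inter> sym_mats \<subseteq> Rset d Pb \<delta>}"
  define r0 where "r0 = (\<gamma> + \<delta>) / (norm (Delta2 d) + 1)"
  have n1: "0 < norm (Delta2 d) + 1" using norm_ge_zero[of "Delta2 d"] by linarith
  have r0: "0 < r0" using gamma delta n1 by (simp add: r0_def)
  have r0_in: "r0 \<in> Rs"
  proof -
    have "x \<bullet> (S *v x) + x \<bullet> ((Delta2 d ** P) *v x) \<le> \<delta> * (norm x)\<^sup>2" if "norm P \<le> r0" for P x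
    proof -
      have "x \<bullet> ((Delta2 d ** P) *v x) \<le> norm x * norm ((Delta2 d ** P) *v x)" by (rule norm_cauchy_schwarz)
      also have "\<dots> \<le> norm x * (norm (Delta2 d ** P) * norm x)"
        by (intro mult_left_mono norm_matrix_vector_mult_le) auto
      also have "\<dots> \<le> norm x * (((norm (Delta2 d) + 1) * r0) * norm x)"
        using that n1 by (intro mult_left_mono mult_right_mono order_trans[OF norm_matrix_mult_le] mult_mono) auto
      also have "\<dots> = (\<gamma> + \<delta>) * (norm x)\<^sup>2" using n1 by (simp add: r0_def power2_eq_square)
      finally show ?thesis using dissipative[of x] by (simp add: distrib_right)
    qed
    then show ?thesis using r0 by (auto simp: Rs_def Rset sym_mats_def)
  qed
  have "\<exists>B. \<forall>r\<in>Rs. r \<le> B"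
  proof -
    have "\<exists>x. Delta2 d *v x \<noteq> 0"
    proof (rule ccontr)
      assume "\<nexists>x. Delta2 d *v x \<noteq> 0"
      then have "matrix_inv (Delta2 d) *v (Delta2 d *v x) = 0" for x by simp
      then have "x = 0" for x :: "real^'n2" by (simp add: matrix_vector_mul_assoc Delta2_inverse)
      from this[of "axis undefined 1"] show False by (simp add: axis_eq_0_iff)
    qed
    then obtain x where x: "Delta2 d *v x \<noteq> 0" by blast
    define c where "c = (\<delta> * (norm x)\<^sup>2 + \<bar>x \<bullet> (S *v x)\<bar> + 1) / (norm (Delta2 d *v x))\<^sup>2"
    have c: "0 < c" unfolding c_def using x delta
      by (intro divide_pos_pos add_nonneg_pos add_nonneg_nonneg mult_nonneg_nonneg) auto
    have "r \<le> c * norm (Delta2 d)" if "r \<in> Rs" for r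
    proof (rule ccontr)
      assume "\<not> r \<le> c * norm (Delta2 d)"
      then have "c *\<^sub>R Delta2 d \<in> Rset d Pb \<delta>"
        using that c by (auto simp: Rs_def sym_mats_def transpose_distribs sym_Delta)
      then have "x \<bullet> (S *v x) + x \<bullet> ((Delta2 d ** (c *\<^sub>R Delta2 d)) *v x) \<le> \<delta> * (norm x)\<^sup>2"
        by (simp add: Rset)
      moreover have "x \<bullet> ((Delta2 d ** (c *\<^sub>R Delta2 d)) *v x) = c * (norm (Delta2 d *v x))\<^sup>2"
      proof -
        have "x \<bullet> ((Delta2 d ** (c *\<^sub>R Delta2 d)) *v x) = c * (x \<bullet> (Delta2 d *v (Delta2 d *v x)))"
          by (simp add: matrix_distribs scaleR_matrix_vector_assoc[symmetric] matrix_vector_mul_assoc)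
        also have "x \<bullet> (Delta2 d *v (Delta2 d *v x)) = (Delta2 d *v x) \<bullet> (Delta2 d *v x)"
          using dot_lmul_matrix[of x "Delta2 d" "Delta2 d *v x"] sym_Delta(2)
          by (metis transpose_matrix_vector)
        finally show ?thesis by (simp add: power2_norm_eq_inner)
      qed
      ultimately show False using x by (simp add: c_def)
    qed
    then show ?thesis by blast
  qed
  then have bdd: "bdd_above Rs" unfolding bdd_above_def .
  define m where "m = Sup Rs"
  have m_ge: "r \<le> m" if "r \<in> Rs" for r using cSup_upper[OF that bdd] by (simp add: m_def)
  have m0: "0 < m" using m_ge[OF r0_in] r0 by simp
  have "m \<in> Rs"
  proof -
    have "P \<in> Rset d Pb \<delta>" if P: "norm P \<le> m" "transpose P = P" for P
    proof -
      have "t * (x \<bullet> ((Delta2 d ** P) *v x)) \<le> \<delta> * (norm x)\<^sup>2 - x \<bullet> (S *v x)" if t: "0 < t" "t < 1" for t x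
      proof -
        have "t * norm P < m"
          using t P m0 mult_right_mono[of t 1 "norm P"] mult_strict_right_mono[of t 1 m]
            mult_left_mono[OF P(1), of t] by linarith
        then obtain r where "r \<in> Rs" "t * norm P < r"
          using less_cSup_iff[OF _ bdd, of "t * norm P"] r0_in unfolding m_def by blast
        then have "t *\<^sub>R P \<in> Rset d Pb \<delta>"
          using t P(2) by (auto simp: Rs_def sym_mats_def transpose_distribs)
        then have "x \<bullet> (S *v x) + x \<bullet> ((Delta2 d ** (t *\<^sub>R P)) *v x) \<le> \<delta> * (norm x)\<^sup>2"
          by (simp add: Rset)
        then show ?thesis by (simp add: matrix_distribs scaleR_matrix_vector_assoc[symmetric])
      qed
      then have "x \<bullet> ((Delta2 d ** P) *v x) \<le> \<delta> * (norm x)\<^sup>2 - x \<bullet> (S *v x)" for x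
        by (rule field_le_mult_one_interval)
      then show ?thesis using P(2) by (simp add: Rset algebra_simps)
    qed
    then show ?thesis using m0 by (auto simp: Rs_def sym_mats_def)
  qed
  then have "q2_radius d Pb \<delta> = m" unfolding q2_radius_def
    using m_ge by (intro Greatest_equality) (auto simp: Rs_def)
  then show "Bball d Pb \<delta> \<subseteq> Rset d Pb \<delta>" "0 < q2_radius d Pb \<delta>"
    using \<open>m \<in> Rs\<close> m0 by (auto simp: Bball_def Rs_def)
qed

end

section \<open>The boundary layer\<close>

context stable_riccati
begin

lemma inner_mult_S: "Y \<bullet> (Y ** S) \<le> - \<gamma> * (norm Y)\<^sup>2" for Y :: "real^'n2^'m"
  by (rule inner_mult_right_le) (rule dissipative)

lemma inner_Lyapunov:
  assumes "transpose X = X"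
  shows "X \<bullet> (transpose S ** X + X ** S) = 2 * (X \<bullet> (X ** S))"
proof -
  have "X \<bullet> (transpose S ** X) = transpose X \<bullet> transpose (transpose S ** X)"
    by (simp only: inner_transpose)
  then show ?thesis by (simp add: transpose_distribs assms inner_add_right)
qed

text \<open>
  For \<open>X = Z\<close> this is the decay of the layer: in terms of symmetric parts, half of \<open>2 S\<close> combines with the quadratic term to
  \<open>S + \<Delta>\<^sub>2 X \<le> \<delta>\<close>, the other half contributes \<open>-\<gamma>\<close>. The factor \<open>\<theta>\<close> covers a quadratic term
  that is evaluated at a clamped argument, where the combination is applied with weight \<open>\<theta>\<close>.
\<close>

lemma layer_slope:
  assumes "transpose X = X" "norm X \<le> q2_radius d Pb \<delta>" "transpose Z = Z" "0 \<le> \<theta>" "\<theta> \<le> 1"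
    and Z: "X = \<theta> *\<^sub>R Z"
  shows "Z \<bullet> (transpose S ** Z + Z ** S + X ** Delta2 d ** X) \<le> - (\<gamma> - \<delta>) * (norm Z)\<^sup>2"
proof -
  have "X \<in> Rset d Pb \<delta>"
    using assms Bball_subset by (auto simp: Bball_def sym_mats_def)
  then have "x \<bullet> ((S + Delta2 d ** X) *v x) \<le> \<delta> * (norm x)\<^sup>2" for x
    by (simp add: Rset_def psd_le_sym_part_iff)
  then have "Z \<bullet> (Z ** (S + Delta2 d ** X)) \<le> \<delta> * (norm Z)\<^sup>2" by (rule inner_mult_right_le)
  then have 1: "Z \<bullet> (Z ** Delta2 d ** X) \<le> \<delta> * (norm Z)\<^sup>2 - Z \<bullet> (Z ** S)"
    by (simp add: matrix_distribs inner_add_right matrix_mul_assoc)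
  have "Z \<bullet> (X ** Delta2 d ** X) = \<theta> * (Z \<bullet> (Z ** Delta2 d ** X))"
    using Z by (metis inner_scaleR_right matmul.scaleR_left)
  also have "\<dots> \<le> \<theta> * (\<delta> * (norm Z)\<^sup>2 - Z \<bullet> (Z ** S))"
    using 1 assms(4) by (rule mult_left_mono)
  finally have "Z \<bullet> (transpose S ** Z + Z ** S + X ** Delta2 d ** X)
     \<le> (2 - \<theta>) * (Z \<bullet> (Z ** S)) + \<theta> * (\<delta> * (norm Z)\<^sup>2)"
    using inner_Lyapunov[OF assms(3)] by (simp add: inner_add_right algebra_simps)
  also have "\<dots> \<le> (2 - \<theta>) * (- \<gamma> * (norm Z)\<^sup>2) + 1 * (\<delta> * (norm Z)\<^sup>2)"
    using assms delta by (intro add_mono mult_left_mono mult_right_mono inner_mult_S) auto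
  also have "\<dots> \<le> 1 * (- \<gamma> * (norm Z)\<^sup>2) + 1 * (\<delta> * (norm Z)\<^sup>2)"
    using assms gamma mult_right_mono_neg[of 1 "2 - \<theta>" "- \<gamma> * (norm Z)\<^sup>2"] by simp
  finally show ?thesis by (simp add: algebra_simps)
qed

text \<open>
  The equation with the quadratic term clamped to the ball has a global solution. Its norm decreases
  and starts inside the ball, so that clamping never acts.
\<close>

lemma layer_P22:
  obtains X where "X 0 = - Pb" "\<And>t. 0 \<le> t \<Longrightarrow> transpose (X t) = X t"
    "\<And>t. 0 \<le> t \<Longrightarrow>
      (X has_vector_derivative layer_field (X t)) (at t within {0..})"
    "\<And>t. 0 \<le> t \<Longrightarrow> norm (X t) \<le> norm Pb * exp (- (\<gamma> - \<delta>) * t)"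
    "\<And>t. 0 \<le> t \<Longrightarrow> norm (X t) \<le> norm Pb"
proof -
  define r where "r = q2_radius d Pb \<delta>"
  have r: "0 < r" using q2_pos by (simp add: r_def)
  define c where "c Z = clamp_ball r Z" for Z :: "real^'n2^'n2"
  have "lip_bounded (\<lambda>Z. Z ** Delta2 d ** Z)" by (intro lip_intros)
  then obtain L where L: "0 \<le> L" "\<And>z w. norm z \<le> r \<Longrightarrow> norm w \<le> r \<Longrightarrow>
      norm (z ** Delta2 d ** z - w ** Delta2 d ** w) \<le> L * norm (z - w)"
    using lip_boundedE by blast
  define f where "f s Z = transpose S ** Z + Z ** S + c Z ** Delta2 d ** c Z" for s :: real and Z
  have "\<exists>X. X 0 = - Pb \<and> (\<forall>t\<ge>0. sym_part (X t) = X t) \<and>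
      (\<forall>t\<ge>0. (X has_vector_derivative f t (X t)) (at t within {0..}))"
  proof (rule picard_subspace[where pr = sym_part and f = f and L = "2 * norm S + 2 * L" and C = 0 and ?x0.0 = "- Pb"])
    show "sym_part (sym_part z) = sym_part z" for z :: "real^'n2^'n2" by (simp add: sym_part(2,3))
    show "sym_part (f s z) = f s z" if "sym_part z = z" for s z
      using that by (simp add: sym_part(3) f_def c_def transpose_distribs transpose_clamp_ball sym_Delta
          matrix_mul_assoc add.commute)
    show "sym_part (- Pb) = - Pb" by (simp add: sym_part(3) sym_Pb transpose_distribs)
    show "continuous_on {0..} (\<lambda>s. f s (u s))" if "continuous_on {0..} u" for u
      unfolding f_def c_def using that r
      by (intro continuous_intros matmul.continuous_on) auto
    show "norm (f s x - f s y) \<le> (2 * norm S + 2 * L) * norm (x - y)" for s x y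
    proof -
      have "f s x - f s y = transpose S ** (x - y) + (x - y) ** S
          + (c x ** Delta2 d ** c x - c y ** Delta2 d ** c y)"
        by (simp add: f_def matrix_distribs)
      also have "norm \<dots> \<le> norm S * norm (x - y) + norm (x - y) * norm S + (2 * L) * norm (x - y)"
        using norm_matrix_mult_le[of "transpose S" "x - y"] norm_matrix_mult_le[of "x - y" S]
          norm_clamped_le[where F = "\<lambda>Z. Z ** Delta2 d ** Z", OF r L]
        by (intro norm_triangle_le add_mono) (auto simp: norm_transpose c_def)
      finally show ?thesis by (simp add: algebra_simps)
    qed
    show "norm (f s 0) \<le> 0" for s by (simp add: f_def c_def clamp_ball_def matrix_distribs)
  qed (auto simp: sym_part intro: exI)
  then obtain X where X: "X 0 = - Pb" "\<And>t. 0 \<le> t \<Longrightarrow> transpose (X t) = X t"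
    "\<And>t. 0 \<le> t \<Longrightarrow> (X has_vector_derivative f t (X t)) (at t within {0..})"
    by (auto simp: sym_part(3))
  have "norm Pb \<le> r" using Pb_ball by (simp add: Bball_def r_def)
  have decay: "(norm (X t))\<^sup>2 \<le> (norm Pb * exp (- (\<gamma> - \<delta>) * t))\<^sup>2" if t: "0 \<le> t" for t
  proof (rule comparison[where v = "\<lambda>t. (norm (X t))\<^sup>2" and m = "\<lambda>t. (norm Pb * exp (- (\<gamma> - \<delta>) * t))\<^sup>2" and s = t and b = t
        and v' = "\<lambda>t. 2 * (X t \<bullet> f t (X t))" and a = "\<lambda>_. - 2 * (\<gamma> - \<delta>)"
        and m' = "\<lambda>t. - 2 * (\<gamma> - \<delta>) * (norm Pb * exp (- (\<gamma> - \<delta>) * t))\<^sup>2"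
        and A = "\<lambda>s. - 2 * (\<gamma> - \<delta>) * s" and r = "\<lambda>_. 0"])
    fix s assume s: "s \<in> {0..t}"
    show "((\<lambda>t. (norm (X t))\<^sup>2) has_real_derivative 2 * (X s \<bullet> f s (X s))) (at s within {0..t})"
      using X(3)[of s] s
      by (intro has_real_derivative_norm_sq) (auto elim!: has_vector_derivative_within_subset)
    show "2 * (X s \<bullet> f s (X s)) \<le> - 2 * (\<gamma> - \<delta>) * (norm (X s))\<^sup>2 + 0"
    proof -
      obtain \<theta> where \<theta>: "0 < \<theta>" "\<theta> \<le> 1" "clamp_ball r (X s) = \<theta> *\<^sub>R X s"
        using clamp_ball_shrinks[OF r] by blast
      have "X s \<bullet> (transpose S ** X s + X s ** S + c (X s) ** Delta2 d ** c (X s)) \<le> - (\<gamma> - \<delta>) * (norm (X s))\<^sup>2"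
        using s \<theta> X(2)[of s] norm_clamp_ball[OF r, of "X s"]
        by (intro layer_slope[where \<theta> = \<theta>]) (auto simp: c_def r_def transpose_distribs)
      then show ?thesis by (simp add: f_def algebra_simps)
    qed
    show "((\<lambda>t. (norm Pb * exp (- (\<gamma> - \<delta>) * t))\<^sup>2) has_real_derivative
        - 2 * (\<gamma> - \<delta>) * (norm Pb * exp (- (\<gamma> - \<delta>) * s))\<^sup>2) (at s within {0..t})"
      by (auto intro!: derivative_eq_intros simp: power2_eq_square)
    show "((\<lambda>s. - 2 * (\<gamma> - \<delta>) * s) has_real_derivative - 2 * (\<gamma> - \<delta>)) (at s within {0..t})"
      by (auto intro!: derivative_eq_intros)
  qed (use X(1) t in auto)
  have bd: "norm (X t) \<le> norm Pb * exp (- (\<gamma> - \<delta>) * t)" if "0 \<le> t" for t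
    using decay[OF that] by (rule power2_le_imp_le) auto
  have bd1: "norm (X t) \<le> norm Pb" if "0 \<le> t" for t
  proof -
    have "norm Pb * exp (- (\<gamma> - \<delta>) * t) \<le> norm Pb * 1"
      using that delta by (intro mult_left_mono) (auto simp: mult_nonpos_nonneg)
    then show ?thesis using bd[OF that] by linarith
  qed
  have "f t (X t) = layer_field (X t)" if "0 \<le> t" for t
    using order_trans[OF bd1[OF that] \<open>norm Pb \<le> r\<close>] by (simp add: f_def c_def clamp_ball_id)
  then show ?thesis using that X bd bd1 by metis
qed

text \<open>
  Once the second component \<open>X\<close> is known, the first one solves a linear equation with coefficient
  \<open>S + \<Delta>\<^sub>2 X\<close>, which tends to \<open>S\<close> exponentially fast. Its decay follows from the differential
  inequality for \<open>exp (2 \<kappa> t) |Y|\<^sup>2\<close>.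
\<close>

lemma boundary_layer:
  obtains \<Phi> \<kappa> C where "unique_solution_on {0..} (boundary_layer_solution d Pb) \<Phi>" "0 < \<kappa>" "0 \<le> C"
    "\<And>t. 0 \<le> t \<Longrightarrow> norm (fst (\<Phi> t)) \<le> C * exp (- \<kappa> * t)"
    "\<And>t. 0 \<le> t \<Longrightarrow> norm (snd (\<Phi> t)) \<le> C * exp (- \<kappa> * t)"
proof -
  obtain X where X: "X 0 = - Pb" "\<And>t. 0 \<le> t \<Longrightarrow> transpose (X t) = X t"
    "\<And>t. 0 \<le> t \<Longrightarrow>
      (X has_vector_derivative layer_field (X t)) (at t within {0..})"
    "\<And>t. 0 \<le> t \<Longrightarrow> norm (X t) \<le> norm Pb * exp (- (\<gamma> - \<delta>) * t)"
    "\<And>t. 0 \<le> t \<Longrightarrow> norm (X t) \<le> norm Pb"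
    using layer_P22 by blast
  define H where "H = transpose (A21 d) + h 0 ** Delta2 d"
  define f where "f s Y = Y ** S + (Y ** Delta2 d + H) ** X s" for s Y
  have contX: "continuous_on {0..} X"
    using X(3) by (auto intro!: continuous_on_vector_derivative)
  define q where "q = norm (Delta2 d) * norm Pb"
  define C1 where "C1 = norm H * norm Pb"
  obtain Y where Y: "Y 0 = - h 0"
    "\<And>t. 0 \<le> t \<Longrightarrow> (Y has_vector_derivative f t (Y t)) (at t within {0..})"
  proof (rule picard_lipschitz[where f = f and L = "norm S + q" and C = C1 and ?x0.0 = "- h 0"])
    show "continuous_on {0..} (\<lambda>s. f s (u s))" if "continuous_on {0..} u" for u
      unfolding f_def using that contX by (intro continuous_intros matmul.continuous_on) auto
    show "norm (f s x - f s y) \<le> (norm S + q) * norm (x - y)" if "0 \<le> s" for s x y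
    proof -
      have "f s x - f s y = (x - y) ** S + (x - y) ** Delta2 d ** X s"
        by (simp add: f_def matrix_distribs)
      also have "norm \<dots> \<le> norm (x - y) * norm S + norm (x - y) * norm (Delta2 d) * norm Pb"
        using X(5)[OF that]
        by (intro norm_triangle_le add_mono norm_matrix_mult_le order_trans[OF norm_matrix_mult_le] mult_mono) auto
      finally show ?thesis by (simp add: algebra_simps q_def)
    qed
    show "norm (f s 0) \<le> C1" if "0 \<le> s" for s
      using order_trans[OF norm_matrix_mult_le mult_left_mono[OF X(5)[OF that]], of H]
      by (simp add: f_def C1_def matrix_distribs)
  qed auto
  \<comment> \<open>the weight \<open>exp (2 \<kappa> t)\<close> then uses up at most half of the damping \<open>\<gamma>\<close>\<close>
  define \<kappa> where "\<kappa> = min (\<gamma> - \<delta>) (\<gamma> / 4)"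
  have \<kappa>: "0 < \<kappa>" "\<kappa> \<le> \<gamma> - \<delta>" "4 * \<kappa> \<le> \<gamma>" using gamma delta by (auto simp: \<kappa>_def min_def)
  have Xk: "norm (X t) \<le> norm Pb * exp (- \<kappa> * t)" if "0 \<le> t" for t
    using X(4)[OF that] \<kappa>(2) that mult_right_mono[of \<kappa> "\<gamma> - \<delta>" t]
    by (elim order_trans) (intro mult_left_mono, auto simp: algebra_simps)
  have qC: "0 \<le> q" "0 \<le> C1" by (simp_all add: q_def C1_def)
  have slope: "2 * (Y s \<bullet> f s (Y s)) \<le> (2 * q * exp (- \<kappa> * s) - \<gamma>) * (norm (Y s))\<^sup>2
       + C1\<^sup>2 / \<gamma> * (exp (- \<kappa> * s))\<^sup>2" if s: "0 \<le> s" for s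
  proof -
    define e where "e = exp (- \<kappa> * s)"
    have "Y s \<bullet> ((Y s ** Delta2 d + H) ** X s) \<le> norm (Y s) * norm ((Y s ** Delta2 d + H) ** X s)"
      by (rule norm_cauchy_schwarz)
    also have "\<dots> \<le> norm (Y s) * ((norm (Y s) * norm (Delta2 d) + norm H) * (norm Pb * e))"
      using Xk[OF s] unfolding e_def
      by (intro mult_left_mono order_trans[OF norm_matrix_mult_le] mult_mono norm_triangle_le add_mono norm_matrix_mult_le) auto
    also have "\<dots> = q * e * (norm (Y s))\<^sup>2 + norm (Y s) * (C1 * e)"
      by (simp add: q_def C1_def power2_eq_square algebra_simps)
    finally have "2 * (Y s \<bullet> f s (Y s)) \<le> - 2 * \<gamma> * (norm (Y s))\<^sup>2 + 2 * q * e * (norm (Y s))\<^sup>2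
        + 2 * norm (Y s) * (C1 * e)"
      using inner_mult_S[of "Y s"] by (simp add: f_def inner_add_right algebra_simps)
    moreover have "2 * norm (Y s) * (C1 * e) \<le> \<gamma> * (norm (Y s))\<^sup>2 + C1\<^sup>2 / \<gamma> * e\<^sup>2"
    proof -
      have "0 \<le> (\<gamma> * norm (Y s) - C1 * e)\<^sup>2 / \<gamma>" using gamma by simp
      then show ?thesis using gamma by (simp add: power2_eq_square field_simps)
    qed
    ultimately show ?thesis unfolding e_def[symmetric] by (simp add: algebra_simps)
  qed
  have ee: "exp (2 * \<kappa> * s) * (exp (- \<kappa> * s))\<^sup>2 = 1" for s
    unfolding power2_eq_square exp_add[symmetric] by simp
  define K where "K = ((norm (h 0))\<^sup>2 + (C1\<^sup>2 / \<gamma>) / (\<gamma> / 2)) * exp (2 * q / \<kappa>)"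
  have Yb: "(norm (Y t))\<^sup>2 \<le> K * (exp (- \<kappa> * t))\<^sup>2" if t: "0 \<le> t" for t
  proof -
    define u where "u s = exp (2 * \<kappa> * s) * (norm (Y s))\<^sup>2" for s
    have "u t \<le> (u 0 + (C1\<^sup>2 / \<gamma>) / (\<gamma> / 2)) * exp ((2 * q) / \<kappa>)"
    proof (rule layer_gronwall[where \<epsilon> = 1 and q = u and b = t
          and q' = "\<lambda>s. 2 * \<kappa> * u s + exp (2 * \<kappa> * s) * (2 * (Y s \<bullet> f s (Y s)))"])
      show "(u has_real_derivative 2 * \<kappa> * u s + exp (2 * \<kappa> * s) * (2 * (Y s \<bullet> f s (Y s))))
          (at s within {0..t})" if "s \<in> {0..t}" for s
      proof -
        have "(Y has_vector_derivative f s (Y s)) (at s within {0..t})"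
          using Y(2)[of s] that by (auto elim!: has_vector_derivative_within_subset)
        note dY = has_real_derivative_norm_sq[OF this]
        have "((\<lambda>s. exp (2 * \<kappa> * s)) has_real_derivative 2 * \<kappa> * exp (2 * \<kappa> * s)) (at s within {0..t})"
          by (auto intro!: derivative_eq_intros)
        from DERIV_mult'[OF this dY] show ?thesis
          unfolding u_def by (rule DERIV_cong) (simp add: mult_ac)
      qed
      show "1 * (2 * \<kappa> * u s + exp (2 * \<kappa> * s) * (2 * (Y s \<bullet> f s (Y s)))) \<le>
          (2 * q * exp (- \<kappa> * (s / 1)) - \<gamma> / 2) * u s + C1\<^sup>2 / \<gamma>" if "s \<in> {0..t}" for s
      proof -
        have "exp (2 * \<kappa> * s) * (2 * (Y s \<bullet> f s (Y s))) \<le>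
          exp (2 * \<kappa> * s) * ((2 * q * exp (- \<kappa> * s) - \<gamma>) * (norm (Y s))\<^sup>2 + C1\<^sup>2 / \<gamma> * (exp (- \<kappa> * s))\<^sup>2)"
          using that by (intro mult_left_mono slope) auto
        also have "\<dots> = (2 * q * exp (- \<kappa> * s) - \<gamma>) * u s
            + C1\<^sup>2 / \<gamma> * (exp (2 * \<kappa> * s) * (exp (- \<kappa> * s))\<^sup>2)"
          by (simp add: u_def distrib_left mult_ac)
        also have "exp (2 * \<kappa> * s) * (exp (- \<kappa> * s))\<^sup>2 = 1"
          by (rule ee)
        finally have "2 * \<kappa> * u s + exp (2 * \<kappa> * s) * (2 * (Y s \<bullet> f s (Y s))) \<le>
            (2 * q * exp (- \<kappa> * s) + (2 * \<kappa> - \<gamma>)) * u s + C1\<^sup>2 / \<gamma>" by (simp add: algebra_simps)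
        also have "(2 * q * exp (- \<kappa> * s) + (2 * \<kappa> - \<gamma>)) * u s \<le> (2 * q * exp (- \<kappa> * s) - \<gamma> / 2) * u s"
          using \<kappa>(3) by (intro mult_right_mono) (auto simp: u_def)
        finally show ?thesis by simp
      qed
    qed (use gamma \<kappa> qC t in \<open>auto simp: u_def\<close>)
    then have "u t \<le> K" using Y(1) by (simp add: u_def K_def)
    then have *: "(exp (- \<kappa> * t))\<^sup>2 * u t \<le> (exp (- \<kappa> * t))\<^sup>2 * K" by (intro mult_left_mono) auto
    have "(exp (- \<kappa> * t))\<^sup>2 * u t = (exp (2 * \<kappa> * t) * (exp (- \<kappa> * t))\<^sup>2) * (norm (Y t))\<^sup>2"
      by (simp only: u_def mult_ac)
    then show ?thesis using * by (simp only: ee mult_1 mult.commute[of K])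
  qed
  have K0: "0 \<le> K" using gamma by (simp add: K_def)
  have Yk: "norm (Y t) \<le> sqrt K * exp (- \<kappa> * t)" if "0 \<le> t" for t
  proof (rule power2_le_imp_le)
    show "(norm (Y t))\<^sup>2 \<le> (sqrt K * exp (- \<kappa> * t))\<^sup>2"
      using Yb[OF that] K0 by (simp add: power_mult_distrib)
  qed (use K0 in simp)
  define \<Phi> where "\<Phi> t = (Y t, X t)" for t
  define F where "F Z = (full_g1 d 0 (fst Z + h 0) (snd Z + Pb) 0, full_g2 d 0 (fst Z + h 0) (snd Z + Pb) 0)" for Z
  have F: "lip_bounded F" unfolding F_def by (intro lip_intros lip_bounded_full)
  have deriv: "(\<Phi> has_vector_derivative F (\<Phi> t)) (at t within {0..})" if "0 \<le> t" for t
  proof -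
    have "F (\<Phi> t) = (f t (Y t), layer_field (X t))"
      unfolding F_def \<Phi>_def fst_conv snd_conv full_g1_layer full_g2_layer
      by (simp add: f_def H_def matrix_distribs matrix_mul_assoc)
    then show ?thesis unfolding \<Phi>_def using Y(2)[OF that] X(3)[OF that]
      by (simp add: has_vector_derivative_Pair)
  qed
  have "continuous_on {0..} \<Phi>"
    by (rule continuous_on_vector_derivative[where f' = "\<lambda>t. F (\<Phi> t)"]) (use deriv in auto)
  moreover have "\<Phi> 0 = (- h 0, - Pb)" "\<And>t. 0 \<le> t \<Longrightarrow> \<Phi> t \<in> UNIV \<times> sym_mats"
    using X(1,2) Y(1) by (auto simp: \<Phi>_def sym_mats_def)
  ultimately have sol: "boundary_layer_solution d Pb \<Phi>"
    unfolding boundary_layer_solution_def case_prod_unfold F_def[symmetric]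
    using deriv by auto
  have "Z t = \<Phi> t" if Z: "boundary_layer_solution d Pb Z" and t: "t \<in> {0..}" for Z t
  proof (rule ode_unique[OF F, where b = t])
    have dZ: "(Z has_vector_derivative F (Z s)) (at s within {0..})" if "0 \<le> s" for s
      using Z that unfolding boundary_layer_solution_def case_prod_unfold F_def[symmetric] by auto
    show "(Z has_vector_derivative F (Z s)) (at s within {0..t})" if "s \<in> {0..t}" for s
      using dZ[of s] that by (auto elim!: has_vector_derivative_within_subset)
    show "(\<Phi> has_vector_derivative F (\<Phi> s)) (at s within {0..t})" if "s \<in> {0..t}" for s
      using deriv[of s] that by (auto elim!: has_vector_derivative_within_subset)
    show "Z 0 = \<Phi> 0" using Z sol by (simp add: boundary_layer_solution_def)
  qed (use t in auto)
  then have "unique_solution_on {0..} (boundary_layer_solution d Pb) \<Phi>"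
    using sol by (auto simp: unique_solution_on_def)
  moreover have "norm (fst (\<Phi> t)) \<le> max (sqrt K) (norm Pb) * exp (- \<kappa> * t)"
    "norm (snd (\<Phi> t)) \<le> max (sqrt K) (norm Pb) * exp (- \<kappa> * t)" if "0 \<le> t" for t
    using order_trans[OF Yk[OF that] mult_right_mono[of "sqrt K" "max (sqrt K) (norm Pb)"]]
      order_trans[OF Xk[OF that] mult_right_mono[of "norm Pb" "max (sqrt K) (norm Pb)"]]
    by (auto simp: \<Phi>_def)
  ultimately show ?thesis using that[of \<Phi> \<kappa> "max (sqrt K) (norm Pb)"] \<kappa>(1) K0 by (simp add: le_max_iff_disj)
qed

end

section \<open>The remainder and the error estimate\<close>

context stable_riccati
begin

text \<open>
  The linear part of the affine map \<open>h\<close>.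
\<close>

definition dh :: "real^'n1^'n1 \<Rightarrow> real^'n2^'n1" where
  "dh X = - ((X ** A12 d + X ** Delta d ** Pb) ** matrix_inv S)"

lemma bounded_linear_dh: "bounded_linear dh"
  unfolding dh_def
  by (intro bounded_linear_minus bounded_linear_compose[OF matmul.bounded_linear_left]
      bounded_linear_add matmul.bounded_linear_left)

lemma h_add: "h (X + Y) = h X + dh Y"
  unfolding hmap_def Smat_def[symmetric] dh_def by (simp add: matrix_distribs)

lemma h_dh: "h X = h 0 + dh X"
  using h_add[of 0 X] by simp

text \<open>
  Here \<open>X\<close> is the outer slow variable, \<open>Y\<close> and \<open>W\<close> are the layer, and \<open>x\<close>, \<open>y\<close>, \<open>w\<close> are the
  errors. From the full right-hand sides the outer and the layer right-hand sides and the stable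
  linear part are subtracted. That the last bound contains neither \<open>x\<close> nor \<open>y\<close> reflects
  the triangular structure of the fast system.
\<close>

definition remainder_bound :: "real \<Rightarrow> real \<Rightarrow> real \<Rightarrow> real \<Rightarrow> bool" where
  "remainder_bound D Cp \<kappa> K \<longleftrightarrow> (\<forall>\<epsilon> s X Y W x y w.
     0 < \<epsilon> \<and> \<epsilon> \<le> 1 \<and> 0 \<le> s \<and> transpose X = X \<and> norm X \<le> D \<and> norm X \<le> D * s \<and>
     norm Y \<le> Cp * exp (- \<kappa> * (s / \<epsilon>)) \<and> norm W \<le> Cp * exp (- \<kappa> * (s / \<epsilon>)) \<and>
     norm x \<le> 1 \<and> norm y \<le> 1 \<and> norm w \<le> 1 \<longrightarrow>
     norm (full_f d (X + x) (Y + h X + y) (W + Pb + w) \<epsilon> - full_f d X (h X) Pb 0)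
       \<le> K * (norm x + norm y + norm w + exp (- \<kappa> * (s / \<epsilon>))) \<and>
     norm (full_g1 d (X + x) (Y + h X + y) (W + Pb + w) \<epsilon> - full_g1 d 0 (Y + h 0) (W + Pb) 0 - y ** S)
       \<le> K * (norm x + norm w + exp (- \<kappa> * (s / \<epsilon>)) * norm y + \<epsilon>) \<and>
     norm (full_g2 d (X + x) (Y + h X + y) (W + Pb + w) \<epsilon> - full_g2 d 0 (Y + h 0) (W + Pb) 0
         - (transpose S ** w + w ** S))
       \<le> (K * exp (- \<kappa> * (s / \<epsilon>)) + norm (Delta2 d) * norm w) * norm w + K * \<epsilon>)"

text \<open>
  At \<open>\<epsilon> = 0\<close> the remainder of the fast equations is explicit. Its only terms without an error
  factor are products of \<open>X\<close>, or \<open>dh X\<close>, with \<open>W\<close>. They are \<open>O(\<epsilon>)\<close>, because \<open>X\<close> is \<open>O(s)\<close>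
  while \<open>W\<close> decays on the time scale \<open>\<epsilon>\<close>. Passing from \<open>0\<close> to \<open>\<epsilon>\<close> costs
  \<open>O(\<epsilon>)\<close> by Lipschitz continuity. In the slow equation Lipschitz continuity alone suffices.
\<close>

lemma remainder_bounds:
  fixes D Cp \<kappa> :: real
  assumes \<kappa>: "0 < \<kappa>" and Cp: "0 \<le> Cp" and D: "0 \<le> D"
  obtains K where "0 \<le> K" "remainder_bound D Cp \<kappa> K"
proof -
  obtain kh where kh: "0 \<le> kh" "\<And>X. norm (dh X) \<le> kh * norm X"
    using bounded_linear.nonneg_bounded[OF bounded_linear_dh] by (auto simp: mult.commute)
  define R where "R = (D + 1) + (Cp + (norm (h 0) + kh * D) + 1) + (Cp + norm Pb + 1) + 1"
  let ?F = "\<lambda>z. full_f d (fst (fst z)) (fst (snd (fst z))) (snd (snd (fst z))) (snd z)"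
  let ?G1 = "\<lambda>z. full_g1 d (fst (fst z)) (fst (snd (fst z))) (snd (snd (fst z))) (snd z)"
  let ?G2 = "\<lambda>z. full_g2 d (fst (fst z)) (fst (snd (fst z))) (snd (snd (fst z))) (snd z)"
  note proj = lip_bounded_full[where X = "\<lambda>z. fst (fst z)" and Y = "\<lambda>z. fst (snd (fst z))"
      and W = "\<lambda>z. snd (snd (fst z))" and e = "\<lambda>z. snd z"]
  have lips: "lip_bounded ?F" "lip_bounded ?G1" "lip_bounded ?G2"
    by (rule proj; intro lip_intros)+
  obtain L1 where L1: "0 \<le> L1" "\<And>z w. norm z \<le> R \<Longrightarrow> norm w \<le> R \<Longrightarrow>
     norm (?F z - ?F w) \<le> L1 * norm (z - w)"
    using lip_boundedE[OF lips(1)] by blast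
  obtain L2 where L2: "0 \<le> L2" "\<And>z w. norm z \<le> R \<Longrightarrow> norm w \<le> R \<Longrightarrow>
     norm (?G1 z - ?G1 w) \<le> L2 * norm (z - w)"
    using lip_boundedE[OF lips(2)] by blast
  obtain L3 where L3: "0 \<le> L3" "\<And>z w. norm z \<le> R \<Longrightarrow> norm w \<le> R \<Longrightarrow>
     norm (?G2 z - ?G2 w) \<le> L3 * norm (z - w)"
    using lip_boundedE[OF lips(3)] by blast
  define K1 where "K1 = 2 * L1 * Cp + L1"
  define k2 where "k2 = norm (A21 d) + (D + 1) * norm (Delta d) + (Cp + (norm (h 0) + kh * D) + 1) * norm (Delta2 d)"
  define k3 where "k3 = (norm (Delta d) + kh * norm (Delta2 d)) * Cp"
  define K2 where "K2 = kh * norm S + k2 + norm (Delta d) * Cp + norm (Delta2 d) * Cp + k3 * (D / \<kappa>) + L2"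
  define K3 where "K3 = 2 * norm (Delta2 d) * Cp + L3"
  define K where "K = K1 + K2 + K3"
  have nn: "0 \<le> k2" "0 \<le> k3" "0 \<le> K1" "0 \<le> K2" "0 \<le> K3"
    using L1 L2 L3 Cp D kh \<kappa> by (simp_all add: K1_def K2_def K3_def k2_def k3_def)
  have "remainder_bound D Cp \<kappa> K"
    unfolding remainder_bound_def
  proof (intro allI impI, elim conjE)
    fix \<epsilon> s :: real and X x :: "real^'n1^'n1" and Y y :: "real^'n2^'n1" and W w :: "real^'n2^'n2"
    assume \<epsilon>: "0 < \<epsilon>" "\<epsilon> \<le> 1" and s: "0 \<le> s" and symX: "transpose X = X"
      and X: "norm X \<le> D" "norm X \<le> D * s"
      and YW: "norm Y \<le> Cp * exp (- \<kappa> * (s / \<epsilon>))" "norm W \<le> Cp * exp (- \<kappa> * (s / \<epsilon>))"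
      and xyw: "norm x \<le> 1" "norm y \<le> 1" "norm w \<le> 1"
    let ?f = "full_f d (X + x) (Y + h X + y) (W + Pb + w)"
    let ?g1 = "full_g1 d (X + x) (Y + h X + y) (W + Pb + w)" and ?l1 = "full_g1 d 0 (Y + h 0) (W + Pb) 0"
    let ?C = "transpose (A21 d) + (X + x) ** Delta d + (Y + h X + y) ** Delta2 d"
    let ?g2 = "full_g2 d (X + x) (Y + h X + y) (W + Pb + w)" and ?l2 = "full_g2 d 0 (Y + h 0) (W + Pb) 0"
    define e where "e = exp (- \<kappa> * (s / \<epsilon>))"
    have e: "0 \<le> e" "e \<le> 1" using \<kappa> s \<epsilon> by (simp_all add: e_def)
    have YW': "norm Y \<le> Cp * e" "norm W \<le> Cp * e" using YW by (simp_all add: e_def)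
    have YW1: "norm Y \<le> Cp" "norm W \<le> Cp"
      using YW' mult_left_mono[OF e(2) Cp] by linarith+
    have hX: "norm (h X) \<le> norm (h 0) + kh * D"
      using norm_triangle_ineq[of "h 0" "dh X"] kh(2)[of X] mult_left_mono[OF X(1) kh(1)] h_dh[of X] by simp
    have in_ball: "norm ((X + x, Y + h X + y, W + Pb + w), t) \<le> R" if "0 \<le> t" "t \<le> 1" for t :: real
    proof -
      have "norm ((X + x, Y + h X + y, W + Pb + w), t)
        \<le> norm (X + x) + norm (Y + h X + y) + norm (W + Pb + w) + norm t"
        using norm_Pair_le[of "(X + x, Y + h X + y, W + Pb + w)" t]
          norm_triple_le[of "X + x" "Y + h X + y" "W + Pb + w"] by linarith
      moreover have "norm (X + x) \<le> D + 1" using X(1) xyw(1) by (intro norm_triangle_le) simp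
      moreover have "norm (Y + h X + y) \<le> Cp + (norm (h 0) + kh * D) + 1"
        using YW1(1) xyw(2) hX by (intro norm_triangle_le add_mono) auto
      moreover have "norm (W + Pb + w) \<le> Cp + norm Pb + 1"
        using YW1(2) xyw(3) by (intro norm_triangle_le add_mono) auto
      ultimately show ?thesis using that by (simp add: R_def)
    qed
    have in_ball0: "norm ((X, h X, Pb), 0 :: real) \<le> R"
    proof -
      have "norm ((X, h X, Pb), 0 :: real) \<le> norm X + norm (h X) + norm Pb"
        using norm_triple_le[of X "h X" Pb] by (simp add: norm_Pair)
      then show ?thesis using X(1) hX Cp by (simp add: R_def)
    qed
    have mono_K: "a * b \<le> K * b" if "a \<in> {K1, K2, K3}" "0 \<le> b" for a b
      using that nn by (intro mult_right_mono) (auto simp: K_def)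
    have "norm (?f \<epsilon> - full_f d X (h X) Pb 0) = norm (?f 0 - full_f d X (h X) Pb 0)"
      by (simp add: full_f_def)
    also have "\<dots> \<le> L1 * norm (((X + x, Y + h X + y, W + Pb + w), 0 :: real) - ((X, h X, Pb), 0))"
      using L1(2)[OF in_ball[of 0] in_ball0] by simp
    also have "\<dots> = L1 * norm (x, Y + y, W + w)"
      by (simp add: norm_Pair algebra_simps)
    also have "\<dots> \<le> L1 * (norm x + (norm Y + norm y) + (norm W + norm w))"
      by (intro mult_left_mono L1 order_trans[OF norm_triple_le] add_mono norm_triangle_ineq) auto
    also have "\<dots> \<le> L1 * (norm x + (Cp * e + norm y) + (Cp * e + norm w))"
      using YW' L1(1) by (intro mult_left_mono add_mono) auto
    also have "\<dots> \<le> K1 * (norm x + norm y + norm w + e)"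
      unfolding K1_def using L1(1) Cp e(1) by (simp add: algebra_simps)
    also have "\<dots> \<le> K * (norm x + norm y + norm w + e)"
      using e(1) by (intro mono_K) auto
    finally have 1: "norm (?f \<epsilon> - full_f d X (h X) Pb 0) \<le> K * (norm x + norm y + norm w + e)" .
    have eps: "norm (((X + x, Y + h X + y, W + Pb + w), \<epsilon>) - ((X + x, Y + h X + y, W + Pb + w), 0)) = \<epsilon>"
      using \<epsilon> by (simp add: norm_Pair)
    have g1eps: "norm (?g1 \<epsilon> - ?g1 0) \<le> L2 * \<epsilon>"
      using L2(2)[OF in_ball[of \<epsilon>] in_ball[of 0], unfolded eps] \<epsilon> by simp
    have g2eps: "norm (?g2 \<epsilon> - ?g2 0) \<le> L3 * \<epsilon>"
      using L3(2)[OF in_ball[of \<epsilon>] in_ball[of 0], unfolded eps] \<epsilon> by simp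
    have g1: "?g1 0 - ?l1 - y ** S
      = - (dh x ** S) + ?C ** w + (x ** Delta d + y ** Delta2 d) ** W + (X ** Delta d + dh X ** Delta2 d) ** W"
    proof -
      have 1: "Y + h X + y = (Y + y - dh x) + h (X + x)" "W + Pb + w = (W + w) + Pb"
        by (simp_all add: h_add)
      have "?g1 0 = (Y + y - dh x) ** S + ?C ** (W + w)"
        unfolding 1 full_g1_layer ..
      then show ?thesis
        unfolding full_g1_layer h_dh[of X] by (simp add: matrix_distribs)
    qed
    have "norm (?g1 0 - ?l1 - y ** S)
      \<le> (kh * norm x) * norm S + k2 * norm w + (norm x * norm (Delta d) + norm y * norm (Delta2 d)) * (Cp * e)
        + (norm X * norm (Delta d) + (kh * norm X) * norm (Delta2 d)) * (Cp * e)"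
      unfolding g1
    proof (intro norm_triangle_le add_mono)
      show "norm (- (dh x ** S)) \<le> kh * norm x * norm S"
        using kh(2)[of x] order_trans[OF norm_matrix_mult_le mult_right_mono, of "dh x" "kh * norm x" S] by simp
      have "norm ?C \<le> k2"
        unfolding k2_def
      proof (intro norm_triangle_le add_mono)
        show "norm (transpose (A21 d)) \<le> norm (A21 d)" by (simp add: norm_transpose)
        show "norm ((X + x) ** Delta d) \<le> (D + 1) * norm (Delta d)"
          using X(1) xyw(1) by (intro order_trans[OF norm_matrix_mult_le] mult_right_mono norm_triangle_le) auto
        have "norm (Y + h X + y) \<le> Cp + (norm (h 0) + kh * D) + 1"
          using YW1(1) xyw(2) hX by (intro norm_triangle_le add_mono) auto
        then show "norm ((Y + h X + y) ** Delta2 d) \<le> (Cp + (norm (h 0) + kh * D) + 1) * norm (Delta2 d)"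
          by (intro order_trans[OF norm_matrix_mult_le] mult_right_mono) auto
      qed
      then show "norm (?C ** w) \<le> k2 * norm w"
        by (intro order_trans[OF norm_matrix_mult_le] mult_right_mono) auto
      have "norm (x ** Delta d + y ** Delta2 d) \<le> norm x * norm (Delta d) + norm y * norm (Delta2 d)"
        by (intro norm_triangle_le add_mono norm_matrix_mult_le)
      then show "norm ((x ** Delta d + y ** Delta2 d) ** W)
          \<le> (norm x * norm (Delta d) + norm y * norm (Delta2 d)) * (Cp * e)"
        using YW'(2) by (intro order_trans[OF norm_matrix_mult_le] mult_mono) auto
      have "norm (X ** Delta d + dh X ** Delta2 d) \<le> norm X * norm (Delta d) + (kh * norm X) * norm (Delta2 d)"
        using kh(2)[of X]
        by (intro norm_triangle_le add_mono norm_matrix_mult_le order_trans[OF norm_matrix_mult_le] mult_right_mono) auto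
      then show "norm ((X ** Delta d + dh X ** Delta2 d) ** W)
          \<le> (norm X * norm (Delta d) + (kh * norm X) * norm (Delta2 d)) * (Cp * e)"
        using YW'(2) kh(1) by (intro order_trans[OF norm_matrix_mult_le] mult_mono) auto
    qed
    also have "(norm X * norm (Delta d) + (kh * norm X) * norm (Delta2 d)) * (Cp * e) = k3 * (norm X * e)"
      by (simp add: k3_def algebra_simps)
    also have "\<dots> \<le> k3 * (D / \<kappa> * \<epsilon>)"
    proof (rule mult_left_mono[OF _ nn(2)])
      have "norm X * e \<le> D * (s * e)" using mult_right_mono[OF X(2) e(1)] by (simp add: mult_ac)
      also have "\<dots> \<le> D * (\<epsilon> / \<kappa>)"
        using exp_decay_mult_le[OF \<kappa> \<epsilon>(1) s] D by (intro mult_left_mono) (auto simp: e_def)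
      finally show "norm X * e \<le> D / \<kappa> * \<epsilon>" by (simp add: mult_ac)
    qed
    finally have "norm (?g1 \<epsilon> - ?l1 - y ** S)
      \<le> kh * norm x * norm S + k2 * norm w + (norm x * norm (Delta d) + norm y * norm (Delta2 d)) * (Cp * e)
        + k3 * (D / \<kappa> * \<epsilon>) + L2 * \<epsilon>"
      using norm_triangle_ineq[of "?g1 0 - ?l1 - y ** S"
         "?g1 \<epsilon> - ?g1 0"] g1eps
      by (simp add: algebra_simps)
    also have "\<dots> = (kh * norm S + norm (Delta d) * Cp * e) * norm x + k2 * norm w
        + norm (Delta2 d) * Cp * (e * norm y) + (k3 * (D / \<kappa>) + L2) * \<epsilon>"
      by (simp add: algebra_simps)
    also have "\<dots> \<le> K2 * norm x + K2 * norm w + K2 * (e * norm y) + K2 * \<epsilon>"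
    proof (intro add_mono mult_right_mono)
      have nn': "0 \<le> k3 * (D / \<kappa>)" "0 \<le> kh * norm S" "0 \<le> norm (Delta2 d) * Cp" "0 \<le> norm (Delta d) * Cp"
        using nn kh Cp D \<kappa> by simp_all
      have "norm (Delta d) * Cp * e \<le> norm (Delta d) * Cp * 1"
        using Cp e by (intro mult_left_mono) auto
      then show "kh * norm S + norm (Delta d) * Cp * e \<le> K2"
        using nn nn' L2(1) unfolding K2_def by linarith
      show "k2 \<le> K2" "norm (Delta2 d) * Cp \<le> K2" "k3 * (D / \<kappa>) + L2 \<le> K2"
        using nn nn' L2(1) unfolding K2_def by linarith+
    qed (use e \<epsilon> in auto)
    also have "\<dots> = K2 * (norm x + norm w + e * norm y + \<epsilon>)" by (simp add: algebra_simps)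
    also have "\<dots> \<le> K * (norm x + norm w + e * norm y + \<epsilon>)"
      using e(1) \<epsilon> by (intro mono_K) auto
    finally have 2: "norm (?g1 \<epsilon> - ?l1 - y ** S)
      \<le> K * (norm x + norm w + e * norm y + \<epsilon>)" .
    have g2: "?g2 0 - ?l2
          - (transpose S ** w + w ** S) = W ** Delta2 d ** w + w ** Delta2 d ** W + w ** Delta2 d ** w"
    proof -
      have 1: "W + Pb + w = (W + w) + Pb" by simp
      show ?thesis unfolding 1 full_g2_layer by (simp add: matrix_distribs)
    qed
    have "norm (?g2 0 - ?l2
          - (transpose S ** w + w ** S))
      \<le> Cp * e * norm (Delta2 d) * norm w + norm w * norm (Delta2 d) * (Cp * e)
        + norm w * norm (Delta2 d) * norm w"
      unfolding g2
    proof (intro norm_triangle_le add_mono norm_mult3_le)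
      show "norm (W ** Delta2 d ** w) \<le> Cp * e * norm (Delta2 d) * norm w"
        using YW'(2) by (intro order_trans[OF norm_mult3_le] mult_right_mono) auto
      show "norm (w ** Delta2 d ** W) \<le> norm w * norm (Delta2 d) * (Cp * e)"
        using YW'(2) by (intro order_trans[OF norm_mult3_le] mult_left_mono) auto
    qed
    then have "norm (?g2 \<epsilon> - ?l2
          - (transpose S ** w + w ** S))
      \<le> (2 * norm (Delta2 d) * Cp * e + norm (Delta2 d) * norm w) * norm w + L3 * \<epsilon>"
      using norm_triangle_ineq[of "?g2 0 - ?l2
          - (transpose S ** w + w ** S)"
         "?g2 \<epsilon> - ?g2 0"] g2eps
      by (simp add: algebra_simps)
    also have "\<dots> \<le> (K * e + norm (Delta2 d) * norm w) * norm w + K * \<epsilon>"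
    proof (intro add_mono mult_right_mono)
      have "2 * norm (Delta2 d) * Cp \<le> K" "L3 \<le> K"
        using nn L3 Cp by (simp_all add: K_def K3_def)
      then show "2 * norm (Delta2 d) * Cp \<le> K" "L3 \<le> K" .
    qed (use \<epsilon> e in auto)
    finally have 3: "norm (?g2 \<epsilon> - ?l2 - (transpose S ** w + w ** S))
        \<le> (K * e + norm (Delta2 d) * norm w) * norm w + K * \<epsilon>" .
    show "norm (?f \<epsilon> - full_f d X (h X) Pb 0) \<le> K * (norm x + norm y + norm w + exp (- \<kappa> * (s / \<epsilon>))) \<and>
      norm (?g1 \<epsilon> - ?l1 - y ** S) \<le> K * (norm x + norm w + exp (- \<kappa> * (s / \<epsilon>)) * norm y + \<epsilon>) \<and>
      norm (?g2 \<epsilon> - ?l2 - (transpose S ** w + w ** S))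
        \<le> (K * exp (- \<kappa> * (s / \<epsilon>)) + norm (Delta2 d) * norm w) * norm w + K * \<epsilon>"
      using 1 2 3 unfolding e_def by blast
  qed
  moreover have "0 \<le> K" using nn by (simp add: K_def)
  ultimately show ?thesis using that by blast
qed

definition error_constant :: "real \<Rightarrow> real \<Rightarrow> real \<Rightarrow> real" where
  "error_constant K \<kappa> T = sqrt (energy_constant
     (4 * K + 3 * K\<^sup>2 / \<gamma> + (1 + 3 * K\<^sup>2 / \<gamma>\<^sup>2) * (K\<^sup>2 / \<gamma>)) (2 * K) \<gamma> \<kappa> T)"

text \<open>
  The coupling of \<open>w\<close> into the equation for \<open>y\<close> need not be small, but \<open>y\<close> does not enter the
  equation for \<open>w\<close>. A large weight \<open>\<mu>\<close> on \<open>|w|\<^sup>2\<close> therefore absorbs the coupling into the damping of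
  \<open>w\<close>, and \<open>slow_fast_energy\<close> applies to \<open>|x|\<^sup>2\<close> and \<open>|y|\<^sup>2 + \<mu> |w|\<^sup>2\<close>.
\<close>

lemma slow_fast_estimate:
  fixes x :: "real \<Rightarrow> real^'n1^'n1" and y :: "real \<Rightarrow> real^'n2^'n1" and w :: "real \<Rightarrow> real^'n2^'n2"
  assumes K: "0 \<le> K" and \<kappa>: "0 < \<kappa>" and T: "0 \<le> T" and \<epsilon>: "0 < \<epsilon>"
    and init: "x 0 = 0" "y 0 = 0" "w 0 = 0"
    and symw: "\<And>s. s \<in> {0..T} \<Longrightarrow> transpose (w s) = w s"
    and dx: "\<And>s. s \<in> {0..T} \<Longrightarrow> (x has_vector_derivative F s) (at s within {0..T})"
    and dy: "\<And>s. s \<in> {0..T} \<Longrightarrow> (y has_vector_derivative (1/\<epsilon>) *\<^sub>R (y s ** S + G1 s)) (at s within {0..T})"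
    and dw: "\<And>s. s \<in> {0..T} \<Longrightarrow>
      (w has_vector_derivative (1/\<epsilon>) *\<^sub>R (transpose S ** w s + w s ** S + G2 s)) (at s within {0..T})"
    and F: "\<And>s. s \<in> {0..T} \<Longrightarrow>
      norm (F s) \<le> K * (norm (x s) + norm (y s) + norm (w s) + exp (- \<kappa> * (s / \<epsilon>)))"
    and G1: "\<And>s. s \<in> {0..T} \<Longrightarrow>
      norm (G1 s) \<le> K * (norm (x s) + norm (w s) + exp (- \<kappa> * (s / \<epsilon>)) * norm (y s) + \<epsilon>)"
    and G2: "\<And>s. s \<in> {0..T} \<Longrightarrow>
      norm (G2 s) \<le> (K * exp (- \<kappa> * (s / \<epsilon>)) + \<gamma> / 2) * norm (w s) + K * \<epsilon>"
    and s: "s \<in> {0..T}"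
  shows "norm (x s) \<le> error_constant K \<kappa> T * \<epsilon> \<and> norm (y s) \<le> error_constant K \<kappa> T * \<epsilon> \<and>
    norm (w s) \<le> error_constant K \<kappa> T * \<epsilon>"
proof -
  \<comment> \<open>large enough: the damping \<open>\<mu> \<gamma> |w|\<^sup>2\<close> dominates the term
    \<open>3 K\<^sup>2 |w|\<^sup>2 / \<gamma>\<close> that Young's inequality leaves in the equation for \<open>y\<close>\<close>
  define \<mu> where "\<mu> = 1 + 3 * K\<^sup>2 / \<gamma>\<^sup>2"
  have \<mu>: "1 \<le> \<mu>" "3 * K\<^sup>2 / \<gamma> \<le> \<mu> * \<gamma>"
    using gamma by (simp_all add: \<mu>_def field_simps power2_eq_square)
  define K' where "K' = 4 * K + 3 * K\<^sup>2 / \<gamma> + \<mu> * (K\<^sup>2 / \<gamma>)"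
  have K': "0 \<le> K'" "4 * K \<le> K'" "3 * K\<^sup>2 / \<gamma> \<le> K'" "3 * K\<^sup>2 / \<gamma> + \<mu> * (K\<^sup>2 / \<gamma>) \<le> K'"
    using K gamma \<mu> by (simp_all add: K'_def)
  define M where "M = energy_constant K' (2 * K) \<gamma> \<kappa> T"
  have const: "error_constant K \<kappa> T = sqrt M"
    by (simp add: error_constant_def M_def K'_def \<mu>_def)
  have M: "0 \<le> M" unfolding M_def using K'(1) K gamma \<kappa> T by (intro energy_constant_nonneg) auto
  have young: "2 * a * (K * b) \<le> (\<gamma> / 3) * a\<^sup>2 + (3 * K\<^sup>2 / \<gamma>) * b\<^sup>2" for a b :: real
  proof -
    have "0 \<le> (\<gamma> * a - 3 * K * b)\<^sup>2 / (3 * \<gamma>)" using gamma by simp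
    also have "\<dots> = (\<gamma> / 3) * a\<^sup>2 + (3 * K\<^sup>2 / \<gamma>) * b\<^sup>2 - 2 * a * (K * b)"
      using gamma by (simp add: power2_eq_square field_simps)
    finally show ?thesis by simp
  qed
  have young1: "2 * a * (K * b) \<le> \<gamma> * a\<^sup>2 + (K\<^sup>2 / \<gamma>) * b\<^sup>2" for a b :: real
  proof -
    have "0 \<le> (\<gamma> * a - K * b)\<^sup>2 / \<gamma>" using gamma by simp
    also have "\<dots> = \<gamma> * a\<^sup>2 + (K\<^sup>2 / \<gamma>) * b\<^sup>2 - 2 * a * (K * b)"
      using gamma by (simp add: power2_eq_square field_simps)
    finally show ?thesis by simp
  qed
  define p where "p s = (norm (x s))\<^sup>2" for s
  define q where "q s = (norm (y s))\<^sup>2 + \<mu> * (norm (w s))\<^sup>2" for s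
  have pq: "p s \<le> M * \<epsilon>\<^sup>2 \<and> q s \<le> M * \<epsilon>\<^sup>2"
  proof (unfold M_def, rule slow_fast_energy[where p = p and q = q and s = s and \<epsilon> = \<epsilon> and p' = "\<lambda>s. 2 * (x s \<bullet> F s)" and
      q' = "\<lambda>s. 2 * (y s \<bullet> ((1/\<epsilon>) *\<^sub>R (y s ** S + G1 s)))
        + \<mu> * (2 * (w s \<bullet> ((1/\<epsilon>) *\<^sub>R (transpose S ** w s + w s ** S + G2 s))))"])
    fix s assume s: "s \<in> {0..T}"
    define e where "e = exp (- \<kappa> * (s / \<epsilon>))"
    have e: "0 \<le> e" by (simp add: e_def)
    show "(p has_real_derivative 2 * (x s \<bullet> F s)) (at s within {0..T})"
      unfolding p_def by (intro has_real_derivative_norm_sq dx s)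
    show "(q has_real_derivative 2 * (y s \<bullet> ((1/\<epsilon>) *\<^sub>R (y s ** S + G1 s)))
        + \<mu> * (2 * (w s \<bullet> ((1/\<epsilon>) *\<^sub>R (transpose S ** w s + w s ** S + G2 s))))) (at s within {0..T})"
      unfolding q_def
      by (intro DERIV_add DERIV_cmult has_real_derivative_norm_sq dy dw s)
    show "0 \<le> p s" "0 \<le> q s" using \<mu> by (simp_all add: p_def q_def)
    define a b c where "a = norm (x s)" and "b = norm (y s)" and "c = norm (w s)"
    have abc: "0 \<le> a" "0 \<le> b" "0 \<le> c" by (simp_all add: a_def b_def c_def)
    have "x s \<bullet> F s \<le> a * (K * (a + b + c + e))"
      unfolding a_def b_def c_def e_def
      by (intro order_trans[OF norm_cauchy_schwarz] mult_left_mono F s) auto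
    also have "2 * \<dots> = K * (2 * a\<^sup>2 + 2 * a * b + 2 * a * c + 2 * a * e)"
      by (simp add: power2_eq_square algebra_simps)
    also have "\<dots> \<le> K * (2 * a\<^sup>2 + (a\<^sup>2 + b\<^sup>2) + (a\<^sup>2 + c\<^sup>2) + (e / \<epsilon> * a\<^sup>2 + \<epsilon> * e))"
    proof (intro mult_left_mono add_mono K)
      show "2 * a * b \<le> a\<^sup>2 + b\<^sup>2" "2 * a * c \<le> a\<^sup>2 + c\<^sup>2" by (rule sum_squares_bound)+
      have "0 \<le> e * (a - \<epsilon>)\<^sup>2 / \<epsilon>" using e \<epsilon> by simp
      also have "\<dots> = e / \<epsilon> * a\<^sup>2 + \<epsilon> * e - 2 * a * e"
        using \<epsilon> by (simp add: power2_eq_square field_simps)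
      finally show "2 * a * e \<le> e / \<epsilon> * a\<^sup>2 + \<epsilon> * e" by simp
    qed simp_all
    also have "\<dots> = (4 * K) * a\<^sup>2 + (K * (e / \<epsilon>)) * a\<^sup>2 + K * (b\<^sup>2 + c\<^sup>2) + K * (\<epsilon> * e)"
      by (simp add: algebra_simps)
    also have "\<dots> \<le> K' * a\<^sup>2 + (2 * K * (e / \<epsilon>)) * a\<^sup>2 + K' * (b\<^sup>2 + \<mu> * c\<^sup>2) + (2 * K) * (\<epsilon> * e)"
      using K K' e \<epsilon> \<mu>(1) abc mult_right_mono[OF \<mu>(1), of "c\<^sup>2"]
      by (intro add_mono mult_mono) auto
    finally show "2 * (x s \<bullet> F s) \<le> (K' + (2 * K) / \<epsilon> * exp (- \<kappa> * (s / \<epsilon>))) * p s + K' * q s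
         + (2 * K) * \<epsilon> * exp (- \<kappa> * (s / \<epsilon>))"
      unfolding e_def[symmetric] p_def q_def a_def[symmetric] b_def[symmetric] c_def[symmetric]
      by (simp add: algebra_simps)
    have "y s \<bullet> G1 s \<le> b * (K * (a + c + e * b + \<epsilon>))"
      unfolding a_def b_def c_def e_def
      by (intro order_trans[OF norm_cauchy_schwarz] mult_left_mono G1 s) auto
    then have "2 * (y s \<bullet> (y s ** S + G1 s)) \<le> - 2 * \<gamma> * b\<^sup>2 + 2 * b * (K * a) + 2 * b * (K * c)
        + 2 * b * (K * \<epsilon>) + 2 * K * e * b\<^sup>2"
      using inner_mult_S[of "y s"] unfolding b_def[symmetric]
      by (simp add: inner_add_right algebra_simps power2_eq_square)
    also have "\<dots> \<le> - 2 * \<gamma> * b\<^sup>2 + ((\<gamma> / 3) * b\<^sup>2 + (3 * K\<^sup>2 / \<gamma>) * a\<^sup>2) + ((\<gamma> / 3) * b\<^sup>2 + (3 * K\<^sup>2 / \<gamma>) * c\<^sup>2)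
        + ((\<gamma> / 3) * b\<^sup>2 + (3 * K\<^sup>2 / \<gamma>) * \<epsilon>\<^sup>2) + 2 * K * e * b\<^sup>2"
      by (intro add_mono young order_refl)
    also have "\<dots> = (2 * K * e - \<gamma>) * b\<^sup>2 + (3 * K\<^sup>2 / \<gamma>) * a\<^sup>2 + (3 * K\<^sup>2 / \<gamma>) * c\<^sup>2 + (3 * K\<^sup>2 / \<gamma>) * \<epsilon>\<^sup>2"
      by (simp add: algebra_simps)
    also have "\<dots> \<le> (2 * K * e - \<gamma>) * b\<^sup>2 + (3 * K\<^sup>2 / \<gamma>) * a\<^sup>2 + (\<mu> * \<gamma>) * c\<^sup>2 + (3 * K\<^sup>2 / \<gamma>) * \<epsilon>\<^sup>2"
      using \<mu>(2) by (intro add_mono mult_right_mono order_refl) auto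
    finally have qy: "2 * (y s \<bullet> (y s ** S + G1 s)) \<le>
       (2 * K * e - \<gamma>) * b\<^sup>2 + (3 * K\<^sup>2 / \<gamma>) * a\<^sup>2 + (\<mu> * \<gamma>) * c\<^sup>2 + (3 * K\<^sup>2 / \<gamma>) * \<epsilon>\<^sup>2" .
    have "w s \<bullet> G2 s \<le> c * ((K * e + \<gamma> / 2) * c + K * \<epsilon>)"
      unfolding c_def e_def
      by (intro order_trans[OF norm_cauchy_schwarz] mult_left_mono G2 s) auto
    then have "2 * (w s \<bullet> (transpose S ** w s + w s ** S + G2 s))
        \<le> - 4 * \<gamma> * c\<^sup>2 + 2 * K * e * c\<^sup>2 + \<gamma> * c\<^sup>2 + 2 * c * (K * \<epsilon>)"
      using inner_mult_S[of "w s"] inner_Lyapunov[OF symw[OF s]] unfolding c_def[symmetric]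
      by (simp add: inner_add_right algebra_simps power2_eq_square)
    also have "\<dots> \<le> - 4 * \<gamma> * c\<^sup>2 + 2 * K * e * c\<^sup>2 + \<gamma> * c\<^sup>2 + (\<gamma> * c\<^sup>2 + (K\<^sup>2 / \<gamma>) * \<epsilon>\<^sup>2)"
      by (intro add_mono young1 order_refl)
    also have "\<dots> = (2 * K * e - 2 * \<gamma>) * c\<^sup>2 + (K\<^sup>2 / \<gamma>) * \<epsilon>\<^sup>2" by (simp add: algebra_simps)
    finally have "\<mu> * (2 * (w s \<bullet> (transpose S ** w s + w s ** S + G2 s)))
        \<le> \<mu> * ((2 * K * e - 2 * \<gamma>) * c\<^sup>2 + (K\<^sup>2 / \<gamma>) * \<epsilon>\<^sup>2)"
      using \<mu>(1) by (intro mult_left_mono) auto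
    with qy have "2 * (y s \<bullet> (y s ** S + G1 s)) + \<mu> * (2 * (w s \<bullet> (transpose S ** w s + w s ** S + G2 s)))
      \<le> (2 * K * e - \<gamma>) * (b\<^sup>2 + \<mu> * c\<^sup>2) + (3 * K\<^sup>2 / \<gamma>) * a\<^sup>2
        + (3 * K\<^sup>2 / \<gamma> + \<mu> * (K\<^sup>2 / \<gamma>)) * \<epsilon>\<^sup>2"
      by (simp add: algebra_simps)
    also have "\<dots> \<le> (2 * K * e - \<gamma>) * (b\<^sup>2 + \<mu> * c\<^sup>2) + K' * a\<^sup>2 + K' * \<epsilon>\<^sup>2"
      using K' by (intro add_mono mult_right_mono order_refl) auto
    finally show "\<epsilon> * (2 * (y s \<bullet> ((1/\<epsilon>) *\<^sub>R (y s ** S + G1 s)))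
        + \<mu> * (2 * (w s \<bullet> ((1/\<epsilon>) *\<^sub>R (transpose S ** w s + w s ** S + G2 s)))))
      \<le> ((2 * K) * exp (- \<kappa> * (s / \<epsilon>)) - \<gamma>) * q s + K' * p s + K' * \<epsilon>\<^sup>2"
      unfolding e_def[symmetric] p_def q_def a_def[symmetric] b_def[symmetric] c_def[symmetric]
      using \<epsilon> by (simp add: distrib_left mult.left_commute[of \<epsilon>])
  qed (use K K'(1) gamma \<kappa> T \<epsilon> init s in \<open>auto simp: p_def q_def\<close>)
  have sq: "norm z \<le> sqrt M * \<epsilon>" if "(norm z)\<^sup>2 \<le> M * \<epsilon>\<^sup>2" for z :: "'b::real_normed_vector"
  proof (rule power2_le_imp_le)
    show "(norm z)\<^sup>2 \<le> (sqrt M * \<epsilon>)\<^sup>2" using that M by (simp add: power_mult_distrib)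
  qed (use \<epsilon> M in simp)
  have "0 \<le> \<mu> * (norm (w s))\<^sup>2" "(norm (w s))\<^sup>2 \<le> \<mu> * (norm (w s))\<^sup>2"
    using \<mu>(1) mult_right_mono[OF \<mu>(1), of "(norm (w s))\<^sup>2"] by auto
  then have "(norm (x s))\<^sup>2 \<le> M * \<epsilon>\<^sup>2" "(norm (y s))\<^sup>2 \<le> M * \<epsilon>\<^sup>2" "(norm (w s))\<^sup>2 \<le> M * \<epsilon>\<^sup>2"
    using pq zero_le_power2[of "norm (y s)"] unfolding p_def q_def by linarith+
  then show ?thesis unfolding const by (intro conjI sq)
qed

end

section \<open>Existence and approximation of the solutions\<close>

lemma clamp_ball_components:
  fixes z :: "'a::real_normed_vector \<times> 'b::real_normed_vector \<times> 'c::real_normed_vector"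
  assumes "0 < r"
  defines "u \<equiv> clamp_ball r z"
  shows "norm (fst u) \<le> norm (fst z)" "norm (fst (snd u)) \<le> norm (fst (snd z))"
    "norm (snd (snd u)) \<le> norm (snd (snd z))"
    "norm (fst u) \<le> r" "norm (fst (snd u)) \<le> r" "norm (snd (snd u)) \<le> r"
proof -
  obtain \<theta> where \<theta>: "0 < \<theta>" "\<theta> \<le> 1" "u = \<theta> *\<^sub>R z"
    using clamp_ball_shrinks[OF assms(1)] unfolding u_def by blast
  then show "norm (fst u) \<le> norm (fst z)" "norm (fst (snd u)) \<le> norm (fst (snd z))"
    "norm (snd (snd u)) \<le> norm (snd (snd z))"
    by (auto intro!: mult_left_le_one_le)
  have "norm u \<le> r" unfolding u_def by (rule norm_clamp_ball(1)[OF assms(1)])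
  then show "norm (fst u) \<le> r" "norm (fst (snd u)) \<le> r" "norm (snd (snd u)) \<le> r"
    using norm_fst_le[of "fst u" "snd u"] norm_snd_le[of "snd u" "fst u"]
      norm_fst_le[of "fst (snd u)" "snd (snd u)"] norm_snd_le[of "snd (snd u)" "fst (snd u)"] by simp_all
qed

definition sym_triple :: "(real^'n1^'n1) \<times> (real^'n2^'n1) \<times> (real^'n2^'n2) \<Rightarrow>
    (real^'n1^'n1) \<times> (real^'n2^'n1) \<times> (real^'n2^'n2)" where
  "sym_triple z = (sym_part (fst z), fst (snd z), sym_part (snd (snd z)))"

lemma sym_triple:
  "bounded_linear sym_triple" "sym_triple (sym_triple z) = sym_triple z" "norm (sym_triple z) \<le> norm z"
  "sym_triple z = z \<longleftrightarrow> transpose (fst z) = fst z \<and> transpose (snd (snd z)) = snd (snd z)"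
proof -
  show "bounded_linear sym_triple" unfolding sym_triple_def
    by (intro bounded_linear_Pair bounded_linear_compose[OF sym_part(1)] bounded_linear_fst bounded_linear_snd
        bounded_linear_compose[OF bounded_linear_fst] bounded_linear_compose[OF bounded_linear_snd])
  show eq: "sym_triple z = z \<longleftrightarrow> transpose (fst z) = fst z \<and> transpose (snd (snd z)) = snd (snd z)" for z
    by (cases z) (auto simp: sym_triple_def sym_part(3))
  show "sym_triple (sym_triple z) = sym_triple z"
    unfolding eq by (simp add: sym_triple_def sym_part(2))
  show "norm (sym_triple z) \<le> norm z"
  proof -
    have "norm (fst (snd z), sym_part (snd (snd z))) \<le> norm (snd z)"
      using power_mono[OF sym_part(4)[of "snd (snd z)"] norm_ge_zero, of 2]
      by (simp add: norm_prod_def[of "snd z"] norm_Pair)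
    from power_mono[OF this norm_ge_zero, of 2] power_mono[OF sym_part(4)[of "fst z"] norm_ge_zero, of 2]
    show ?thesis unfolding sym_triple_def norm_prod_def[of z] norm_Pair[of "sym_part (fst z)"]
      by (intro real_sqrt_le_mono add_mono)
  qed
qed

context stable_riccati
begin

lemma lip_bounded_h: "lip_bounded F \<Longrightarrow> lip_bounded (\<lambda>z. h (F z))"
  by (subst h_dh) (intro lip_intros lip_bounded_compose_linear[OF bounded_linear_dh])

text \<open>
  The function \<open>Z\<close> below is the sum of outer solution and layer, and \<open>u\<close> is the error of this
  approximation. Its equation \<open>u' = full_field (Z + u) - Z'\<close> is replaced by one in which the
  remainder sees only the clamped error, while the stable linear part \<open>A\<close> still acts
  on \<open>u\<close> itself. The damping is thus fully available for large \<open>u\<close> as well, the energy estimate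
  needs no a priori bound on \<open>u\<close>, and it yields \<open>u = O(\<epsilon>)\<close>.
\<close>

lemma tikhonov_approximation:
  assumes T: "0 < T" and Q1: "Q1 d \<in> sym_mats" and Q2: "Q2 d \<in> sym_mats"
    and red: "reduced_solution d T Pbar" and lay: "boundary_layer_solution d Pb \<Phi>"
    and \<kappa>: "0 < \<kappa>" and Cp: "0 \<le> Cp"
    and decay: "\<And>t. 0 \<le> t \<Longrightarrow> norm (fst (\<Phi> t)) \<le> Cp * exp (- \<kappa> * t)"
      "\<And>t. 0 \<le> t \<Longrightarrow> norm (snd (\<Phi> t)) \<le> Cp * exp (- \<kappa> * t)"
  obtains \<epsilon>s M where "0 < \<epsilon>s" "\<epsilon>s \<le> 1" "0 \<le> M"
    "\<And>\<epsilon>. 0 < \<epsilon> \<Longrightarrow> \<epsilon> < \<epsilon>s \<Longrightarrow> \<exists>P11 P12 P22. full_solution d T \<epsilon> (\<lambda>t. (P11 t, P12 t, P22 t)) \<and>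
      (\<forall>t\<in>{0..T}. norm (P11 t - Pbar t) \<le> M * \<epsilon> \<and>
         norm (P12 t - h (Pbar t) - fst (\<Phi> ((T - t) / \<epsilon>))) \<le> M * \<epsilon> \<and>
         norm (P22 t - Pb - snd (\<Phi> ((T - t) / \<epsilon>))) \<le> M * \<epsilon>)"
proof -
  define X where "X s = Pbar (T - s)" for s
  define \<rho> where "\<rho> Z = full_f d Z (h Z) Pb 0" for Z
  have symX: "transpose (X s) = X s" if "s \<in> {0..T}" for s
  proof -
    have "T - s \<in> {0..T}" using that by auto
    then show ?thesis using red unfolding reduced_solution_def X_def sym_mats_def by blast
  qed
  have dX: "(X has_vector_derivative \<rho> (X s)) (at s within {0..T})" if s: "s \<in> {0..T}" for s
  proof -
    have "T - s \<in> {0..T}" using s by auto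
    then obtain P' where P': "(Pbar has_vector_derivative P') (at (T - s) within {0..T})"
      "P' + transpose (Atilde d) ** X s + X s ** Atilde d + X s ** Mred d ** X s + Nred d = 0"
      using red unfolding reduced_solution_def X_def by blast
    have "P' + \<rho> (X s) = 0"
      using P'(2) unfolding \<rho>_def reduced_equation[OF symX[OF s]] by (simp add: add.assoc)
    then have "- P' = \<rho> (X s)" by (rule minus_unique)
    then show ?thesis using has_vector_derivative_reflect[OF P'(1)] by (simp add: X_def[abs_def])
  qed
  have X0: "X 0 = 0" using red by (simp add: X_def reduced_solution_def)
  have contX: "continuous_on {0..T} X" using dX by (rule continuous_on_vector_derivative)
  obtain D1 where D1: "\<And>s. s \<in> {0..T} \<Longrightarrow> norm (X s) \<le> D1"
    using continuous_on_interval_bound[OF contX] by blast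
  have lip\<rho>: "lip_bounded (\<lambda>z. \<rho> (F z))" if "lip_bounded F" for F :: "'z::real_normed_vector \<Rightarrow> _"
    unfolding \<rho>_def by (intro lip_bounded_full lip_bounded_h lip_bounded_const that)
  obtain D2 where D2: "0 < D2" "\<And>z. norm z \<le> D1 \<Longrightarrow> norm (\<rho> z) \<le> D2"
    using lip_bounded_bound[OF lip\<rho>[OF lip_bounded_ident]] by blast
  define D where "D = max D1 D2"
  have D: "0 \<le> D" "\<And>s. s \<in> {0..T} \<Longrightarrow> norm (X s) \<le> D" "\<And>s. s \<in> {0..T} \<Longrightarrow> norm (\<rho> (X s)) \<le> D"
    using D1 D2 by (force simp: D_def le_max_iff_disj)+
  have Ds: "norm (X s) \<le> D * s" if s: "s \<in> {0..T}" for s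
  proof -
    have "norm (X s - X 0) \<le> D * norm (s - 0)"
    proof (rule differentiable_bound[where S = "{0..T}" and f' = "\<lambda>s h. h *\<^sub>R \<rho> (X s)"])
      show "(X has_derivative (\<lambda>h. h *\<^sub>R \<rho> (X s))) (at s within {0..T})" if "s \<in> {0..T}" for s
        using dX[OF that] by (simp add: has_vector_derivative_def)
      show "onorm (\<lambda>h. h *\<^sub>R \<rho> (X s)) \<le> D" if "s \<in> {0..T}" for s
        using D(3)[OF that] by (intro onorm_le) (simp add: mult.commute[of D] mult_left_mono)
    qed (use s T in auto)
    then show ?thesis using s X0 by simp
  qed
  obtain kh where kh: "0 \<le> kh" "\<And>X. norm (dh X) \<le> kh * norm X"
    using bounded_linear.nonneg_bounded[OF bounded_linear_dh] by (auto simp: mult.commute)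
  define Kd where "Kd = kh * D"
  have Kd: "norm (dh (\<rho> (X s))) \<le> Kd" if "s \<in> {0..T}" for s
    unfolding Kd_def using kh D(3)[OF that] by (intro order_trans[OF kh(2)] mult_left_mono) auto
  have Kd0: "0 \<le> Kd" using kh D(1) by (simp add: Kd_def)
  \<comment> \<open>in the ball of this radius the quadratic term of the \<open>w\<close> equation takes at most the part \<open>\<gamma> / 2\<close> of the damping\<close>
  define r where "r = min 1 ((\<gamma> / 2) / (norm (Delta2 d) + 1))"
  have n1: "0 < norm (Delta2 d) + 1" using norm_ge_zero[of "Delta2 d"] by linarith
  have r: "0 < r" "r \<le> 1" using gamma n1 by (auto simp: r_def)
  have "(norm (Delta2 d) + 1) * r \<le> (norm (Delta2 d) + 1) * ((\<gamma> / 2) / (norm (Delta2 d) + 1))"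
    using n1 by (intro mult_left_mono) (auto simp: r_def)
  also have "\<dots> = \<gamma> / 2"
    by (rule nonzero_mult_div_cancel_left[of "norm (Delta2 d) + 1" "\<gamma> / 2", unfolded times_divide_eq_right[symmetric]])
      (use n1 in simp)
  finally have rD: "norm (Delta2 d) * r \<le> \<gamma> / 2" using r by (simp add: distrib_right)
  obtain K0 where K0: "0 \<le> K0" and rem: "remainder_bound D Cp \<kappa> K0"
    using remainder_bounds[OF \<kappa> Cp D(1)] by blast
  define K where "K = K0 + Kd"
  have K: "0 \<le> K" "K0 \<le> K" using K0 Kd0 by (simp_all add: K_def)
  define M where "M = error_constant K \<kappa> T"
  have M: "0 \<le> M"
    unfolding M_def error_constant_def using K(1) gamma \<kappa> T
    by (intro real_sqrt_ge_zero energy_constant_nonneg add_nonneg_nonneg mult_nonneg_nonneg) auto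
  \<comment> \<open>below this threshold three error components of size \<open>M \<epsilon>\<close> add up to less than the clamping radius\<close>
  define \<epsilon>s where "\<epsilon>s = min 1 (r / (3 * M + 1))"
  have \<epsilon>s: "0 < \<epsilon>s" "\<epsilon>s \<le> 1" using r M by (auto simp: \<epsilon>s_def)
  show ?thesis
  proof (rule that[OF \<epsilon>s M])
    fix \<epsilon> :: real
    assume \<epsilon>: "0 < \<epsilon>" "\<epsilon> < \<epsilon>s"
    have \<epsilon>1: "\<epsilon> \<le> 1" using \<epsilon> \<epsilon>s by simp
    have M\<epsilon>: "3 * (M * \<epsilon>) \<le> r"
    proof -
      have "\<epsilon> \<le> r / (3 * M + 1)" using \<epsilon>(2) by (simp add: \<epsilon>s_def)
      then have "(3 * M + 1) * \<epsilon> \<le> r" using M by (simp add: field_simps)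
      then show ?thesis using \<epsilon> by (simp add: algebra_simps)
    qed
    define Y W where "Y s = fst (\<Phi> (s / \<epsilon>))" and "W s = snd (\<Phi> (s / \<epsilon>))" for s
    have YW: "norm (Y s) \<le> Cp * exp (- \<kappa> * (s / \<epsilon>))" "norm (W s) \<le> Cp * exp (- \<kappa> * (s / \<epsilon>))"
      if "0 \<le> s" for s
      unfolding Y_def W_def using that \<epsilon> by (intro decay; simp)+
    have symW: "transpose (W s) = W s" if "0 \<le> s" for s
    proof -
      have "s / \<epsilon> \<in> {0..}" using that \<epsilon> by simp
      then have "\<Phi> (s / \<epsilon>) \<in> UNIV \<times> sym_mats"
        using lay unfolding boundary_layer_solution_def by blast
      then show ?thesis by (auto simp: W_def sym_mats_def)
    qed
    define L1 where "L1 s = full_g1 d 0 (Y s + h 0) (W s + Pb) 0" for s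
    define L2 where "L2 s = full_g2 d 0 (Y s + h 0) (W s + Pb) 0" for s
    have d\<Phi>: "((\<lambda>s. \<Phi> (s / \<epsilon>)) has_vector_derivative (1/\<epsilon>) *\<^sub>R (L1 s, L2 s)) (at s within {0..T})"
      if s: "s \<in> {0..T}" for s
    proof -
      have "((\<Phi> \<circ> (\<lambda>s. s / \<epsilon>)) has_vector_derivative (1/\<epsilon>) *\<^sub>R (L1 s, L2 s)) (at s within {0..T})"
      proof (rule vector_diff_chain_within)
        show "((\<lambda>s. s / \<epsilon>) has_vector_derivative 1 / \<epsilon>) (at s within {0..T})"
          using \<epsilon>(1) by (auto intro!: derivative_eq_intros simp flip: has_real_derivative_iff_has_vector_derivative)
        have "s / \<epsilon> \<in> {0..}" using s \<epsilon> by simp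
        then have "(\<Phi> has_vector_derivative (L1 s, L2 s)) (at (s / \<epsilon>) within {0..})"
          using lay unfolding boundary_layer_solution_def L1_def L2_def Y_def W_def case_prod_unfold by blast
        then show "(\<Phi> has_vector_derivative (L1 s, L2 s)) (at (s / \<epsilon>) within (\<lambda>s. s / \<epsilon>) ` {0..T})"
          by (rule has_vector_derivative_within_subset) (use \<epsilon> in auto)
      qed
      then show ?thesis by (simp add: o_def)
    qed
    have dY: "(Y has_vector_derivative (1/\<epsilon>) *\<^sub>R L1 s) (at s within {0..T})"
      and dW: "(W has_vector_derivative (1/\<epsilon>) *\<^sub>R L2 s) (at s within {0..T})" if "s \<in> {0..T}" for s
      using bounded_linear.has_vector_derivative[OF bounded_linear_fst d\<Phi>[OF that]]
        bounded_linear.has_vector_derivative[OF bounded_linear_snd d\<Phi>[OF that]]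
      by (simp_all add: Y_def[abs_def] W_def[abs_def])
    define Z where "Z s = (X s, Y s + h (X s), W s + Pb)" for s
    define base where "base s = (\<rho> (X s), (1/\<epsilon>) *\<^sub>R L1 s + dh (\<rho> (X s)), (1/\<epsilon>) *\<^sub>R L2 s)" for s
    have dZ: "(Z has_vector_derivative base s) (at s within {0..T})" if s: "s \<in> {0..T}" for s
    proof -
      have "((\<lambda>s. h 0 + dh (X s)) has_vector_derivative 0 + dh (\<rho> (X s))) (at s within {0..T})"
        by (intro has_vector_derivative_add has_vector_derivative_const
            bounded_linear.has_vector_derivative[OF bounded_linear_dh] dX s)
      then have "((\<lambda>s. h (X s)) has_vector_derivative dh (\<rho> (X s))) (at s within {0..T})"
        by (simp flip: h_dh)
      then have "(Z has_vector_derivative (\<rho> (X s), (1/\<epsilon>) *\<^sub>R L1 s + dh (\<rho> (X s)), (1/\<epsilon>) *\<^sub>R L2 s + 0)) (at s within {0..T})"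
        unfolding Z_def
        by (intro has_vector_derivative_Pair has_vector_derivative_add has_vector_derivative_const dX dY dW s)
      then show ?thesis by (simp add: base_def)
    qed
    have contZ: "continuous_on {0..T} Z" using dZ by (rule continuous_on_vector_derivative)
    have contbase: "continuous_on {0..T} base"
    proof -
      define B where "B z = (\<rho> (fst z), (1/\<epsilon>) *\<^sub>R full_g1 d 0 (fst (snd z) + h 0) (snd (snd z) + Pb) 0 + dh (\<rho> (fst z)),
          (1/\<epsilon>) *\<^sub>R full_g2 d 0 (fst (snd z) + h 0) (snd (snd z) + Pb) 0)" for z
      have "lip_bounded B" unfolding B_def
        by (intro lip_intros lip_bounded_full lip\<rho> lip_bounded_compose_linear[OF bounded_linear_dh])
      moreover have "continuous_on {0..T} (\<lambda>s. (X s, Y s, W s))"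
        using dY dW by (intro continuous_on_Pair contX continuous_on_vector_derivative) auto
      ultimately have "continuous_on {0..T} (\<lambda>s. B (X s, Y s, W s))"
        using continuous_on_compose2[OF lip_bounded_continuous_on[of B UNIV]] by blast
      then show ?thesis by (simp add: B_def base_def[abs_def] L1_def L2_def)
    qed
    define A where "A z = (0 :: real^'n1^'n1, (1/\<epsilon>) *\<^sub>R (fst (snd z) ** S),
        (1/\<epsilon>) *\<^sub>R (transpose S ** snd (snd z) + snd (snd z) ** S))"
      for z :: "(real^'n1^'n1) \<times> (real^'n2^'n1) \<times> (real^'n2^'n2)"
    have A: "bounded_linear A" unfolding A_def
      by (intro bounded_linear_Pair bounded_linear_zero bounded_linear_add
          bounded_linear_compose[OF bounded_linear_scaleR_right]
          bounded_linear_compose[OF matmul.bounded_linear_left]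
          bounded_linear_compose[OF matmul.bounded_linear_right]
          bounded_linear_compose[OF bounded_linear_fst] bounded_linear_compose[OF bounded_linear_snd]
          bounded_linear_fst bounded_linear_snd)
    obtain kA where kA: "0 \<le> kA" "\<And>z. norm (A z) \<le> kA * norm z"
      using bounded_linear.nonneg_bounded[OF A] by (auto simp: mult.commute)
    define c where "c z = clamp_ball r z" for z :: "(real^'n1^'n1) \<times> (real^'n2^'n1) \<times> (real^'n2^'n2)"
    \<comment> \<open>time is frozen after \<open>T\<close>, which gives a field on the half-line that is uniformly Lipschitz\<close>
    define f where "f s z = full_field d \<epsilon> (Z (min s T) + c z) - base (min s T) + A (z - c z)" for s z
    obtain R where R: "\<And>s. s \<in> {0..T} \<Longrightarrow> norm (Z s) \<le> R"
      using continuous_on_interval_bound[OF contZ] by blast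
    obtain Lf where Lf: "0 \<le> Lf" "\<And>z w. norm z \<le> R + r \<Longrightarrow> norm w \<le> R + r \<Longrightarrow>
        norm (full_field d \<epsilon> z - full_field d \<epsilon> w) \<le> Lf * norm (z - w)"
      using lip_boundedE[OF lip_bounded_full_field] by blast
    have contf0: "continuous_on {0..T} (\<lambda>s. full_field d \<epsilon> (Z s) - base s)"
      by (intro continuous_on_diff contbase
          continuous_on_compose2[OF lip_bounded_continuous_on[OF lip_bounded_full_field] contZ]) auto
    obtain C0 where C0: "\<And>s. s \<in> {0..T} \<Longrightarrow> norm (full_field d \<epsilon> (Z s) - base s) \<le> C0"
      using continuous_on_interval_bound[OF contf0] by blast
    have lipc: "norm (c z - c w) \<le> 2 * norm (z - w)" for z w
      unfolding c_def by (rule clamp_ball_lipschitz[OF r(1)])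
    have symbase: "sym_triple (base s) = base s" if "s \<in> {0..T}" for s
      using symX[OF that] symW[of s] that Q1 Q2
      by (simp add: sym_triple(4) base_def \<rho>_def L2_def full_sym transpose_distribs sym_Pb)
    have "\<exists>u. u 0 = 0 \<and> (\<forall>s\<ge>0. sym_triple (u s) = u s) \<and>
        (\<forall>s\<ge>0. (u has_vector_derivative f s (u s)) (at s within {0..}))"
    proof (rule picard_subspace[where pr = sym_triple and f = f and ?x0.0 = 0
          and L = "2 * Lf + 3 * kA" and C = C0])
      show "sym_triple (f s z) = f s z" if "0 \<le> s" "sym_triple z = z" for s z
      proof -
        have s: "min s T \<in> {0..T}" using that T by auto
        have sz: "transpose (fst z) = fst z" "transpose (snd (snd z)) = snd (snd z)"
          using that(2) unfolding sym_triple(4) by auto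
        have sc: "transpose (fst (c z)) = fst (c z)" "transpose (snd (snd (c z))) = snd (snd (c z))"
          by (simp_all add: c_def clamp_ball_def transpose_distribs sz)
        have "sym_triple (full_field d \<epsilon> (Z (min s T) + c z)) = full_field d \<epsilon> (Z (min s T) + c z)"
          unfolding sym_triple(4) full_field_def
          using symX[OF s] symW[of "min s T"] s sc Q1 Q2
          by (simp add: Z_def full_sym transpose_distribs sym_Pb)
        moreover have "sym_triple (A (z - c z)) = A (z - c z)"
          by (simp add: sym_triple(4) A_def transpose_distribs sz sc add.commute)
        ultimately show ?thesis unfolding f_def
          by (simp add: linear_add[OF bounded_linear.linear[OF sym_triple(1)]]
              linear_diff[OF bounded_linear.linear[OF sym_triple(1)]] symbase[OF s])
      qed
      show "sym_triple 0 = 0" by (simp add: sym_triple(4) transpose_distribs)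
      show "continuous_on {0..} (\<lambda>s. f s (u s))" if u: "continuous_on {0..} u" for u
      proof -
        have m: "continuous_on {0..} (\<lambda>s. min s T)" by (intro continuous_intros)
        have im: "(\<lambda>s. min s T) ` {0..} \<subseteq> {0..T}" using T by auto
        have Zm: "continuous_on {0..} (\<lambda>s. Z (min s T))" by (rule continuous_on_compose2[OF contZ m im])
        have bm: "continuous_on {0..} (\<lambda>s. base (min s T))" by (rule continuous_on_compose2[OF contbase m im])
        have cu: "continuous_on {0..} (\<lambda>s. c (u s))"
          unfolding c_def by (rule continuous_on_clamp_ball[OF r(1) u])
        show ?thesis unfolding f_def
          by (intro continuous_on_add continuous_on_diff bm bounded_linear.continuous_on[OF A] u cu
            continuous_on_compose2[OF lip_bounded_continuous_on[OF lip_bounded_full_field, of UNIV] continuous_on_add[OF Zm cu]]) auto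
      qed
      show "norm (f s z - f s w) \<le> (2 * Lf + 3 * kA) * norm (z - w)" if "0 \<le> s" for s z w
      proof -
        have s: "min s T \<in> {0..T}" using that T by auto
        have in_ball: "norm (Z (min s T) + c z) \<le> R + r" for z
          using R[OF s] norm_clamp_ball(1)[OF r(1), of z] by (intro norm_triangle_le add_mono) (auto simp: c_def)
        have eq: "f s z - f s w = (full_field d \<epsilon> (Z (min s T) + c z) - full_field d \<epsilon> (Z (min s T) + c w))
            + A ((z - w) - (c z - c w))"
          unfolding f_def linear_diff[OF bounded_linear.linear[OF A]] by simp
        have "norm (full_field d \<epsilon> (Z (min s T) + c z) - full_field d \<epsilon> (Z (min s T) + c w)) \<le> Lf * (2 * norm (z - w))"
          using Lf(2)[OF in_ball in_ball, of z w] mult_left_mono[OF lipc[of z w] Lf(1)] by simp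
        moreover have "norm (A ((z - w) - (c z - c w))) \<le> kA * (norm (z - w) + 2 * norm (z - w))"
          using norm_triangle_ineq4[of "z - w" "c z - c w"] lipc[of z w]
          by (intro order_trans[OF kA(2)] mult_left_mono kA(1)) linarith
        ultimately show ?thesis unfolding eq
          by (intro norm_triangle_le) (simp add: algebra_simps)
      qed
      show "norm (f s 0) \<le> C0" if "0 \<le> s" for s
      proof -
        have "f s 0 = full_field d \<epsilon> (Z (min s T)) - base (min s T)"
          by (simp add: f_def c_def clamp_ball_def linear_0[OF bounded_linear.linear[OF A]])
        then show ?thesis using C0[of "min s T"] that T by auto
      qed
    qed (auto simp: sym_triple intro: exI)
    then obtain u where u0: "u 0 = 0" and symu: "\<And>s. 0 \<le> s \<Longrightarrow> sym_triple (u s) = u s"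
      and du: "\<And>s. 0 \<le> s \<Longrightarrow> (u has_vector_derivative f s (u s)) (at s within {0..})" by blast
    have du': "(u has_vector_derivative f s (u s)) (at s within {0..T})" if "s \<in> {0..T}" for s
      by (rule has_vector_derivative_within_subset[OF du]) (use that in auto)
    define x where "x s = fst (u s)" for s
    define y where "y s = fst (snd (u s))" for s
    define w where "w s = snd (snd (u s))" for s
    define cx where "cx s = fst (c (u s))" for s
    define cy where "cy s = fst (snd (c (u s)))" for s
    define cw where "cw s = snd (snd (c (u s)))" for s
    define F where "F s = full_f d (X s + cx s) (Y s + h (X s) + cy s) (W s + Pb + cw s) \<epsilon> - \<rho> (X s)" for s
    define G1 where "G1 s = full_g1 d (X s + cx s) (Y s + h (X s) + cy s) (W s + Pb + cw s) \<epsilon> - L1 s - cy s ** S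
        - \<epsilon> *\<^sub>R dh (\<rho> (X s))" for s
    define G2 where "G2 s = full_g2 d (X s + cx s) (Y s + h (X s) + cy s) (W s + Pb + cw s) \<epsilon> - L2 s
        - (transpose S ** cw s + cw s ** S)" for s
    have f_eq: "f s (u s) = (F s, (1/\<epsilon>) *\<^sub>R (y s ** S + G1 s), (1/\<epsilon>) *\<^sub>R (transpose S ** w s + w s ** S + G2 s))"
      if "s \<in> {0..T}" for s
    proof -
      have "min s T = s" using that by auto
      then show ?thesis using \<epsilon>(1)
        by (simp add: f_def full_field_def Z_def base_def A_def F_def G1_def G2_def x_def y_def w_def
            cx_def cy_def cw_def matrix_distribs scaleR_add_right scaleR_diff_right)
    qed
    have cb: "norm (cx s) \<le> norm (x s)" "norm (cy s) \<le> norm (y s)" "norm (cw s) \<le> norm (w s)"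
      "norm (cx s) \<le> r" "norm (cy s) \<le> r" "norm (cw s) \<le> r" for s
      unfolding cx_def cy_def cw_def x_def y_def w_def c_def by (rule clamp_ball_components[OF r(1)])+
    have small: "norm (x s) \<le> M * \<epsilon> \<and> norm (y s) \<le> M * \<epsilon> \<and> norm (w s) \<le> M * \<epsilon>" if s: "s \<in> {0..T}" for s
      unfolding M_def
    proof (rule slow_fast_estimate[OF K(1) \<kappa> less_imp_le[OF T] \<epsilon>(1),
          where x = x and y = y and w = w and F = F and ?G1.0 = G1 and ?G2.0 = G2])
      show "x 0 = 0" "y 0 = 0" "w 0 = 0" by (simp_all add: x_def y_def w_def u0)
      fix s assume s: "s \<in> {0..T}"
      then have s0: "0 \<le> s" by simp
      show "transpose (w s) = w s" using symu[OF s0] by (simp add: w_def sym_triple(4))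
      note comps = du'[OF s, unfolded f_eq[OF s]]
      show "(x has_vector_derivative F s) (at s within {0..T})"
        using bounded_linear.has_vector_derivative[OF bounded_linear_fst comps] by (simp add: x_def[abs_def])
      show "(y has_vector_derivative (1/\<epsilon>) *\<^sub>R (y s ** S + G1 s)) (at s within {0..T})"
        using bounded_linear.has_vector_derivative[OF bounded_linear_compose[OF bounded_linear_fst bounded_linear_snd] comps]
        by (simp add: y_def[abs_def])
      show "(w has_vector_derivative (1/\<epsilon>) *\<^sub>R (transpose S ** w s + w s ** S + G2 s)) (at s within {0..T})"
        using bounded_linear.has_vector_derivative[OF bounded_linear_compose[OF bounded_linear_snd bounded_linear_snd] comps]
        by (simp add: w_def[abs_def])
      define e where "e = exp (- \<kappa> * (s / \<epsilon>))"
      have e: "0 \<le> e" by (simp add: e_def)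
      let ?g1 = "full_g1 d (X s + cx s) (Y s + h (X s) + cy s) (W s + Pb + cw s) \<epsilon>"
      have "norm (F s) \<le> K0 * (norm (cx s) + norm (cy s) + norm (cw s) + e) \<and>
        norm (?g1 - L1 s - cy s ** S)
          \<le> K0 * (norm (cx s) + norm (cw s) + e * norm (cy s) + \<epsilon>) \<and>
        norm (G2 s) \<le> (K0 * e + norm (Delta2 d) * norm (cw s)) * norm (cw s) + K0 * \<epsilon>"
        unfolding F_def G2_def L1_def L2_def \<rho>_def e_def
        using symX[OF s] D(2)[OF s] Ds[OF s] YW[OF s0] cb[of s] r(2) \<epsilon>(1) \<epsilon>1 s0
        by (intro rem[unfolded remainder_bound_def, rule_format]) auto
      then have b1: "norm (F s) \<le> K0 * (norm (cx s) + norm (cy s) + norm (cw s) + e)"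
        and b2: "norm (?g1 - L1 s - cy s ** S)
          \<le> K0 * (norm (cx s) + norm (cw s) + e * norm (cy s) + \<epsilon>)"
        and b3: "norm (G2 s) \<le> (K0 * e + norm (Delta2 d) * norm (cw s)) * norm (cw s) + K0 * \<epsilon>" by blast+
      show "norm (F s) \<le> K * (norm (x s) + norm (y s) + norm (w s) + exp (- \<kappa> * (s / \<epsilon>)))"
        unfolding e_def[symmetric] using cb[of s] K K0 e
        by (intro order_trans[OF b1] mult_mono add_mono) auto
      have "norm (G1 s) \<le> norm (?g1 - L1 s - cy s ** S)
          + norm (\<epsilon> *\<^sub>R dh (\<rho> (X s)))"
        unfolding G1_def by (rule norm_triangle_ineq4)
      also have "\<dots> \<le> K0 * (norm (cx s) + norm (cw s) + e * norm (cy s) + \<epsilon>) + Kd * \<epsilon>"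
        using b2 Kd[OF s] \<epsilon>(1) by (intro add_mono) auto
      also have "\<dots> \<le> K0 * (norm (x s) + norm (w s) + e * norm (y s) + \<epsilon>)
          + Kd * (norm (x s) + norm (w s) + e * norm (y s) + \<epsilon>)"
        using cb[of s] K0 Kd0 e \<epsilon>(1) by (intro add_mono mult_left_mono) auto
      finally show "norm (G1 s) \<le> K * (norm (x s) + norm (w s) + exp (- \<kappa> * (s / \<epsilon>)) * norm (y s) + \<epsilon>)"
        unfolding e_def[symmetric] K_def by (simp add: distrib_right)
      have "norm (Delta2 d) * norm (cw s) \<le> \<gamma> / 2"
        using mult_left_mono[OF cb(6)[of s] norm_ge_zero[of "Delta2 d"]] rD by linarith
      then show "norm (G2 s) \<le> (K * exp (- \<kappa> * (s / \<epsilon>)) + \<gamma> / 2) * norm (w s) + K * \<epsilon>"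
        unfolding e_def[symmetric] using cb(3)[of s] K K0 e gamma \<epsilon>(1)
        by (intro order_trans[OF b3] add_mono mult_mono) auto
    qed (use \<epsilon>(1) s in auto)
    \<comment> \<open>the error stays inside the clamping ball, so that \<open>Z + u\<close> solves the full system\<close>
    have cu: "c (u s) = u s" if s: "s \<in> {0..T}" for s
    proof -
      have "norm (u s) \<le> norm (x s) + norm (y s) + norm (w s)"
        using norm_triple_le[of "x s" "y s" "w s"] by (simp add: x_def y_def w_def)
      then have "norm (u s) \<le> r" using small[OF s] M\<epsilon> by linarith
      then show ?thesis by (simp add: c_def clamp_ball_id)
    qed
    define V where "V s = Z s + u s" for s
    have "full_solution d T \<epsilon> (\<lambda>t. V (T - t))"
    proof (rule reversed_full_solution[OF \<epsilon>(1)])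
      have "\<Phi> 0 = (- h 0, - Pb)" using lay by (simp add: boundary_layer_solution_def)
      then show "V 0 = 0" by (simp add: V_def Z_def u0 X0 Y_def W_def zero_prod_def)
      fix s assume s: "s \<in> {0..T}"
      then have s0: "0 \<le> s" by simp
      show "V s \<in> sym_mats \<times> UNIV \<times> sym_mats"
        using symX[OF s] symW[OF s0] symu[OF s0]
        by (simp add: V_def Z_def mem_Times_iff sym_mats_def sym_triple(4) transpose_distribs sym_Pb)
      have "(V has_vector_derivative base s + f s (u s)) (at s within {0..T})"
        unfolding V_def by (intro has_vector_derivative_add dZ du' s)
      moreover have "base s + f s (u s) = full_field d \<epsilon> (V s)"
      proof -
        have "min s T = s" using s by auto
        then show ?thesis
          by (simp add: f_def cu[OF s] V_def linear_0[OF bounded_linear.linear[OF A]])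
      qed
      ultimately show "(V has_vector_derivative full_field d \<epsilon> (V s)) (at s within {0..T})" by simp
    qed
    moreover have "norm (fst (V (T - t)) - Pbar t) \<le> M * \<epsilon> \<and>
        norm (fst (snd (V (T - t))) - h (Pbar t) - fst (\<Phi> ((T - t) / \<epsilon>))) \<le> M * \<epsilon> \<and>
        norm (snd (snd (V (T - t))) - Pb - snd (\<Phi> ((T - t) / \<epsilon>))) \<le> M * \<epsilon>" if t: "t \<in> {0..T}" for t
    proof -
      have "T - t \<in> {0..T}" using t by auto
      moreover have "fst (V (T - t)) - Pbar t = x (T - t)"
        "fst (snd (V (T - t))) - h (Pbar t) - fst (\<Phi> ((T - t) / \<epsilon>)) = y (T - t)"
        "snd (snd (V (T - t))) - Pb - snd (\<Phi> ((T - t) / \<epsilon>)) = w (T - t)"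
        by (simp_all add: V_def Z_def X_def Y_def W_def x_def y_def w_def)
      ultimately show ?thesis using small by simp
    qed
    ultimately show "\<exists>P11 P12 P22. full_solution d T \<epsilon> (\<lambda>t. (P11 t, P12 t, P22 t)) \<and>
      (\<forall>t\<in>{0..T}. norm (P11 t - Pbar t) \<le> M * \<epsilon> \<and>
         norm (P12 t - h (Pbar t) - fst (\<Phi> ((T - t) / \<epsilon>))) \<le> M * \<epsilon> \<and>
         norm (P22 t - Pb - snd (\<Phi> ((T - t) / \<epsilon>))) \<le> M * \<epsilon>)"
      by (intro exI[of _ "\<lambda>t. fst (V (T - t))"] exI[of _ "\<lambda>t. fst (snd (V (T - t)))"]
          exI[of _ "\<lambda>t. snd (snd (V (T - t)))"]) simp
  qed
qed

end

section \<open>The generalised Riccati equation\<close>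

theorem theorem4p5:
  fixes d :: "('n1::finite, 'n2::finite, 'k1::finite, 'k2::finite) riccati_data"
    and T \<gamma> \<delta> :: real
    and Pbar11 :: "real \<Rightarrow> real^'n1^'n1"
    and Pbar22 :: "real^'n2^'n2"
  assumes "Q1 d \<in> sym_mats" and "Q2 d \<in> sym_mats"
    and "0 < T"
    and i: "invertible (Delta2 d)"
    and ii: "Pbar22 \<in> sym_mats" "algebraic_riccati d Pbar22"
      "\<And>z. complex_eigenvalue (Smat d Pbar22) z \<Longrightarrow> Re z < 0"
    and iii: "unique_solution_on {0..T} (reduced_solution d T) Pbar11"
    and iv: "0 < \<gamma>"
      "psd_le ((1/2) *\<^sub>R (transpose (Smat d Pbar22) + Smat d Pbar22)) ((- \<gamma>) *\<^sub>R mat 1)"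
    and v: "0 < \<delta>" "\<delta> < \<gamma>"
      "- Pbar22 \<in> (top_of_set sym_mats) interior_of (Bball d Pbar22 \<delta>)"
  shows "\<exists>Phat. unique_solution_on {0..} (boundary_layer_solution d Pbar22) Phat \<and>
    (\<exists>\<epsilon>s. tikhonov_threshold d T Pbar11 Pbar22 Phat \<epsilon>s \<and>
      (\<exists>C. \<forall>\<epsilon>. 0 < \<epsilon> \<and> \<epsilon> < \<epsilon>s \<longrightarrow>
        (\<exists>P11 P12 P22.
          unique_solution_on {0..T} (full_solution d T \<epsilon>) (\<lambda>t. (P11 t, P12 t, P22 t)) \<and>
          unique_solution_on {0..T} (riccati_solution d T \<epsilon>)
            (\<lambda>t. block_mat (P11 t) (\<epsilon> *\<^sub>R P12 t) (\<epsilon> *\<^sub>R transpose (P12 t)) (\<epsilon> *\<^sub>R P22 t)) \<and>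
          (\<forall>t\<in>{0..T}.
            norm (block_mat (P11 t) (\<epsilon> *\<^sub>R P12 t) (\<epsilon> *\<^sub>R transpose (P12 t)) (\<epsilon> *\<^sub>R P22 t)
                  - block_mat (Pbar11 t) 0 0 0) \<le> C * \<epsilon>))))"
proof -
  interpret stable_riccati d Pbar22 \<gamma> \<delta>
  proof
    show "invertible (Delta2 d)" by (rule i)
    show "transpose Pbar22 = Pbar22" using ii(1) by (simp add: sym_mats_def)
    show "algebraic_riccati d Pbar22" by (rule ii(2))
    show "0 < \<gamma>" "0 < \<delta>" "\<delta> < \<gamma>" by (fact iv(1) v(1) v(2))+
    show "x \<bullet> (Smat d Pbar22 *v x) \<le> - \<gamma> * (norm x)\<^sup>2" for x
      using iv(2) unfolding psd_le_sym_part_iff by blast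
    show "- Pbar22 \<in> Bball d Pbar22 \<delta>"
      using v(3) interior_of_subset[of "top_of_set sym_mats" "Bball d Pbar22 \<delta>"] by blast
  qed
  have red: "reduced_solution d T Pbar11" using iii by (simp add: unique_solution_on_def)
  obtain \<Phi> \<kappa> Cp where \<Phi>: "unique_solution_on {0..} (boundary_layer_solution d Pbar22) \<Phi>"
    and \<kappa>: "0 < \<kappa>" and Cp: "0 \<le> Cp"
    and decay: "\<And>t. 0 \<le> t \<Longrightarrow> norm (fst (\<Phi> t)) \<le> Cp * exp (- \<kappa> * t)"
      "\<And>t. 0 \<le> t \<Longrightarrow> norm (snd (\<Phi> t)) \<le> Cp * exp (- \<kappa> * t)"
    using boundary_layer by blast
  have lay: "boundary_layer_solution d Pbar22 \<Phi>" using \<Phi> by (simp add: unique_solution_on_def)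
  have bounded_\<Phi>: "norm (fst (\<Phi> t)) \<le> Cp" "norm (snd (\<Phi> t)) \<le> Cp" if "0 \<le> t" for t
  proof -
    have "Cp * exp (- \<kappa> * t) \<le> Cp * 1" using Cp \<kappa> that by (intro mult_left_mono) auto
    then show "norm (fst (\<Phi> t)) \<le> Cp" "norm (snd (\<Phi> t)) \<le> Cp" using decay[OF that] by simp_all
  qed
  have "continuous_on {0..T} (\<lambda>t. h (Pbar11 t))"
    using red unfolding reduced_solution_def
    by (intro continuous_on_compose2[OF lip_bounded_continuous_on[OF lip_bounded_h[OF lip_bounded_ident], of UNIV]]) auto
  then obtain H where H: "\<And>t. t \<in> {0..T} \<Longrightarrow> norm (h (Pbar11 t)) \<le> H"
    using continuous_on_interval_bound by blast
  let ?near = "\<lambda>M P11 P12 P22 \<epsilon> t. norm (P11 t - Pbar11 t) \<le> M * \<epsilon> \<and>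
    norm (P12 t - h (Pbar11 t) - fst (\<Phi> ((T - t) / \<epsilon>))) \<le> M * \<epsilon> \<and>
    norm (P22 t - Pbar22 - snd (\<Phi> ((T - t) / \<epsilon>))) \<le> M * \<epsilon>"
  obtain \<epsilon>s M where \<epsilon>s: "0 < \<epsilon>s" "\<epsilon>s \<le> 1" and M: "0 \<le> M"
    and approx: "\<And>\<epsilon>. 0 < \<epsilon> \<Longrightarrow> \<epsilon> < \<epsilon>s \<Longrightarrow> \<exists>P11 P12 P22. full_solution d T \<epsilon> (\<lambda>t. (P11 t, P12 t, P22 t)) \<and> (\<forall>t\<in>{0..T}. ?near M P11 P12 P22 \<epsilon> t)"
    using tikhonov_approximation[OF \<open>0 < T\<close> assms(1,2) red lay \<kappa> Cp decay] by blast
  have unique_full: "unique_solution_on {0..T} (full_solution d T \<epsilon>) P"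
    if "0 < \<epsilon>" "full_solution d T \<epsilon> P" for \<epsilon> P
    unfolding unique_solution_on_def using that full_solution_unique by blast
  have bounds: "?near M P11 P12 P22 \<epsilon> t"
    if \<epsilon>: "0 < \<epsilon>" "\<epsilon> < \<epsilon>s" and sol: "full_solution d T \<epsilon> (\<lambda>t. (P11 t, P12 t, P22 t))" and t: "t \<in> {0..T}"
    for \<epsilon> P11 P12 P22 t
  proof -
    obtain R11 R12 R22 where R: "full_solution d T \<epsilon> (\<lambda>t. (R11 t, R12 t, R22 t))" "?near M R11 R12 R22 \<epsilon> t"
      using approx[OF \<epsilon>] t by blast
    have "(P11 t, P12 t, P22 t) = (R11 t, R12 t, R22 t)"
      by (rule full_solution_unique[OF \<epsilon>(1) sol R(1) t])
    then show ?thesis using R(2) by simp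
  qed
  have threshold: "tikhonov_threshold d T Pbar11 Pbar22 \<Phi> \<epsilon>s"
    unfolding tikhonov_threshold_def
  proof (intro conjI allI impI)
    show "\<exists>P. unique_solution_on {0..T} (full_solution d T \<epsilon>) P" if "0 < \<epsilon> \<and> \<epsilon> < \<epsilon>s" for \<epsilon>
      using that approx unique_full by blast
    show "\<exists>C. \<forall>\<epsilon> P11 P12 P22. 0 < \<epsilon> \<and> \<epsilon> < \<epsilon>s \<and> full_solution d T \<epsilon> (\<lambda>t. (P11 t, P12 t, P22 t)) \<longrightarrow>
        (\<forall>t\<in>{0..T}. ?near C P11 P12 P22 \<epsilon> t)"
      by (intro exI[of _ M]) (use bounds in blast)
  qed (use \<epsilon>s in auto)
  \<comment> \<open>only the \<open>P\<^sub>1\<^sub>1\<close> block needs the error estimate; the other blocks carry the factor \<open>\<epsilon>\<close> and are bounded,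
    since the outer solution, the layer and the error are\<close>
  define C where "C = M + (M + Cp + H) + (M + Cp + H) + (M + Cp + norm Pbar22)"
  have main: "\<exists>P11 P12 P22.
      unique_solution_on {0..T} (full_solution d T \<epsilon>) (\<lambda>t. (P11 t, P12 t, P22 t)) \<and>
      unique_solution_on {0..T} (riccati_solution d T \<epsilon>)
        (\<lambda>t. block_mat (P11 t) (\<epsilon> *\<^sub>R P12 t) (\<epsilon> *\<^sub>R transpose (P12 t)) (\<epsilon> *\<^sub>R P22 t)) \<and>
      (\<forall>t\<in>{0..T}. norm (block_mat (P11 t) (\<epsilon> *\<^sub>R P12 t) (\<epsilon> *\<^sub>R transpose (P12 t)) (\<epsilon> *\<^sub>R P22 t)
              - block_mat (Pbar11 t) 0 0 0) \<le> C * \<epsilon>)" if \<epsilon>: "0 < \<epsilon>" "\<epsilon> < \<epsilon>s" for \<epsilon>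
  proof -
    obtain P11 P12 P22 where sol: "full_solution d T \<epsilon> (\<lambda>t. (P11 t, P12 t, P22 t))"
      using approx[OF \<epsilon>] by blast
    define P where "P t = block_mat (P11 t) (\<epsilon> *\<^sub>R P12 t) (\<epsilon> *\<^sub>R transpose (P12 t)) (\<epsilon> *\<^sub>R P22 t)" for t
    have "riccati_solution d T \<epsilon> P"
      unfolding P_def by (rule full_imp_riccati_solution[OF \<epsilon>(1) assms(2) sol])
    moreover have "R t = P t" if R: "riccati_solution d T \<epsilon> R" and t: "t \<in> {0..T}" for R t
    proof -
      obtain R11 R12 R22 where full: "full_solution d T \<epsilon> (\<lambda>t. (R11 t, R12 t, R22 t))"
        and blocks: "\<And>t. t \<in> {0..T} \<Longrightarrow>
          R t = block_mat (R11 t) (\<epsilon> *\<^sub>R R12 t) (\<epsilon> *\<^sub>R transpose (R12 t)) (\<epsilon> *\<^sub>R R22 t)"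
        using riccati_imp_full_solution[OF \<epsilon>(1) assms(2) R] by blast
      have "(R11 t, R12 t, R22 t) = (P11 t, P12 t, P22 t)"
        by (rule full_solution_unique[OF \<epsilon>(1) full sol t])
      then show ?thesis using blocks[OF t] by (simp add: P_def)
    qed
    ultimately have "unique_solution_on {0..T} (riccati_solution d T \<epsilon>) P"
      by (auto simp: unique_solution_on_def)
    moreover have "norm (P t - block_mat (Pbar11 t) 0 0 0) \<le> C * \<epsilon>" if t: "t \<in> {0..T}" for t
    proof -
      note b = bounds[OF \<epsilon> sol t]
      have \<tau>: "0 \<le> (T - t) / \<epsilon>" using t \<epsilon>(1) by simp
      have "M * \<epsilon> \<le> M * 1" using M \<epsilon> \<epsilon>s by (intro mult_left_mono) auto
      then have M\<epsilon>: "M * \<epsilon> \<le> M" by simp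
      have "norm (P12 t) \<le> norm (P12 t - h (Pbar11 t) - fst (\<Phi> ((T - t) / \<epsilon>)))
          + norm (fst (\<Phi> ((T - t) / \<epsilon>)) + h (Pbar11 t))"
        using norm_triangle_ineq[of "P12 t - h (Pbar11 t) - fst (\<Phi> ((T - t) / \<epsilon>))"
            "fst (\<Phi> ((T - t) / \<epsilon>)) + h (Pbar11 t)"] by simp
      then have P12: "norm (P12 t) \<le> M + Cp + H"
        using b M\<epsilon> bounded_\<Phi>(1)[OF \<tau>] H[OF t]
          norm_triangle_ineq[of "fst (\<Phi> ((T - t) / \<epsilon>))" "h (Pbar11 t)"] by linarith
      have "norm (P22 t) \<le> norm (P22 t - Pbar22 - snd (\<Phi> ((T - t) / \<epsilon>)))
          + norm (snd (\<Phi> ((T - t) / \<epsilon>)) + Pbar22)"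
        using norm_triangle_ineq[of "P22 t - Pbar22 - snd (\<Phi> ((T - t) / \<epsilon>))"
            "snd (\<Phi> ((T - t) / \<epsilon>)) + Pbar22"] by simp
      then have P22: "norm (P22 t) \<le> M + Cp + norm Pbar22"
        using b M\<epsilon> bounded_\<Phi>(2)[OF \<tau>]
          norm_triangle_ineq[of "snd (\<Phi> ((T - t) / \<epsilon>))" Pbar22] by linarith
      have "norm (P t - block_mat (Pbar11 t) 0 0 0)
          \<le> norm (P11 t - Pbar11 t) + norm (\<epsilon> *\<^sub>R P12 t) + norm (\<epsilon> *\<^sub>R transpose (P12 t)) + norm (\<epsilon> *\<^sub>R P22 t)"
        unfolding P_def block_mat_diff diff_zero by (rule norm_block_mat_le)
      also have "\<dots> \<le> M * \<epsilon> + (M + Cp + H) * \<epsilon> + (M + Cp + H) * \<epsilon> + (M + Cp + norm Pbar22) * \<epsilon>"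
        using b P12 P22 \<epsilon>(1)
        by (intro add_mono) (simp_all add: norm_transpose mult.commute[of \<epsilon>] mult_right_mono)
      finally show ?thesis by (simp add: C_def algebra_simps)
    qed
    ultimately show ?thesis using unique_full[OF \<epsilon>(1) sol] unfolding P_def by blast
  qed
  show ?thesis
    using \<Phi> threshold main by blast
qed

end
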